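(* Let $\gamma>0$ and suppose the prior is $p(\theta)=\mathcal N(\theta\mid 0,\gamma I_d)$. Then the objective $$J(u)=\mathbb E_{\Theta\sim\mathbb Q^{u,\delta_0}}\left[\frac1{2\gamma}\int_0^1\|u(t,\Theta_t)\|^2dt-\ln\frac{p(X\mid\Theta_1)\,p(\Theta_1)}{\mathcal N(\Theta_1\mid 0,\gamma I_d)}\right],\qquad u\in\mathcal U,$$ equals the negative evidence lower bound (ELBO), with variational path measure $\mathbb Q^{u,\delta_0}$, of the latent diffusion model $$d\Theta_t=\sqrt\gamma\,dB_t,\quad\Theta_0\sim\delta_0,\qquad x_i\sim p(x_i\mid\Theta_1)\ \ (i=1,\dots,N).$$ That is, for every $u\in\mathcal U$, $$J(u)=-\Big(\mathbb E_{\Theta\sim\mathbb Q^{u,\delta_0}}\big[\ln p(X\mid\Theta_1)\big]-D_{\mathrm{KL}}\big(\mathbb Q^{u,\delta_0}\,\big\|\,\mathbb W^\gamma\big)\Big).$$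
   Context: A Bayesian model is given by a prior density $p(\theta)$ on $\mathbb R^d$ and a likelihood $p(X\mid\theta)=\prod_{i=1}^Np(x_i\mid\theta)$ for a fixed data set $X=\{x_i\}_{i=1}^N$. $B$ is a standard $d$-dimensional Brownian motion. For a drift $u:[0,1]\times\mathbb R^d\to\mathbb R^d$, $\mathbb Q^{u,\delta_0}$ is the law on $C([0,1],\mathbb R^d)$ of the solution of $d\Theta_t=u(t,\Theta_t)dt+\sqrt\gamma\,dB_t$, $\Theta_0=0$, and $\mathbb W^\gamma=\mathbb Q^{0,\delta_0}$ is the Wiener measure with variance $\gamma$. $\mathcal U$ is the set of admissible controls, which (under appropriate conditions on the model, assumed here) is the set of $C^1$ vector fields with at most linear growth in space. $D_{\mathrm{KL}}$ is the Kullback–Leibler divergence. The ELBO of a model with latent path $\Theta\sim\mathbb S$ and observations $X\sim p(X\mid\Theta_1)$, for a variational path measure $\mathbb Q$, is $\mathbb E_{\mathbb Q}[\ln p(X\mid\Theta_1)]-D_{\mathrm{KL}}(\mathbb Q\,\|\,\mathbb S)$. *)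

theory Defs
  imports "HOL-Probability.Probability"
begin

(* Density at x of the centred Gaussian with covariance v times the identity. *)
definition gaussian_density :: "real \<Rightarrow> 'a::euclidean_space \<Rightarrow> real" where
  "gaussian_density v x = (2 * pi * v) powr (- real DIM('a) / 2) * exp (- (norm x)\<^sup>2 / (2 * v))"

definition standard_brownian_motion ::
    "'w measure \<Rightarrow> (real \<Rightarrow> 'w \<Rightarrow> 'a::euclidean_space) \<Rightarrow> bool" where
  "standard_brownian_motion M B \<longleftrightarrow>
     prob_space M \<and>
     (\<forall>t\<ge>0. B t \<in> borel_measurable M) \<and>
     (\<forall>\<omega>\<in>space M. continuous_on {0..} (\<lambda>t. B t \<omega>)) \<and>
     (AE \<omega> in M. B 0 \<omega> = 0) \<and>
     (\<forall>s t. 0 \<le> s \<and> s < t \<longrightarrow>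
        distr M borel (\<lambda>\<omega>. B t \<omega> - B s \<omega>)
          = density lborel (\<lambda>x. ennreal (gaussian_density (t - s) x))) \<and>
     (\<forall>(n::nat) (\<tau>::nat \<Rightarrow> real). 0 \<le> \<tau> 0 \<and> mono \<tau> \<longrightarrow>
        prob_space.indep_vars M (\<lambda>_. borel)
          (\<lambda>i \<omega>. B (\<tau> (Suc i)) \<omega> - B (\<tau> i) \<omega>) {..<n})"

(* The space C([0,1], 'a); a path is represented by its extensional version (undefined outside
   [0,1]). The trace of the product sigma-algebra is the one generated by the evaluation maps,
   which is the Borel sigma-algebra of the uniform norm. *)
definition path_space :: "(real \<Rightarrow> 'a::euclidean_space) measure" where
  "path_space = restrict_space (PiM {0..1} (\<lambda>_. borel)) {w. continuous_on {0..1} w}"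

definition path_law ::
    "'w measure \<Rightarrow> (real \<Rightarrow> 'w \<Rightarrow> 'a::euclidean_space) \<Rightarrow> (real \<Rightarrow> 'a) measure" where
  "path_law M \<Theta> = distr M path_space (\<lambda>\<omega>. \<lambda>t\<in>{0..1}. \<Theta> t \<omega>)"

(* Theta solves d Theta_t = u(t, Theta_t) dt + sqrt gamma dB_t, Theta_0 = 0 on [0,1].
   The diffusion coefficient is constant, so its stochastic integral is sqrt gamma * B_t.
   Adaptedness is not required: for a drift that is locally Lipschitz in space (in particular
   for the admissible ones below) the equation has at most one continuous solution for each
   path of B, so that its solution is adapted up to null sets. *)
definition sde_solution ::
    "'w measure \<Rightarrow> (real \<Rightarrow> 'w \<Rightarrow> 'a::euclidean_space) \<Rightarrow> real \<Rightarrow> (real \<Rightarrow> 'a \<Rightarrow> 'a)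
       \<Rightarrow> (real \<Rightarrow> 'w \<Rightarrow> 'a) \<Rightarrow> bool" where
  "sde_solution M B \<gamma> u \<Theta> \<longleftrightarrow>
     (\<forall>t\<in>{0..1}. \<Theta> t \<in> borel_measurable M) \<and>
     (\<forall>\<omega>\<in>space M. continuous_on {0..1} (\<lambda>t. \<Theta> t \<omega>)) \<and>
     (AE \<omega> in M. \<Theta> 0 \<omega> = 0 \<and>
        (\<forall>t\<in>{0..1}. \<Theta> t \<omega> = (LBINT s:{0..t}. u s (\<Theta> s \<omega>)) + sqrt \<gamma> *\<^sub>R B t \<omega>))"

(* C^1 on [0,1] x 'a, jointly in time and space (one-sided time derivatives at 0 and 1). Only
   the values of u at times in [0,1] matter. *)
definition admissible_controls :: "(real \<Rightarrow> 'a::euclidean_space \<Rightarrow> 'a) set" where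
  "admissible_controls = {u.
     (\<exists>u' :: real \<times> 'a \<Rightarrow> (real \<times> 'a) \<Rightarrow>\<^sub>L 'a.
        (\<forall>z\<in>{0..1} \<times> UNIV.
           (case_prod u has_derivative blinfun_apply (u' z)) (at z within {0..1} \<times> UNIV)) \<and>
        continuous_on ({0..1} \<times> UNIV) u') \<and>
     (\<exists>C. \<forall>t\<in>{0..1}. \<forall>x. norm (u t x) \<le> C * (1 + norm x))}"

(* p y \<theta> is the density at y, with respect to \<nu>, of one observation given the parameter \<theta>. *)
definition observation_model ::
    "'x measure \<Rightarrow> ('x \<Rightarrow> 'a::euclidean_space \<Rightarrow> real) \<Rightarrow> bool" where
  "observation_model \<nu> p \<longleftrightarrow>
     (\<forall>y\<in>space \<nu>. \<forall>\<theta>. 0 \<le> p y \<theta>) \<and>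
     case_prod p \<in> borel_measurable (\<nu> \<Otimes>\<^sub>M borel) \<and>
     (\<forall>\<theta>. (\<integral>\<^sup>+ y. ennreal (p y \<theta>) \<partial>\<nu>) = 1)"

definition likelihood ::
    "('x \<Rightarrow> 'a \<Rightarrow> real) \<Rightarrow> nat \<Rightarrow> (nat \<Rightarrow> 'x) \<Rightarrow> 'a \<Rightarrow> real" where
  "likelihood p N x \<theta> = (\<Prod>i=1..N. p (x i) \<theta>)"

(* Logarithm of a nonnegative real with value -\<infinity> at 0 (the library has ln 0 = 0). *)
definition eln :: "real \<Rightarrow> ereal" where
  "eln r = (if r > 0 then ereal (ln r) else - \<infinity>)"

(* Expectation of an extended-real random variable, meaningful when the positive or the
   negative part has a finite integral. e2ennreal truncates negative values to 0. *)
definition eexpectation :: "'w measure \<Rightarrow> ('w \<Rightarrow> ereal) \<Rightarrow> ereal" where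
  "eexpectation M f =
     enn2ereal (\<integral>\<^sup>+ \<omega>. e2ennreal (f \<omega>) \<partial>M) - enn2ereal (\<integral>\<^sup>+ \<omega>. e2ennreal (- f \<omega>) \<partial>M)"

definition has_eexpectation :: "'w measure \<Rightarrow> ('w \<Rightarrow> ereal) \<Rightarrow> bool" where
  "has_eexpectation M f \<longleftrightarrow>
     (\<integral>\<^sup>+ \<omega>. e2ennreal (f \<omega>) \<partial>M) < \<infinity> \<or> (\<integral>\<^sup>+ \<omega>. e2ennreal (- f \<omega>) \<partial>M) < \<infinity>"

(* The divergence D(Q || P) of probability measures with values in [0,\<infinity>]. The library's real
   number KL_divergence b P Q, in which the reference measure comes first, is meaningful only
   if Q is absolutely continuous w.r.t. P and ln (dQ/dP) is Q-integrable; otherwise D(Q || P)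
   is infinite, as the negative part of ln (dQ/dP) always has a finite Q-integral. *)
definition KL :: "'w measure \<Rightarrow> 'w measure \<Rightarrow> ereal" where
  "KL Q P =
     (if absolutely_continuous P Q \<and> integrable Q (entropy_density (exp 1) P Q)
      then ereal (KL_divergence (exp 1) P Q) else \<infinity>)"

definition control_objective ::
    "real \<Rightarrow> ('a::euclidean_space \<Rightarrow> real) \<Rightarrow> ('a \<Rightarrow> real) \<Rightarrow> (real \<Rightarrow> 'a \<Rightarrow> 'a)
       \<Rightarrow> (real \<Rightarrow> 'a) measure \<Rightarrow> ereal" where
  "control_objective \<gamma> prior lik u Q =
     eexpectation Q (\<lambda>w.
       ereal (1 / (2 * \<gamma>) * (LBINT t:{0..1}. (norm (u t (w t)))\<^sup>2))
       - eln (lik (w 1) * prior (w 1) / gaussian_density \<gamma> (w 1)))"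

(* ELBO of the model with latent path law S and likelihood lik of the endpoint at time 1. *)
definition elbo ::
    "('a::euclidean_space \<Rightarrow> real) \<Rightarrow> (real \<Rightarrow> 'a) measure \<Rightarrow> (real \<Rightarrow> 'a) measure \<Rightarrow> ereal" where
  "elbo lik S Q = eexpectation Q (\<lambda>w. eln (lik (w 1))) - KL Q S"

end

theory Submission
  imports Defs
begin

text \<open>No stochastic integral is needed. The law of the Euler scheme that freezes the drift on the dyadic
  grid of mesh \<open>2\<^sup>-\<^sup>n\<close> has an explicit density \<open>L\<^sub>n\<close> with respect to the law \<open>P\<close> of \<open>sqrt \<gamma> B\<close>, by
  finitely many translations of Gaussian measures, and the relative entropy of two such laws is half
  the mean squared distance of their frozen drifts divided by \<open>\<gamma>\<close>. Since the schemes converge uniformly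
  to the solution, these entropies tend to \<open>0\<close>; hence \<open>L\<^sub>n\<close> is Cauchy in \<open>L\<^sup>1(P)\<close> and its limit \<open>L\<close> is the
  density of the law of the solution. Fatou's lemma bounds \<open>\<integral> L ln L dP\<close> above by the control cost, and
  Gibbs' inequality \<open>\<integral> L ln L\<^sub>n dP \<le> \<integral> L ln L dP\<close> bounds it below.\<close>

section \<open>Gaussian translations\<close>

text \<open>Linear growth of the drift gives second moments of the paths but no direct control of
  exponential moments. Densities are therefore never bounded; they are compared through the means of
  their logarithms under the law of a scheme, where a logarithm becomes quadratic terms plus a noise
  term of mean zero. Schemes of different mesh live on different grids, so each one carries two
  indices: \<open>a\<close> for freezing the drift and \<open>m \<ge> a\<close> for sampling the
  noise. Meshes \<open>a\<close> and \<open>c\<close> are compared on any common finer grid, and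
  refining \<open>m\<close> does not change the density. Small entropy yields small L1 distance
  through the Hellinger affinity: the tangent line of \<open>exp\<close> bounds the affinity below,
  and a weighted AM-GM inequality bounds the distance by it. Energies and exponents converge by
  dominated convergence, with one integrable function above the squared suprema of the Brownian
  path, of all schemes and of the solution; it comes from chaining, since only the laws of finitely
  many increments are given.\<close>

abbreviation gaussian_measure :: "real \<Rightarrow> 'a::euclidean_space measure" where
  "gaussian_measure v \<equiv> density lborel (\<lambda>x. ennreal (gaussian_density v x))"

lemma gaussian_density_nonneg [simp]: "0 \<le> gaussian_density v x"
  by (simp add: gaussian_density_def)

lemma borel_measurable_gaussian_density [measurable]: "gaussian_density v \<in> borel_measurable borel"
  unfolding gaussian_density_def by measurable

lemma gaussian_density_pos: "v > 0 \<Longrightarrow> gaussian_density v x > 0"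
  by (simp add: gaussian_density_def)

lemma gaussian_density_uminus: "gaussian_density v (- x) = gaussian_density v x"
  by (simp add: gaussian_density_def)

lemma gaussian_density_shift:
  assumes "v > 0"
  shows "gaussian_density v (x - c) = gaussian_density v x * exp ((x \<bullet> c - (norm c)\<^sup>2 / 2) / v)"
proof -
  have "- (norm (x - c))\<^sup>2 / (2 * v) = - (norm x)\<^sup>2 / (2 * v) + (x \<bullet> c - (norm c)\<^sup>2 / 2) / v"
    using assms by (simp add: power2_norm_eq_inner inner_diff inner_commute field_simps)
  then show ?thesis unfolding gaussian_density_def by (simp only: exp_add mult.assoc)
qed

lemma nn_integral_lborel_shift:
  fixes c :: "'a::euclidean_space"
  assumes [measurable]: "f \<in> borel_measurable borel"
  shows "(\<integral>\<^sup>+x. f (x + c) \<partial>lborel) = (\<integral>\<^sup>+x. f x \<partial>lborel)"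
proof -
  have "(\<integral>\<^sup>+x. f x \<partial>lborel) = (\<integral>\<^sup>+x. f x \<partial>distr lborel borel ((+) c))"
    by (simp add: lborel_distr_plus)
  also have "\<dots> = (\<integral>\<^sup>+x. f (x + c) \<partial>lborel)"
    by (subst nn_integral_distr) (simp_all add: add.commute)
  finally show ?thesis by simp
qed

lemma nn_integral_gaussian_shift:
  fixes c :: "'a::euclidean_space"
  assumes v: "v > 0" and [measurable]: "f \<in> borel_measurable borel"
  shows "(\<integral>\<^sup>+x. f (x + c) \<partial>gaussian_measure v)
       = (\<integral>\<^sup>+x. f x * ennreal (exp ((x \<bullet> c - (norm c)\<^sup>2 / 2) / v)) \<partial>gaussian_measure v)"
proof -
  have "(\<integral>\<^sup>+x. f (x + c) \<partial>gaussian_measure v)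
      = (\<integral>\<^sup>+x. ennreal (gaussian_density v ((x + c) - c)) * f (x + c) \<partial>lborel)"
    by (subst nn_integral_density) auto
  also have "\<dots> = (\<integral>\<^sup>+x. ennreal (gaussian_density v (x - c)) * f x \<partial>lborel)"
    by (rule nn_integral_lborel_shift) measurable
  also have "\<dots> = (\<integral>\<^sup>+x. f x * ennreal (exp ((x \<bullet> c - (norm c)\<^sup>2 / 2) / v)) \<partial>gaussian_measure v)"
    by (subst nn_integral_density)
       (auto simp: gaussian_density_shift[OF v] ennreal_mult mult_ac intro!: nn_integral_cong)
  finally show ?thesis .
qed

text \<open>The integrand is odd under the reflection \<open>x \<mapsto> - x\<close>, which
  preserves Lebesgue measure. The resulting equation \<open>?I = - ?I\<close> holds for the Bochner
  integral even before integrability is known.\<close>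

lemma integral_gaussian_inner:
  fixes c :: "'a::euclidean_space"
  shows "(\<integral>x. c \<bullet> x \<partial>gaussian_measure v) = 0"
proof -
  have refl: "distr lborel borel uminus = (lborel :: 'a measure)"
    using lborel_affine[of "-1" "0::'a"] by (simp add: density_1)
  let ?I = "\<integral>x. gaussian_density v x *\<^sub>R (c \<bullet> x) \<partial>lborel"
  have "?I = (\<integral>x. gaussian_density v x *\<^sub>R (c \<bullet> x) \<partial>distr lborel borel uminus)"
    by (simp add: refl)
  also have "\<dots> = (\<integral>x. gaussian_density v (-x) *\<^sub>R (c \<bullet> (-x)) \<partial>lborel)"
    by (rule integral_distr) measurable
  also have "\<dots> = - ?I" by (simp add: gaussian_density_uminus)
  finally have "?I = 0" by linarith
  then show ?thesis by (subst integral_density) auto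
qed

text \<open>Doubling the variance frees a factor \<open>exp (- y)\<close> with
  \<open>y = (norm x)\<^sup>2 / (4 * v)\<close>, which absorbs the power because
  \<open>y\<^sup>2 \<le> 2 * exp y\<close>. The constant 32 is 16 from
  \<open>(norm x)^4 = 16 * v\<^sup>2 * y\<^sup>2\<close> times this 2. Integrating the right side
  only needs the Gaussian to have mass 1.\<close>

lemma norm_power4_gaussian_le:
  fixes x :: "'a::euclidean_space"
  assumes v: "v > 0"
  shows "(norm x)^4 * gaussian_density v x
     \<le> 32 * 2 powr (real DIM('a) / 2) * v\<^sup>2 * gaussian_density (2 * v) x"
proof -
  define y where "y = (norm x)\<^sup>2 / (4 * v)"
  have y: "y \<ge> 0" using v by (simp add: y_def)
  have *: "(norm x)^4 = 16 * v\<^sup>2 * y\<^sup>2" using v by (simp add: y_def field_simps)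
  have e: "y\<^sup>2 \<le> 2 * exp y" using exp_lower_Taylor_quadratic[OF y] y by (simp add: field_simps)
  have d: "gaussian_density v x = 2 powr (real DIM('a) / 2) * gaussian_density (2 * v) x * exp (- y)"
  proof -
    have "(2 * pi * v) powr (- real DIM('a) / 2)
       = 2 powr (real DIM('a) / 2) * (2 * pi * (2 * v)) powr (- real DIM('a) / 2)"
    proof -
      have "(2 * pi * (2 * v)) powr (- real DIM('a) / 2)
          = 2 powr (- real DIM('a) / 2) * (2 * pi * v) powr (- real DIM('a) / 2)"
        using v powr_mult[of 2 "2 * pi * v" "- real DIM('a) / 2"] by (simp add: mult_ac)
      then show ?thesis by (simp add: powr_add[symmetric] flip: mult.assoc)
    qed
    moreover have "exp (- (norm x)\<^sup>2 / (2 * v)) = exp (- (norm x)\<^sup>2 / (2 * (2 * v))) * exp (- y)"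
      unfolding exp_add[symmetric] y_def using v by (intro arg_cong[of _ _ exp]) (simp add: field_simps)
    ultimately show ?thesis unfolding gaussian_density_def by (simp add: mult_ac)
  qed
  have "(norm x)^4 * gaussian_density v x
      = 16 * v\<^sup>2 * 2 powr (real DIM('a) / 2) * gaussian_density (2 * v) x * (y\<^sup>2 * exp (- y))"
    unfolding * d by (simp add: mult_ac)
  also have "\<dots> \<le> 16 * v\<^sup>2 * 2 powr (real DIM('a) / 2) * gaussian_density (2 * v) x * 2"
    using e by (intro mult_left_mono) (auto simp: exp_minus field_simps)
  finally show ?thesis by (simp add: mult_ac)
qed

text \<open>The Euler recursion written for increments: each new coordinate is the noise plus a
  shift depending on the coordinates already shifted. Starting from \<open>undefined\<close> keeps
  the result extensional, hence a point of the product space over \<open>{..<n}\<close>.\<close>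

fun triangular_shift :: "(nat \<Rightarrow> (nat \<Rightarrow> 'a) \<Rightarrow> 'a) \<Rightarrow> (nat \<Rightarrow> 'a::plus) \<Rightarrow> nat \<Rightarrow> nat \<Rightarrow> 'a" where
  "triangular_shift d \<xi> 0 = (\<lambda>_. undefined)"
| "triangular_shift d \<xi> (Suc n) = (triangular_shift d \<xi> n)(n := \<xi> n + d n (triangular_shift d \<xi> n))"

lemma triangular_shift_cong:
  "(\<And>k. k < n \<Longrightarrow> \<xi> k = \<xi>' k) \<Longrightarrow> triangular_shift d \<xi> n = triangular_shift d \<xi>' n"
  by (induction n) auto

lemma triangular_shift_nth:
  "k < n \<Longrightarrow> triangular_shift d \<xi> n k = \<xi> k + d k (triangular_shift d \<xi> k)"
  by (induction n) (auto simp: less_Suc_eq)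

lemma triangular_shift_extensional: "triangular_shift d \<xi> n \<in> extensional {..<n}"
  by (induction n) (auto simp: extensional_def)

lemma restrict_triangular_shift:
  "k \<le> n \<Longrightarrow> restrict (triangular_shift d \<xi> n) {..<k} = triangular_shift d \<xi> k"
  using triangular_shift_extensional[of d \<xi> k]
  by (auto simp: fun_eq_iff restrict_def triangular_shift_nth extensional_def)

lemma measurable_triangular_shift:
  fixes d :: "nat \<Rightarrow> (nat \<Rightarrow> 'a::euclidean_space) \<Rightarrow> 'a"
  assumes "\<And>k. k < n \<Longrightarrow> d k \<in> borel_measurable (PiM {..<k} (\<lambda>_. borel))" "{..<n} \<subseteq> I"
  shows "(\<lambda>\<xi>. triangular_shift d \<xi> n) \<in> PiM I (\<lambda>_. borel) \<rightarrow>\<^sub>M PiM {..<n} (\<lambda>_. borel)"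
  using assms
proof (induction n)
  case 0
  then show ?case by (intro measurable_PiM_single') auto
next
  case (Suc n)
  have IH[measurable]: "(\<lambda>\<xi>. triangular_shift d \<xi> n) \<in> PiM I (\<lambda>_. borel) \<rightarrow>\<^sub>M PiM {..<n} (\<lambda>_. borel)"
    by (rule Suc.IH) (use Suc.prems in auto)
  have [measurable]: "d n \<in> borel_measurable (PiM {..<n} (\<lambda>_. borel))" using Suc by auto
  have [measurable]: "(\<lambda>\<xi>. \<xi> n) \<in> PiM I (\<lambda>_. borel) \<rightarrow>\<^sub>M (borel :: 'a measure)"
    using Suc.prems by (intro measurable_component_singleton) auto
  show ?case unfolding triangular_shift.simps
    by (rule measurable_fun_upd[where J="{..<n}"]) (auto simp: lessThan_Suc)
qed

text \<open>Girsanov's theorem in discrete time: given the past, the last step is a translation of a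
  Gaussian measure.\<close>

proposition nn_integral_triangular_shift:
  fixes d :: "nat \<Rightarrow> (nat \<Rightarrow> 'a::euclidean_space) \<Rightarrow> 'a"
  assumes v: "v > 0" and prob: "prob_space (gaussian_measure v :: 'a measure)"
    and d: "\<And>k. k < n \<Longrightarrow> d k \<in> borel_measurable (PiM {..<k} (\<lambda>_. borel))"
    and f: "f \<in> borel_measurable (PiM {..<n} (\<lambda>_. borel))"
  shows "(\<integral>\<^sup>+\<xi>. f (triangular_shift d \<xi> n) \<partial>PiM {..<n} (\<lambda>_. gaussian_measure v))
       = (\<integral>\<^sup>+\<eta>. f \<eta> * ennreal (exp ((\<Sum>k<n. \<eta> k \<bullet> d k (restrict \<eta> {..<k})
             - (norm (d k (restrict \<eta> {..<k})))\<^sup>2 / 2) / v)) \<partial>PiM {..<n} (\<lambda>_. gaussian_measure v))"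
  using d f
proof (induction n arbitrary: f)
  case 0
  show ?case
    by (intro nn_integral_cong) (auto simp: space_PiM)
next
  case (Suc n)
  interpret prob_space "gaussian_measure v :: 'a measure" by (rule prob)
  interpret product_sigma_finite "\<lambda>_::nat. gaussian_measure v :: 'a measure" ..
  define D where "D k \<eta> = d k (restrict \<eta> {..<k})" for k \<eta>
  define \<rho> where "\<rho> m \<eta> = ennreal (exp ((\<Sum>k<m. \<eta> k \<bullet> D k \<eta> - (norm (D k \<eta>))\<^sup>2 / 2) / v))" for m \<eta>
  note Suc.prems(2)[unfolded lessThan_Suc, measurable]
  have dm[measurable]: "d k \<in> borel_measurable (PiM {..<k} (\<lambda>_. borel))" if "k \<le> n" for k
    using Suc.prems(1) that by auto
  have dm'[measurable]: "d n \<in> borel_measurable (PiM {..<n} (\<lambda>_. borel))" by (rule dm) simp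
  have D: "(\<lambda>\<eta>. D k \<eta>) \<in> borel_measurable (PiM {..<m} (\<lambda>_. borel))" if "k \<le> n" "k \<le> m" for k m
    unfolding D_def
    by (rule measurable_compose[OF measurable_restrict_subset dm]) (use that in auto)
  have \<rho>: "\<rho> m \<in> borel_measurable (PiM {..<m} (\<lambda>_. borel))" if "m \<le> Suc n" for m
    unfolding \<rho>_def using that
    by (intro measurable_compose[OF _ measurable_ennreal] borel_measurable_exp
          measurable_compose[OF _ borel_measurable_exp] borel_measurable_divide borel_measurable_sum
          borel_measurable_diff borel_measurable_inner borel_measurable_power borel_measurable_norm
          measurable_compose[OF D borel_measurable_norm] D measurable_component_singleton) auto
  note [measurable] = \<rho>[of n, simplified] \<rho>[of "Suc n", simplified, unfolded lessThan_Suc]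
  have tri[measurable]: "(\<lambda>\<xi>. triangular_shift d \<xi> n)
      \<in> PiM (insert n {..<n}) (\<lambda>_. borel) \<rightarrow>\<^sub>M PiM {..<n} (\<lambda>_. borel)"
    by (rule measurable_triangular_shift) (auto intro: dm)
  have triS[measurable]: "(\<lambda>\<xi>. triangular_shift d \<xi> (Suc n))
      \<in> PiM (insert n {..<n}) (\<lambda>_. borel) \<rightarrow>\<^sub>M PiM (insert n {..<n}) (\<lambda>_. borel)"
    unfolding lessThan_Suc[symmetric] by (rule measurable_triangular_shift) (auto intro: dm)
  have upd[measurable]: "(\<lambda>(\<eta>, y). f (\<eta>(n := y))) \<in> borel_measurable (PiM {..<n} (\<lambda>_. borel) \<Otimes>\<^sub>M borel)"
    by measurable
  \<comment> \<open>The newest coordinate is integrated out with its past fixed. The induction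
    hypothesis is then applied to \<open>h\<close>, a function of the first \<open>n\<close>
    coordinates, instead of \<open>f\<close>.\<close>
  define h where "h \<eta> = (\<integral>\<^sup>+y. f (\<eta>(n := y + d n \<eta>)) \<partial>gaussian_measure v)" for \<eta>
  have h[measurable]: "h \<in> borel_measurable (PiM {..<n} (\<lambda>_. borel))"
    unfolding h_def
  proof (rule borel_measurable_nn_integral)
    show "(\<lambda>(\<eta>, y). f (\<eta>(n := y + d n \<eta>))) \<in> borel_measurable (PiM {..<n} (\<lambda>_. borel) \<Otimes>\<^sub>M gaussian_measure v)"
      using measurable_compose[OF _ upd, of "\<lambda>(\<eta>, y). (\<eta>, y + d n \<eta>)" "PiM {..<n} (\<lambda>_. borel) \<Otimes>\<^sub>M gaussian_measure v"]
      by (simp add: case_prod_beta')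
  qed
  have "(\<integral>\<^sup>+\<xi>. f (triangular_shift d \<xi> (Suc n)) \<partial>PiM {..<Suc n} (\<lambda>_. gaussian_measure v))
     = (\<integral>\<^sup>+\<xi>. \<integral>\<^sup>+y. f ((triangular_shift d \<xi> n)(n := y + d n (triangular_shift d \<xi> n)))
           \<partial>gaussian_measure v \<partial>PiM {..<n} (\<lambda>_. gaussian_measure v))"
    unfolding lessThan_Suc
  proof (subst product_nn_integral_insert)
    show "(\<lambda>\<xi>. f (triangular_shift d \<xi> (Suc n))) \<in> borel_measurable (PiM (insert n {..<n}) (\<lambda>i. gaussian_measure v))"
      by measurable
  qed (auto cong: triangular_shift_cong)
  also have "\<dots> = (\<integral>\<^sup>+\<xi>. h (triangular_shift d \<xi> n) \<partial>PiM {..<n} (\<lambda>_. gaussian_measure v))"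
    by (simp add: h_def)
  also have "\<dots> = (\<integral>\<^sup>+\<eta>. h \<eta> * \<rho> n \<eta> \<partial>PiM {..<n} (\<lambda>_. gaussian_measure v))"
    unfolding \<rho>_def D_def by (rule Suc.IH) (auto intro: Suc.prems h)
  also have "\<dots> = (\<integral>\<^sup>+\<eta>. \<integral>\<^sup>+y. f (\<eta>(n := y)) * \<rho> (Suc n) (\<eta>(n := y))
      \<partial>gaussian_measure v \<partial>PiM {..<n} (\<lambda>_. gaussian_measure v))"
  proof (rule nn_integral_cong)
    fix \<eta> :: "nat \<Rightarrow> 'a" assume \<eta>: "\<eta> \<in> space (PiM {..<n} (\<lambda>_. gaussian_measure v))"
    have [measurable]: "(\<lambda>y. f (\<eta>(n := y))) \<in> borel_measurable borel"
    proof -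
      have "\<eta> \<in> space (PiM {..<n} (\<lambda>_. borel))" using \<eta> by (simp add: space_PiM)
      then show ?thesis using upd by (auto dest: measurable_Pair2)
    qed
    have r: "restrict \<eta> {..<n} = \<eta>" using \<eta> by (auto simp: space_PiM restrict_def fun_eq_iff PiE_iff extensional_def)
    have r': "restrict (\<eta>(n := y)) {..<k} = restrict \<eta> {..<k}" if "k \<le> n" for k y
      using that by (auto simp: restrict_def fun_eq_iff)
    have Dk: "D k (\<eta>(n := y)) = D k \<eta>" if "k \<le> n" for k y using r'[OF that] by (simp add: D_def)
    have Dn: "D n \<eta> = d n \<eta>" by (simp add: D_def r)
    \<comment> \<open>Shifts up to index \<open>n\<close> do not see coordinate \<open>n\<close>, so
      the density of the past is constant in \<open>y\<close> and leaves the inner integral.\<close>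
    have \<rho>S: "\<rho> (Suc n) (\<eta>(n := y)) = ennreal (exp ((y \<bullet> d n \<eta> - (norm (d n \<eta>))\<^sup>2 / 2) / v)) * \<rho> n \<eta>" for y
      unfolding \<rho>_def by (simp add: Dk Dn exp_add add_divide_distrib ennreal_mult mult.commute)
    have "h \<eta> = (\<integral>\<^sup>+y. f (\<eta>(n := y)) * ennreal (exp ((y \<bullet> d n \<eta> - (norm (d n \<eta>))\<^sup>2 / 2) / v)) \<partial>gaussian_measure v)"
      unfolding h_def by (rule nn_integral_gaussian_shift[OF v]) measurable
    then show "h \<eta> * \<rho> n \<eta> = (\<integral>\<^sup>+y. f (\<eta>(n := y)) * \<rho> (Suc n) (\<eta>(n := y)) \<partial>gaussian_measure v)"
      by (simp add: \<rho>S nn_integral_multc[symmetric] mult.assoc)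
  qed
  also have "\<dots> = (\<integral>\<^sup>+\<eta>. f \<eta> * \<rho> (Suc n) \<eta> \<partial>PiM {..<Suc n} (\<lambda>_. gaussian_measure v))"
    unfolding lessThan_Suc by (subst product_nn_integral_insert) auto
  finally show ?case unfolding \<rho>_def D_def .
qed

section \<open>Brownian motion on dyadic grids\<close>

definition dyadic_index :: "nat \<Rightarrow> real \<Rightarrow> nat" where
  "dyadic_index n t = nat \<lfloor>t * 2 ^ n\<rfloor>"

definition dyadic_floor :: "nat \<Rightarrow> real \<Rightarrow> real" where
  "dyadic_floor n t = real (dyadic_index n t) / 2 ^ n"

lemma dyadic_floor_bounds:
  assumes "0 \<le> t"
  shows "0 \<le> dyadic_floor n t" "dyadic_floor n t \<le> t" "t < dyadic_floor n t + 1 / 2 ^ n"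
proof -
  have e: "real (dyadic_index n t) = of_int \<lfloor>t * 2 ^ n\<rfloor>" using assms by (simp add: dyadic_index_def)
  have "of_int \<lfloor>t * 2 ^ n\<rfloor> \<le> t * 2 ^ n" "t * 2 ^ n < of_int \<lfloor>t * 2 ^ n\<rfloor> + 1" by linarith+
  then show "0 \<le> dyadic_floor n t" "dyadic_floor n t \<le> t" "t < dyadic_floor n t + 1 / 2 ^ n"
    using assms by (simp_all add: dyadic_floor_def e field_simps)
qed

lemma dyadic_index_le:
  assumes "0 \<le> t" "t \<le> 1"
  shows "dyadic_index n t \<le> 2 ^ n"
proof -
  have "t * 2 ^ n \<le> 1 * 2 ^ n" using assms by (intro mult_right_mono) auto
  then have "\<lfloor>t * 2 ^ n\<rfloor> \<le> \<lfloor>2 ^ n :: real\<rfloor>" by (intro floor_mono) simp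
  also have "\<lfloor>2 ^ n :: real\<rfloor> = 2 ^ n" by (metis floor_of_int of_int_numeral of_int_power)
  finally have "\<lfloor>t * 2 ^ n\<rfloor> \<le> 2 ^ n" .
  then show ?thesis by (simp add: dyadic_index_def nat_le_iff)
qed

lemma dyadic_floor_mem: "t \<in> {0..1} \<Longrightarrow> dyadic_floor n t \<in> {0..1}"
  using dyadic_floor_bounds[of t n] by auto

lemma dyadic_index_grid [simp]: "dyadic_index n (real k / 2 ^ n) = k"
  by (simp add: dyadic_index_def)

lemma tendsto_dyadic_floor:
  assumes "0 \<le> t"
  shows "(\<lambda>n. dyadic_floor n t) \<longlonglongrightarrow> t"
proof (rule tendsto_sandwich[OF _ _ _ tendsto_const])
  show "\<forall>\<^sub>F n in sequentially. t - (1/2)^n \<le> dyadic_floor n t"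
    using dyadic_floor_bounds(3)[OF assms] by (auto simp: power_one_over intro!: always_eventually less_imp_le) (smt (verit))
  show "\<forall>\<^sub>F n in sequentially. dyadic_floor n t \<le> t"
    using dyadic_floor_bounds(2)[OF assms] by auto
  have "(\<lambda>n. t - (1/2)^n) \<longlonglongrightarrow> t - 0" by (intro tendsto_intros LIMSEQ_power_zero) auto
  then show "(\<lambda>n. t - (1/2)^n) \<longlonglongrightarrow> t" by simp
qed

locale brownian_motion = prob_space M for M :: "'w measure" +
  fixes B :: "real \<Rightarrow> 'w \<Rightarrow> 'a::euclidean_space"
  assumes brownian: "standard_brownian_motion M B"
begin

lemma measurable_B [measurable]: "0 \<le> t \<Longrightarrow> B t \<in> borel_measurable M"
  using brownian by (simp add: standard_brownian_motion_def)

lemma continuous_B: "\<omega> \<in> space M \<Longrightarrow> continuous_on {0..} (\<lambda>t. B t \<omega>)"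
  using brownian by (simp add: standard_brownian_motion_def)

lemma AE_B_0: "AE \<omega> in M. B 0 \<omega> = 0"
  using brownian by (simp add: standard_brownian_motion_def)

lemma distr_increment:
  "0 \<le> s \<Longrightarrow> s < t \<Longrightarrow> distr M borel (\<lambda>\<omega>. B t \<omega> - B s \<omega>) = gaussian_measure (t - s)"
  using brownian by (simp add: standard_brownian_motion_def)

text \<open>The normalisation of the Gaussian density is not computed: it is read off from the law
  of a Brownian increment of length \<open>v\<close>.\<close>

lemma prob_space_gaussian_measure:
  assumes "v > 0"
  shows "prob_space (gaussian_measure v :: 'a measure)"
  using distr_increment[of 0 v] assms prob_space_distr[of "\<lambda>\<omega>. B v \<omega> - B 0 \<omega>" borel] by simp

definition increment :: "nat \<Rightarrow> nat \<Rightarrow> 'w \<Rightarrow> 'a" where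
  "increment m k \<omega> = B (real (Suc k) / 2 ^ m) \<omega> - B (real k / 2 ^ m) \<omega>"

lemma measurable_increment [measurable]: "increment m k \<in> borel_measurable M"
  unfolding increment_def by measurable

lemma distr_dyadic_increment: "distr M borel (increment m k) = gaussian_measure (1 / 2 ^ m)"
proof -
  have "real k / 2 ^ m < real (Suc k) / 2 ^ m" by (intro divide_strict_right_mono) auto
  moreover have "real (Suc k) / 2 ^ m - real k / 2 ^ m = 1 / 2 ^ m"
    by (simp add: add_divide_distrib)
  ultimately show ?thesis
    using distr_increment[of "real k / 2 ^ m" "real (Suc k) / 2 ^ m"] unfolding increment_def by simp
qed

lemma distr_increments:
  assumes "n > 0"
  shows "distr M (PiM {..<n} (\<lambda>_. borel)) (\<lambda>\<omega>. \<lambda>k\<in>{..<n}. increment m k \<omega>)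
       = PiM {..<n} (\<lambda>_. gaussian_measure (1 / 2 ^ m))"
proof -
  have *: "indep_vars (\<lambda>_. borel) (\<lambda>i \<omega>. B (\<tau> (Suc i)) \<omega> - B (\<tau> i) \<omega>) {..<n}"
    if "0 \<le> \<tau> 0" "mono \<tau>" for n and \<tau> :: "nat \<Rightarrow> real"
    using brownian that by (simp add: standard_brownian_motion_def)
  have "mono (\<lambda>k. real k / 2 ^ m)" by (auto simp: mono_def divide_right_mono)
  then have "indep_vars (\<lambda>_. borel) (increment m) {..<n}"
    unfolding increment_def[abs_def] by (intro *) auto
  then have "distr M (PiM {..<n} (\<lambda>_. borel)) (\<lambda>\<omega>. \<lambda>k\<in>{..<n}. increment m k \<omega>)
     = PiM {..<n} (\<lambda>k. distr M borel (increment m k))"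
    using assms by (subst (asm) indep_vars_iff_distr_eq_PiM') auto
  then show ?thesis by (simp add: distr_dyadic_increment)
qed

text \<open>The discrete form of the fact that a stochastic integral has mean zero: by Fubini the
  newest increment is integrated first, and it is centred while the factor built from the past stays
  fixed.\<close>

lemma expectation_past_increment:
  assumes \<psi>[measurable]: "\<psi> \<in> borel_measurable (PiM {..<k} (\<lambda>_. borel))"
    and int: "integrable M (\<lambda>\<omega>. \<psi> (\<lambda>j\<in>{..<k}. increment m j \<omega>) \<bullet> increment m k \<omega>)"
  shows "expectation (\<lambda>\<omega>. \<psi> (\<lambda>j\<in>{..<k}. increment m j \<omega>) \<bullet> increment m k \<omega>) = 0"
proof -
  let ?\<mu> = "gaussian_measure (1 / 2 ^ m) :: 'a measure"
  let ?f = "\<lambda>\<eta>. \<psi> (restrict \<eta> {..<k}) \<bullet> \<eta> k"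
  interpret \<mu>: prob_space ?\<mu> by (rule prob_space_gaussian_measure) simp
  interpret product_sigma_finite "\<lambda>_::nat. ?\<mu>" ..
  have [measurable]: "(\<lambda>\<eta>. restrict \<eta> {..<k}) \<in> PiM {..<Suc k} (\<lambda>_. borel) \<rightarrow>\<^sub>M PiM {..<k} (\<lambda>_. borel::'a measure)"
    by (rule measurable_restrict_subset) auto
  have f: "?f \<in> borel_measurable (PiM {..<Suc k} (\<lambda>_. borel))" by measurable
  have f_inc: "?f (\<lambda>j\<in>{..<Suc k}. increment m j \<omega>) = \<psi> (\<lambda>j\<in>{..<k}. increment m j \<omega>) \<bullet> increment m k \<omega>" for \<omega>
  proof -
    have "restrict (\<lambda>j\<in>{..<Suc k}. increment m j \<omega>) {..<k} = (\<lambda>j\<in>{..<k}. increment m j \<omega>)"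
      by (auto simp: fun_eq_iff restrict_def)
    then show ?thesis by simp
  qed
  have "integrable (distr M (PiM {..<Suc k} (\<lambda>_. borel)) (\<lambda>\<omega>. \<lambda>k\<in>{..<Suc k}. increment m k \<omega>)) ?f"
    using int by (subst integrable_distr_eq[OF _ f]) (measurable, simp only: f_inc)
  then have int': "integrable (PiM (insert k {..<k}) (\<lambda>_. ?\<mu>)) ?f"
    unfolding distr_increments[OF zero_less_Suc] unfolding lessThan_Suc .
  have "expectation (\<lambda>\<omega>. \<psi> (\<lambda>j\<in>{..<k}. increment m j \<omega>) \<bullet> increment m k \<omega>)
      = integral\<^sup>L (distr M (PiM {..<Suc k} (\<lambda>_. borel)) (\<lambda>\<omega>. \<lambda>k\<in>{..<Suc k}. increment m k \<omega>)) ?f"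
    by (subst integral_distr[OF _ f]) (measurable, simp only: f_inc)
  also have "\<dots> = integral\<^sup>L (PiM (insert k {..<k}) (\<lambda>_. ?\<mu>)) ?f"
    unfolding distr_increments[OF zero_less_Suc] unfolding lessThan_Suc ..
  also have "\<dots> = (\<integral>\<eta>. (\<integral>y. ?f (\<eta>(k := y)) \<partial>?\<mu>) \<partial>PiM {..<k} (\<lambda>_. ?\<mu>))"
    by (rule product_integral_insert[OF _ _ int']) auto
  also have "\<dots> = (\<integral>\<eta>. 0 \<partial>PiM {..<k} (\<lambda>_. ?\<mu>))"
  proof (rule Bochner_Integration.integral_cong[OF refl])
    fix \<eta> :: "nat \<Rightarrow> 'a"
    have "(\<integral>y. ?f (\<eta>(k := y)) \<partial>?\<mu>) = (\<integral>y. \<psi> (restrict \<eta> {..<k}) \<bullet> y \<partial>?\<mu>)"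
      by (intro Bochner_Integration.integral_cong refl) (auto intro!: arg_cong2[of _ _ _ _ inner] arg_cong[of _ _ \<psi>])
    also have "\<dots> = 0" by (rule integral_gaussian_inner)
    finally show "(\<integral>y. ?f (\<eta>(k := y)) \<partial>?\<mu>) = 0" .
  qed
  finally show ?thesis by simp
qed

section \<open>Fourth moments of increments and the supremum of the Brownian path\<close>

definition increment_moment :: real where
  "increment_moment = 32 * 2 powr (real DIM('a) / 2)"

lemma nn_integral_increment_power4:
  "(\<integral>\<^sup>+\<omega>. ennreal ((norm (increment m k \<omega>))^4) \<partial>M) \<le> ennreal (increment_moment / 4 ^ m)"
proof -
  let ?v = "1 / 2 ^ m :: real"
  have v2: "?v\<^sup>2 = 1 / 4 ^ m"
    by (simp add: power_divide power2_eq_square flip: power_mult_distrib)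
  interpret \<mu>: prob_space "gaussian_measure (2 * ?v) :: 'a measure" by (rule prob_space_gaussian_measure) simp
  have "(\<integral>\<^sup>+\<omega>. ennreal ((norm (increment m k \<omega>))^4) \<partial>M)
     = (\<integral>\<^sup>+x. ennreal ((norm x)^4) \<partial>distr M borel (increment m k))"
    by (subst nn_integral_distr) auto
  also have "\<dots> = (\<integral>\<^sup>+x. ennreal ((norm (x::'a))^4 * gaussian_density ?v x) \<partial>lborel)"
    by (subst distr_dyadic_increment, subst nn_integral_density) (auto simp: ennreal_mult mult.commute)
  also have "\<dots> \<le> (\<integral>\<^sup>+x. ennreal (32 * 2 powr (real DIM('a) / 2) * ?v\<^sup>2) * ennreal (gaussian_density (2 * ?v) (x::'a)) \<partial>lborel)"
    using norm_power4_gaussian_le[of ?v]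
    by (intro nn_integral_mono) (simp add: ennreal_mult[symmetric] ennreal_leI)
  also have "\<dots> = ennreal (32 * 2 powr (real DIM('a) / 2) * ?v\<^sup>2) * (\<integral>\<^sup>+x. ennreal (gaussian_density (2 * ?v) (x::'a)) \<partial>lborel)"
    by (rule nn_integral_cmult) measurable
  also have "(\<integral>\<^sup>+x. ennreal (gaussian_density (2 * ?v) (x::'a)) \<partial>lborel) = emeasure (gaussian_measure (2 * ?v) :: 'a measure) UNIV"
    by (subst emeasure_density) (auto)
  also have "\<dots> = 1" using \<mu>.emeasure_space_1 by simp
  finally show ?thesis 
    by (simp only: increment_moment_def v2 mult.assoc) simp
qed

text \<open>An upper bound for the largest squared increment of level \<open>j\<close>, from
  \<open>y \<le> a + y\<^sup>2 / a\<close> with \<open>a = (2/3)^j\<close> and the maximum of the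
  fourth powers replaced by their sum. There are \<open>2^j\<close> increments with fourth moment of
  order \<open>4^(-j)\<close>, so the mean is of order \<open>(2/3)^j + (3/4)^j\<close>; this still
  decays after the factor \<open>(5/4)^j\<close> used for the chaining sum.\<close>

definition chaining_weight :: "nat \<Rightarrow> 'w \<Rightarrow> real" where
  "chaining_weight j \<omega> = (2/3)^j + (3/2)^j * (\<Sum>k<2^j. (norm (increment j k \<omega>))^4)"

lemma chaining_weight_nonneg: "0 \<le> chaining_weight j \<omega>"
  by (auto simp: chaining_weight_def intro!: add_nonneg_nonneg mult_nonneg_nonneg sum_nonneg)

lemma measurable_chaining_weight [measurable]: "chaining_weight j \<in> borel_measurable M"
  unfolding chaining_weight_def by measurable

lemma increment_le_chaining_weight:
  assumes "k < 2 ^ j"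
  shows "(norm (increment j k \<omega>))\<^sup>2 \<le> chaining_weight j \<omega>"
proof -
  define a :: real where "a = (2/3)^j"
  define y where "y = (norm (increment j k \<omega>))\<^sup>2"
  have a: "a > 0" by (simp add: a_def)
  have ia: "(3/2)^j = 1 / a" by (simp add: a_def power_divide)
  have "(norm (increment j k \<omega>))^4 \<le> (\<Sum>k<2^j. (norm (increment j k \<omega>))^4)"
    by (rule member_le_sum) (use assms in auto)
  then have "y\<^sup>2 / a \<le> (3/2)^j * (\<Sum>k<2^j. (norm (increment j k \<omega>))^4)"
    using a by (simp add: ia y_def divide_right_mono)
  moreover have "y \<le> a + y\<^sup>2 / a"
  proof (cases "y \<le> a")
    case True then show ?thesis using a by (simp add: add_increasing2)
  next
    case False
    then have "y * a \<le> y * y" using a by (intro mult_left_mono) auto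
    then have "y \<le> y\<^sup>2 / a" using a by (simp add: power2_eq_square field_simps)
    then show ?thesis using a by simp
  qed
  ultimately show ?thesis unfolding chaining_weight_def y_def a_def by linarith
qed

lemma norm_B_dyadic_le:
  assumes "B 0 \<omega> = 0" "k \<le> 2 ^ n"
  shows "norm (B (real k / 2 ^ n) \<omega>) \<le> (\<Sum>j\<le>n. sqrt (chaining_weight j \<omega>))"
  using assms(2)
proof (induction n arbitrary: k)
  case 0
  have w: "norm (increment 0 0 \<omega>) \<le> sqrt (chaining_weight 0 \<omega>)"
    using increment_le_chaining_weight[of 0 0 \<omega>] by (intro real_le_rsqrt) simp
  from 0 consider "k = 0" | "k = 1" by fastforce
  then show ?case using w assms(1) chaining_weight_nonneg[of 0 \<omega>] by cases (auto simp: increment_def)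
next
  case (Suc n)
  have nn: "0 \<le> sqrt (chaining_weight (Suc n) \<omega>)" by (simp add: chaining_weight_nonneg)
  have eq: "real (2 * i) / 2 ^ Suc n = real i / 2 ^ n" for i by simp
  show ?case
  proof (cases "even k")
    case True
    then obtain i where k: "k = 2 * i" by blast
    have "norm (B (real i / 2 ^ n) \<omega>) \<le> (\<Sum>j\<le>n. sqrt (chaining_weight j \<omega>))"
      using Suc.prems k by (intro Suc.IH) simp
    then show ?thesis using nn unfolding k eq sum.atMost_Suc by linarith
  next
    case False
    then obtain i where k: "k = Suc (2 * i)" by (metis oddE Suc_eq_plus1)
    have "Suc (2 * i) \<le> 2 * 2 ^ n" using Suc.prems k by simp
    then have i: "2 * i < 2 ^ Suc n" "i \<le> 2 ^ n" by auto
    have "norm (increment (Suc n) (2 * i) \<omega>) \<le> sqrt (chaining_weight (Suc n) \<omega>)"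
      using increment_le_chaining_weight[OF i(1)] by (intro real_le_rsqrt) simp
    moreover have "norm (B (real i / 2 ^ n) \<omega>) \<le> (\<Sum>j\<le>n. sqrt (chaining_weight j \<omega>))"
      by (rule Suc.IH[OF i(2)])
    moreover have "B (real k / 2 ^ Suc n) \<omega> = B (real i / 2 ^ n) \<omega> + increment (Suc n) (2 * i) \<omega>"
      unfolding increment_def k eq by simp
    ultimately show ?thesis by (simp only: sum.atMost_Suc) (smt (verit) norm_triangle_ineq)
  qed
qed

text \<open>Cauchy-Schwarz against the geometric weights \<open>(4/5)^j\<close>, whose sum is at
  most 5. The squared chaining sum becomes a weighted sum that is linear in the weights, so only
  their means have to be summed.\<close>

lemma sum_sqrt_le:
  fixes w :: "nat \<Rightarrow> real"
  assumes "\<And>j. 0 \<le> w j"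
  shows "(\<Sum>j\<le>n. sqrt (w j))\<^sup>2 \<le> (\<Sum>j\<le>n. 5 * (5/4)^j * w j)"
proof -
  have "(\<Sum>j\<le>n. sqrt (w j))\<^sup>2 = (\<Sum>j\<le>n. sqrt ((4/5)^j) * sqrt ((5/4)^j * w j))\<^sup>2"
  proof (intro arg_cong[of _ _ "\<lambda>x. x\<^sup>2"] sum.cong refl)
    fix j
    have "(4/5)^j * ((5/4)^j * w j) = w j"
      unfolding mult.assoc[symmetric] power_mult_distrib[symmetric] by simp
    then show "sqrt (w j) = sqrt ((4/5)^j) * sqrt ((5/4)^j * w j)"
      by (simp only: real_sqrt_mult[symmetric])
  qed
  also have "\<dots> \<le> (\<Sum>j\<le>n. (sqrt ((4/5)^j))\<^sup>2) * (\<Sum>j\<le>n. (sqrt ((5/4)^j * w j))\<^sup>2)"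
    by (rule Cauchy_Schwarz_ineq_sum)
  also have "\<dots> = (\<Sum>j\<le>n. (4/5)^j) * (\<Sum>j\<le>n. (5/4)^j * w j)"
    using assms by simp
  also have "\<dots> \<le> 5 * (\<Sum>j\<le>n. (5/4)^j * w j)"
  proof (rule mult_right_mono)
    have "(\<Sum>j\<le>n. (4/5::real)^j) = (1 - (4/5)^Suc n) / (1 - 4/5)"
      using sum_gp0[of "4/5::real" n] by simp
    also have "\<dots> \<le> 5" by (simp add: field_simps)
    finally show "(\<Sum>j\<le>n. (4/5::real)^j) \<le> 5" .
  qed (auto intro!: sum_nonneg mult_nonneg_nonneg assms)
  finally show ?thesis by (simp add: sum_distrib_left mult.assoc)
qed

text \<open>Chaining: a point of the grid of level \<open>n\<close> is reached from \<open>0\<close> by at most one increment of each level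
  \<open>j \<le> n\<close>, and fourth moments make the squares of the largest increments summable.\<close>

lemma square_integrable_sup_B:
  obtains G where "integrable M G" "\<And>\<omega>. 0 \<le> G \<omega>"
    "AE \<omega> in M. \<forall>t\<in>{0..1}. (norm (B t \<omega>))\<^sup>2 \<le> G \<omega>"
proof -
  define g where "g j \<omega> = 5 * (5/4)^j * chaining_weight j \<omega>" for j \<omega>
  have [measurable]: "g j \<in> borel_measurable M" for j unfolding g_def by measurable
  have g0: "0 \<le> g j \<omega>" for j \<omega> by (simp add: g_def chaining_weight_nonneg)
  have K: "0 \<le> increment_moment" by (simp add: increment_moment_def)
  have gj: "(\<integral>\<^sup>+\<omega>. ennreal (g j \<omega>) \<partial>M) \<le> ennreal (5 * (5/6)^j + 5 * increment_moment * (15/16)^j)" for j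
  proof -
    have "(\<integral>\<^sup>+\<omega>. ennreal (g j \<omega>) \<partial>M) = (\<integral>\<^sup>+\<omega>. ennreal (5 * (5/6)^j)
        + ennreal (5 * (15/8)^j) * (\<Sum>k<2^j. ennreal ((norm (increment j k \<omega>))^4)) \<partial>M)"
    proof (rule nn_integral_cong)
      fix \<omega>
      have p: "(5/6::real)^j = (5/4)^j * (2/3)^j" "(15/8::real)^j = (5/4)^j * (3/2)^j"
        by (simp_all flip: power_mult_distrib)
      have "g j \<omega> = 5 * (5/6)^j + 5 * (15/8)^j * (\<Sum>k<2^j. (norm (increment j k \<omega>))^4)"
        unfolding g_def chaining_weight_def p by (simp only: distrib_left mult.assoc)
      then show "ennreal (g j \<omega>) = ennreal (5 * (5/6)^j)
        + ennreal (5 * (15/8)^j) * (\<Sum>k<2^j. ennreal ((norm (increment j k \<omega>))^4))"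
        by (simp add: ennreal_plus ennreal_mult sum_nonneg)
    qed
    also have "\<dots> = ennreal (5 * (5/6)^j) + ennreal (5 * (15/8)^j) * (\<Sum>k<2^j. (\<integral>\<^sup>+\<omega>. ennreal ((norm (increment j k \<omega>))^4) \<partial>M))"
      by (subst nn_integral_add, simp, simp, subst nn_integral_cmult, simp, subst nn_integral_sum)
         (simp_all add: emeasure_space_1)
    also have "\<dots> \<le> ennreal (5 * (5/6)^j) + ennreal (5 * (15/8)^j) * (\<Sum>k<(2::nat)^j. ennreal (increment_moment / 4 ^ j))"
      by (intro add_left_mono mult_left_mono sum_mono nn_integral_increment_power4) auto
    also have "(\<Sum>k<(2::nat)^j. ennreal (increment_moment / 4 ^ j)) = ennreal (2^j * (increment_moment / 4 ^ j))"
      using K by (subst sum_ennreal) auto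
    also have "ennreal (5 * (5/6)^j) + ennreal (5 * (15/8)^j) * ennreal (2^j * (increment_moment / 4 ^ j))
        = ennreal (5 * (5/6)^j + 5 * increment_moment * (15/16)^j)"
    proof -
      have "5 * (15/8)^j * (2^j * (increment_moment / 4 ^ j)) = 5 * increment_moment * ((15/8) * 2 / 4) ^ j"
        by (simp only: power_mult_distrib power_divide) simp
      then show ?thesis using K by (simp add: ennreal_plus[symmetric] ennreal_mult[symmetric] del: ennreal_plus)
    qed
    finally show ?thesis .
  qed
  \<comment> \<open>The series is taken in \<open>ennreal\<close>, because its almost sure
    finiteness is only a consequence of the finite integral.\<close>
  define H where "H \<omega> = (\<Sum>j. ennreal (g j \<omega>))" for \<omega>
  have [measurable]: "H \<in> borel_measurable M" unfolding H_def by measurable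
  have "(\<integral>\<^sup>+\<omega>. H \<omega> \<partial>M) = (\<Sum>j. \<integral>\<^sup>+\<omega>. ennreal (g j \<omega>) \<partial>M)"
    unfolding H_def by (rule nn_integral_suminf) measurable
  also have "\<dots> \<le> (\<Sum>j. ennreal (5 * (5/6)^j + 5 * increment_moment * (15/16)^j))"
    by (intro suminf_le gj) auto
  also have "\<dots> < \<infinity>"
  proof -
    have "summable (\<lambda>j. 5 * (5/6)^j + 5 * increment_moment * (15/16::real)^j)"
      by (intro summable_add summable_mult summable_geometric) auto
    then have "(\<Sum>j. ennreal (5 * (5/6)^j + 5 * increment_moment * (15/16)^j)) \<noteq> top"
      by (rule ennreal_suminf_neq_top) (use K in auto)
    then show ?thesis by (simp only: infinity_ennreal_def less_top)
  qed
  finally have fin: "(\<integral>\<^sup>+\<omega>. H \<omega> \<partial>M) < \<infinity>" .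
  then have H_fin: "AE \<omega> in M. H \<omega> \<noteq> \<infinity>" by (intro nn_integral_PInf_AE) auto
  show thesis
  proof (rule that[of "\<lambda>\<omega>. enn2real (H \<omega>)"])
    show "integrable M (\<lambda>\<omega>. enn2real (H \<omega>))"
    proof (rule integrableI_bounded)
      have "(\<integral>\<^sup>+\<omega>. ennreal (norm (enn2real (H \<omega>))) \<partial>M) \<le> (\<integral>\<^sup>+\<omega>. H \<omega> \<partial>M)"
        by (intro nn_integral_mono) (simp add: ennreal_enn2real_if)
      then show "(\<integral>\<^sup>+\<omega>. ennreal (norm (enn2real (H \<omega>))) \<partial>M) < \<infinity>" using fin by (rule le_less_trans)
    qed measurable
    show "AE \<omega> in M. \<forall>t\<in>{0..1}. (norm (B t \<omega>))\<^sup>2 \<le> enn2real (H \<omega>)"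
      using H_fin AE_B_0 AE_space
    proof eventually_elim
      case (elim \<omega>)
      have dy: "(norm (B (real k / 2 ^ n) \<omega>))\<^sup>2 \<le> enn2real (H \<omega>)" if "k \<le> 2 ^ n" for k n
      proof -
        have "(norm (B (real k / 2 ^ n) \<omega>))\<^sup>2 \<le> (\<Sum>j\<le>n. sqrt (chaining_weight j \<omega>))\<^sup>2"
          by (intro power_mono norm_B_dyadic_le elim that) auto
        also have "\<dots> \<le> (\<Sum>j\<le>n. g j \<omega>)"
          unfolding g_def by (intro sum_sqrt_le chaining_weight_nonneg)
        finally have "ennreal ((norm (B (real k / 2 ^ n) \<omega>))\<^sup>2) \<le> (\<Sum>j\<le>n. ennreal (g j \<omega>))"
          using g0 by (simp add: ennreal_leI)
        also have "\<dots> \<le> H \<omega>" unfolding H_def by (rule sum_le_suminf) auto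
        finally show ?thesis using elim by (metis enn2real_ennreal enn2real_mono infinity_ennreal_def less_top zero_le_power2)
      qed
      show ?case
      proof
        fix t :: real assume t: "t \<in> {0..1}"
        have "(\<lambda>n. B (dyadic_floor n t) \<omega>) \<longlonglongrightarrow> B t \<omega>"
          by (rule continuous_on_tendsto_compose[OF continuous_B[OF elim(3)] tendsto_dyadic_floor])
             (use t dyadic_floor_bounds in auto)
        then have "(\<lambda>n. (norm (B (dyadic_floor n t) \<omega>))\<^sup>2) \<longlonglongrightarrow> (norm (B t \<omega>))\<^sup>2"
          by (intro tendsto_intros)
        then show "(norm (B t \<omega>))\<^sup>2 \<le> enn2real (H \<omega>)"
          by (rule LIMSEQ_le_const2) (use t in \<open>auto simp: dyadic_floor_def intro!: dy dyadic_index_le\<close>)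
      qed
    qed
  qed simp
qed

end

section \<open>Convergence of the Euler scheme\<close>

lemma grid_mem:
  assumes "k \<le> 2 ^ m"
  shows "real k / 2 ^ m \<in> {0..1}"
proof -
  have "real k \<le> real (2 ^ m)" using assms by (rule of_nat_mono)
  then show ?thesis by simp
qed

text \<open>The last point of the grid of mesh \<open>2^(-a)\<close> not after point
  \<open>k\<close> of the grid of mesh \<open>2^(-m)\<close>, expressed as an index of the fine
  grid. Both grids can then be handled with a single time unit.\<close>

definition coarse_index :: "nat \<Rightarrow> nat \<Rightarrow> nat \<Rightarrow> nat" where
  "coarse_index a m k = k div 2 ^ (m - a) * 2 ^ (m - a)"

lemma coarse_index_le: "coarse_index a m k \<le> k"
  by (simp add: coarse_index_def)

lemma coarse_index_time:
  assumes "a \<le> m" "k < 2 ^ m" "real k / 2 ^ m \<le> s" "s \<le> real (Suc k) / 2 ^ m"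
  shows "real (coarse_index a m k) / 2 ^ m \<in> {0..1}" "\<bar>real (coarse_index a m k) / 2 ^ m - s\<bar> \<le> 1 / 2 ^ a"
proof -
  let ?p = "2 ^ (m - a) :: nat" and ?c = "coarse_index a m k"
  have "k mod ?p < ?p" by simp
  then have "Suc k \<le> ?c + ?p" unfolding coarse_index_def by (metis Suc_leI add_less_cancel_left div_mult_mod_eq)
  then have "real (Suc k) / 2 ^ m \<le> real (?c + ?p) / 2 ^ m"
    by (intro divide_right_mono of_nat_mono) auto
  also have "\<dots> = real ?c / 2 ^ m + 1 / 2 ^ a"
  proof -
    have "(2::real) ^ m = 2 ^ a * 2 ^ (m - a)" using assms(1) by (simp flip: power_add)
    then show ?thesis by (simp add: add_divide_distrib)
  qed
  finally have 1: "s \<le> real ?c / 2 ^ m + 1 / 2 ^ a" using assms(4) by linarith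
  have "real ?c / 2 ^ m \<le> real k / 2 ^ m" using coarse_index_le[of a m k] by (intro divide_right_mono) auto
  then have 2: "real ?c / 2 ^ m \<le> s" using assms(3) by linarith
  show "\<bar>real ?c / 2 ^ m - s\<bar> \<le> 1 / 2 ^ a" using 1 2 by linarith
  show "real ?c / 2 ^ m \<in> {0..1}" using coarse_index_le[of a m k] assms(2) by (intro grid_mem) simp
qed

definition frozen_drift :: "(real \<Rightarrow> 'a \<Rightarrow> 'b) \<Rightarrow> nat \<Rightarrow> nat \<Rightarrow> (real \<Rightarrow> 'a) \<Rightarrow> nat \<Rightarrow> 'b" where
  "frozen_drift u a m w k = u (real (coarse_index a m k) / 2 ^ m) (w (real (coarse_index a m k) / 2 ^ m))"

lemma frozen_drift_same: "frozen_drift u n n w k = u (real k / 2 ^ n) (w (real k / 2 ^ n))"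
  by (simp add: frozen_drift_def coarse_index_def)

text \<open>The Riemann-sum version of the Girsanov logarithm, which in the limit would be the
  stochastic integral of \<open>u\<close> along \<open>w\<close> minus half the energy, over
  \<gamma>. It involves finitely many values of the path only, so it is defined for every
  path.\<close>

definition girsanov_exponent ::
    "real \<Rightarrow> (real \<Rightarrow> 'a \<Rightarrow> 'a) \<Rightarrow> nat \<Rightarrow> (real \<Rightarrow> 'a::real_inner) \<Rightarrow> real" where
  "girsanov_exponent \<gamma> u n w =
     (\<Sum>k<2^n. u (real k / 2 ^ n) (w (real k / 2 ^ n)) \<bullet> (w (real (Suc k) / 2 ^ n) - w (real k / 2 ^ n))
        - (norm (u (real k / 2 ^ n) (w (real k / 2 ^ n))))\<^sup>2 / 2 ^ n / 2) / \<gamma>"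

lemma girsanov_exponent_refine:
  assumes "a \<le> m"
  shows "girsanov_exponent \<gamma> u a w =
     (\<Sum>k<2^m. frozen_drift u a m w k \<bullet> (w (real (Suc k) / 2 ^ m) - w (real k / 2 ^ m))
        - (norm (frozen_drift u a m w k))\<^sup>2 / 2 ^ m / 2) / \<gamma>"
proof -
  define p where "p = (2::nat) ^ (m - a)"
  have p0: "p > 0" by (simp add: p_def)
  have pm: "2 ^ m = (2::nat) ^ a * p" using assms by (simp add: p_def flip: power_add)
  have pr: "(2::real) ^ m = 2 ^ a * real p" using pm by (metis of_nat_mult of_nat_numeral of_nat_power)
  define f where "f j = frozen_drift u a m w j \<bullet> (w (real (Suc j) / 2 ^ m) - w (real j / 2 ^ m))
        - (norm (frozen_drift u a m w j))\<^sup>2 / 2 ^ m / 2" for j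
  have "(\<Sum>j<2^m. f j) = (\<Sum>i<2^a. sum f {i * p..<i * p + p})"
    unfolding pm by (rule sum.nat_group[symmetric])
  also have "\<dots> = (\<Sum>k<2^a. u (real k / 2 ^ a) (w (real k / 2 ^ a)) \<bullet> (w (real (Suc k) / 2 ^ a) - w (real k / 2 ^ a))
        - (norm (u (real k / 2 ^ a) (w (real k / 2 ^ a))))\<^sup>2 / 2 ^ a / 2)"
  proof (rule sum.cong[OF refl])
    fix i assume "i \<in> {..<(2::nat)^a}"
    let ?u = "u (real i / 2 ^ a) (w (real i / 2 ^ a))"
    have fr: "frozen_drift u a m w j = ?u" if "j \<in> {i * p..<i * p + p}" for j
    proof -
      have "j div p = i" using that by (intro div_nat_eqI) (auto simp: mult.commute)
      then have "coarse_index a m j = i * p" by (simp add: coarse_index_def p_def)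
      then show ?thesis using p0 by (simp add: frozen_drift_def pr)
    qed
    have t: "real (i * p) / 2 ^ m = real i / 2 ^ a" "real (i * p + p) / 2 ^ m = real (Suc i) / 2 ^ a"
      using p0 by (simp_all add: pr field_simps)
    have "sum f {i * p..<i * p + p} = (\<Sum>j = i * p..<i * p + p.
        ?u \<bullet> (w (real (Suc j) / 2 ^ m) - w (real j / 2 ^ m)) - (norm ?u)\<^sup>2 / 2 ^ m / 2)"
      unfolding f_def using fr by (intro sum.cong) auto
    also have "\<dots> = ?u \<bullet> (\<Sum>j = i * p..<i * p + p. w (real (Suc j) / 2 ^ m) - w (real j / 2 ^ m))
        - real p * ((norm ?u)\<^sup>2 / 2 ^ m / 2)"
      unfolding inner_sum_right by (subst sum_subtractf) simp
    also have "(\<Sum>j = i * p..<i * p + p. w (real (Suc j) / 2 ^ m) - w (real j / 2 ^ m))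
        = w (real (Suc i) / 2 ^ a) - w (real i / 2 ^ a)"
      using sum_Suc_diff'[of "i * p" "i * p + p" "\<lambda>j. w (real j / 2 ^ m)"] by (simp only: t)
    also have "real p * ((norm ?u)\<^sup>2 / 2 ^ m / 2) = (norm ?u)\<^sup>2 / 2 ^ a / 2"
      using p0 by (simp add: pr)
    finally show "sum f {i * p..<i * p + p} = ?u \<bullet> (w (real (Suc i) / 2 ^ a) - w (real i / 2 ^ a))
        - (norm ?u)\<^sup>2 / 2 ^ a / 2" .
  qed
  finally show ?thesis by (simp add: girsanov_exponent_def f_def)
qed

text \<open>The geometric sum closes the induction exactly:
  \<open>A + q * (\<Sum>j<k. A * (1 + q) ^ j) = A * (1 + q) ^ k\<close>. The delayed index
  \<open>c j\<close> is harmless because the bound grows with the index; it will be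
  \<open>coarse_index\<close>, since a frozen drift looks back to an earlier grid point.\<close>

lemma discrete_gronwall:
  fixes e :: "nat \<Rightarrow> real"
  assumes "0 \<le> A" "0 \<le> q" "\<And>j. c j \<le> j"
    and e: "\<And>k. k \<le> n \<Longrightarrow> e k \<le> A + q * (\<Sum>j<k. e (c j))"
  shows "k \<le> n \<Longrightarrow> e k \<le> A * (1 + q) ^ k"
proof (induction k rule: less_induct)
  case (less k)
  have "(\<Sum>j<k. e (c j)) \<le> (\<Sum>j<k. A * (1 + q) ^ j)"
  proof (rule sum_mono)
    fix j assume "j \<in> {..<k}"
    then have "e (c j) \<le> A * (1 + q) ^ c j"
      using less assms(3)[of j] by auto
    also have "\<dots> \<le> A * (1 + q) ^ j"
      using assms by (intro mult_left_mono power_increasing) auto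
    finally show "e (c j) \<le> A * (1 + q) ^ j" .
  qed
  then have "e k \<le> A + q * (\<Sum>j<k. A * (1 + q) ^ j)"
    using e[OF less.prems] assms(2) by (meson add_left_mono mult_left_mono order_trans)
  also have "q * (\<Sum>j<k. A * (1 + q) ^ j) = A * ((1 + q) ^ k - 1)"
    using power_diff_1_eq[of "1 + q" k] by (simp add: sum_distrib_left[symmetric] mult.left_commute)
  finally show ?case by (simp add: algebra_simps)
qed

lemma one_plus_power_le_exp:
  assumes "0 \<le> C" "k \<le> 2 ^ m"
  shows "(1 + C / 2 ^ m) ^ k \<le> exp (C :: real)"
proof -
  have "(1 + C / 2 ^ m) ^ k \<le> exp (C / 2 ^ m) ^ k"
    using assms by (intro power_mono) (auto intro: exp_ge_add_one_self)
  also have "\<dots> = exp (real k * (C / 2 ^ m))" by (rule exp_of_nat_mult[symmetric])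
  also have "\<dots> \<le> exp C"
  proof -
    have "real k / 2 ^ m * C \<le> 1 * C" using assms grid_mem[of k m] by (intro mult_right_mono) auto
    then show ?thesis by simp
  qed
  finally show ?thesis .
qed

text \<open>The numbers \<open>g j\<close> need not be values of \<open>f\<close>: below, they are
  frozen drifts along an Euler path while \<open>f\<close> is the drift along the solution. The
  error is added cell by cell, which is why the set integral is first turned into a gauge integral
  over adjacent intervals.\<close>

lemma riemann_sum_error:
  fixes f :: "real \<Rightarrow> 'b::euclidean_space"
  assumes f: "continuous_on {0..1} f" and "k \<le> 2 ^ m"
    and g: "\<And>j s. j < k \<Longrightarrow> real j / 2 ^ m \<le> s \<Longrightarrow> s \<le> real (Suc j) / 2 ^ m \<Longrightarrow> norm (g j - f s) \<le> \<epsilon> j"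
  shows "norm ((\<Sum>j<k. g j /\<^sub>R 2 ^ m) - (LBINT s:{0..real k / 2 ^ m}. f s)) \<le> (\<Sum>j<k. \<epsilon> j / 2 ^ m)"
proof -
  have le1: "real j / 2 ^ m \<le> 1" if "j \<le> k" for j
    using grid_mem[of j m] that assms(2) by simp
  have f': "continuous_on {s..t} f" if "0 \<le> s" "t \<le> 1" for s t
    by (rule continuous_on_subset[OF f]) (use that in auto)
  have LB: "(LBINT s:{0..t}. f s) = integral {0..t} f" if "t \<le> 1" for t
    by (rule set_borel_integral_eq_integral(2)) (intro borel_integrable_atLeastAtMost' f' that order_refl)
  have "norm ((\<Sum>j<n. g j /\<^sub>R 2 ^ m) - integral {0..real n / 2 ^ m} f) \<le> (\<Sum>j<n. \<epsilon> j / 2 ^ m)" if "n \<le> k" for n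
    using that
  proof (induction n)
    case 0
    then show ?case by simp
  next
    case (Suc n)
    let ?a = "real n / 2 ^ m" and ?b = "real (Suc n) / 2 ^ m"
    have ab: "0 \<le> ?a" "?a \<le> ?b" "?b \<le> 1" using le1[of "Suc n"] Suc.prems by (auto simp: divide_right_mono)
    have len: "?b - ?a = 1 / 2 ^ m" by (simp add: add_divide_distrib)
    have "integral {0..?a} f + integral {?a..?b} f = integral {0..?b} f"
      by (rule Henstock_Kurzweil_Integration.integral_combine) (use ab f'[of 0 ?b] in \<open>auto intro: integrable_continuous_interval\<close>)
    moreover have "integral {?a..?b} (\<lambda>s. g n - f s) = g n /\<^sub>R 2 ^ m - integral {?a..?b} f"
      using len ab f'[of ?a ?b]
      by (subst Henstock_Kurzweil_Integration.integral_diff)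
         (auto intro: integrable_continuous_interval simp: divide_inverse)
    moreover have "norm (integral {?a..?b} (\<lambda>s. g n - f s)) \<le> \<epsilon> n * (?b - ?a)"
      using ab Suc.prems by (intro integral_bound continuous_intros f' g) auto
    moreover have "norm ((\<Sum>j<n. g j /\<^sub>R 2 ^ m) - integral {0..?a} f) \<le> (\<Sum>j<n. \<epsilon> j / 2 ^ m)"
      using Suc by simp
    ultimately have "norm (((\<Sum>j<n. g j /\<^sub>R 2 ^ m) - integral {0..?a} f) + (g n /\<^sub>R 2 ^ m - integral {?a..?b} f))
        \<le> (\<Sum>j<n. \<epsilon> j / 2 ^ m) + \<epsilon> n / 2 ^ m"
      unfolding len by (intro norm_triangle_mono) auto
    moreover have "((\<Sum>j<n. g j /\<^sub>R 2 ^ m) - integral {0..?a} f) + (g n /\<^sub>R 2 ^ m - integral {?a..?b} f)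
       = (\<Sum>j<Suc n. g j /\<^sub>R 2 ^ m) - integral {0..?b} f"
      using \<open>integral {0..?a} f + integral {?a..?b} f = integral {0..?b} f\<close>
      by (simp add: algebra_simps)
    ultimately show ?case by (simp only: sum.lessThan_Suc)
  qed
  from this[of k] show ?thesis using LB[OF le1[of k]] by simp
qed

text \<open>The drift is frozen on the grid of mesh \<open>2\<^sup>-\<^sup>a\<close>, the noise is sampled on the finer grid of mesh
  \<open>2\<^sup>-\<^sup>m\<close>.\<close>

definition euler_path ::
    "(real \<Rightarrow> 'a \<Rightarrow> 'a) \<Rightarrow> (real \<Rightarrow> 'a::real_normed_vector) \<Rightarrow> nat \<Rightarrow> nat \<Rightarrow> (real \<Rightarrow> 'a) \<Rightarrow> bool" where
  "euler_path u \<beta> a m X \<longleftrightarrow>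
     (\<forall>k\<le>2^m. X (real k / 2 ^ m) = (\<Sum>j<k. frozen_drift u a m X j /\<^sub>R 2 ^ m) + \<beta> (real k / 2 ^ m)) \<and>
     (\<forall>t\<in>{0..1}. X t = X (dyadic_floor m t))"

text \<open>What the analysis uses of a control. The Lipschitz bound is joint in time and space
  because freezing displaces the time argument too, and local because it will come from continuity
  of the derivative on compact sets.\<close>

locale regular_drift =
  fixes u :: "real \<Rightarrow> 'a::euclidean_space \<Rightarrow> 'a" and C :: real
  assumes lipschitz: "\<And>R. \<exists>L\<ge>0. \<forall>s\<in>{0..1}. \<forall>t\<in>{0..1}. \<forall>x\<in>cball 0 R. \<forall>y\<in>cball 0 R.
      norm (u s x - u t y) \<le> L * (\<bar>s - t\<bar> + norm (x - y))"
    and growth: "\<And>t x. t \<in> {0..1} \<Longrightarrow> norm (u t x) \<le> C * (1 + norm x)"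
begin

lemma C_nonneg: "0 \<le> C"
  using growth[of 0 0] by (smt (verit) atLeastAtMost_iff mult_cancel_left1 norm_ge_zero norm_zero)

lemma growth_ball:
  assumes "t \<in> {0..1}" "norm x \<le> R"
  shows "norm (u t x) \<le> C * (1 + R)"
  using growth[OF assms(1), of x] mult_left_mono[OF _ C_nonneg, of "1 + norm x" "1 + R"] assms(2) by linarith

lemma continuous_on_u: "continuous_on ({0..1} \<times> UNIV) (case_prod u)"
proof (rule continuous_on_eq_continuous_within[THEN iffD2], rule ballI)
  fix z assume "z \<in> {0..1::real} \<times> (UNIV :: 'a set)"
  then obtain t x where z: "z = (t, x)" "t \<in> {0..1}" by auto
  obtain L where L: "L \<ge> 0" "\<forall>s\<in>{0..1}. \<forall>t\<in>{0..1}. \<forall>x\<in>cball 0 R. \<forall>y\<in>cball 0 R.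
      norm (u s x - u t y) \<le> L * (\<bar>s - t\<bar> + norm (x - y))" if "R = norm x + 1" for R
    using lipschitz[of "norm x + 1"] by metis
  show "continuous (at z within {0..1} \<times> UNIV) (case_prod u)"
  proof -
    \<comment> \<open>The Lipschitz constant is valid on a ball only, so the limit is first computed
      within a unit ball around \<open>x\<close>, which does not change it.\<close>
    have "open (UNIV \<times> ball x 1 :: (real \<times> 'a) set)" by (intro open_Times) auto
    then have "\<forall>\<^sub>F w in at z. w \<in> UNIV \<times> ball x 1" using z by (intro eventually_at_in_open') auto
    then have *: "\<forall>\<^sub>F w in at z. (w \<in> {0..1} \<times> (UNIV :: 'a set)) = (w \<in> {0..1} \<times> ball x 1)"
      by eventually_elim auto
    have "(case_prod u \<longlongrightarrow> case_prod u z) (at z within {0..1} \<times> ball x 1)"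
    proof (rule Lim_null[THEN iffD2], rule Lim_null_comparison)
      show "\<forall>\<^sub>F w in at z within {0..1} \<times> ball x 1.
          norm (case_prod u w - case_prod u z) \<le> L * (\<bar>fst w - t\<bar> + norm (snd w - x))"
      proof (rule eventually_at_filter[THEN iffD2], rule always_eventually, intro allI impI)
        fix w :: "real \<times> 'a" assume w: "w \<in> {0..1} \<times> ball x 1"
        then have "norm (snd w) \<le> norm x + 1"
          using norm_triangle_ineq2[of "snd w" x] by (auto simp: dist_norm norm_minus_commute)
        then show "norm (case_prod u w - case_prod u z) \<le> L * (\<bar>fst w - t\<bar> + norm (snd w - x))"
          using L(2)[OF refl] w z by (auto simp: case_prod_beta)
      qed
      have "((\<lambda>w. L * (\<bar>fst w - t\<bar> + norm (snd w - x))) \<longlongrightarrow> L * (\<bar>fst z - t\<bar> + norm (snd z - x)))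
          (at z within {0..1} \<times> ball x 1)"
        by (intro tendsto_intros)
      then show "((\<lambda>w. L * (\<bar>fst w - t\<bar> + norm (snd w - x))) \<longlongrightarrow> 0) (at z within {0..1} \<times> ball x 1)"
        by (simp add: z)
    qed
    then show ?thesis
      unfolding continuous_within using Lim_transform_within_set_eq[OF *] by blast
  qed
qed

lemma continuous_on_u_path:
  assumes "continuous_on S w" "S \<subseteq> {0..1}"
  shows "continuous_on S (\<lambda>t. u t (w t))"
proof -
  have "continuous_on S (\<lambda>t. case_prod u (t, w t))"
    by (rule continuous_on_compose2[OF continuous_on_u]) (use assms in \<open>auto intro!: continuous_intros\<close>)
  then show ?thesis by simp
qed

lemma measurable_u [measurable]:
  assumes "t \<in> {0..1}"
  shows "u t \<in> borel_measurable borel"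
proof -
  have "continuous_on UNIV (\<lambda>x. case_prod u (t, x))"
    by (rule continuous_on_compose2[OF continuous_on_u]) (use assms in \<open>auto intro!: continuous_intros\<close>)
  then show ?thesis by (intro borel_measurable_continuous_onI) simp
qed

text \<open>Discrete Gronwall with the linear growth bound. The result is affine in the size
  \<open>S\<close> of the noise and independent of both meshes, so square integrability of the
  supremum of the noise passes to all schemes at once.\<close>

lemma euler_path_bound:
  assumes X: "euler_path u \<beta> a m X" and "a \<le> m"
    and \<beta>: "\<And>t. t \<in> {0..1} \<Longrightarrow> norm (\<beta> t) \<le> S" and t: "t \<in> {0..1}"
  shows "norm (X t) \<le> (C + S) * exp C"
proof -
  have S: "0 \<le> S" using order_trans[OF norm_ge_zero \<beta>[of 0]] by simp
  have tm: "real k / 2 ^ m \<in> {0..1}" if "k \<le> 2 ^ m" for k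
    using that by (rule grid_mem)
  have grid: "norm (X (real k / 2 ^ m)) \<le> (C + S) * (1 + C / 2 ^ m) ^ k" if "k \<le> 2 ^ m" for k
  proof (rule discrete_gronwall[where n = "2 ^ m" and c = "coarse_index a m"])
    fix k :: nat assume k: "k \<le> 2 ^ m"
    have "norm (X (real k / 2 ^ m)) \<le> norm (\<Sum>j<k. frozen_drift u a m X j /\<^sub>R 2 ^ m) + norm (\<beta> (real k / 2 ^ m))"
      using X k unfolding euler_path_def by (metis norm_triangle_ineq)
    also have "norm (\<Sum>j<k. frozen_drift u a m X j /\<^sub>R 2 ^ m)
        \<le> (\<Sum>j<k. C / 2 ^ m + C / 2 ^ m * norm (X (real (coarse_index a m j) / 2 ^ m)))"
    proof (rule sum_norm_le)
      fix j assume "j \<in> {..<k}"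
      then have "coarse_index a m j \<le> 2 ^ m" using coarse_index_le[of a m j] k by auto
      from growth[OF tm[OF this], of "X (real (coarse_index a m j) / 2 ^ m)"]
      have "norm (frozen_drift u a m X j) / 2 ^ m \<le> C * (1 + norm (X (real (coarse_index a m j) / 2 ^ m))) / 2 ^ m"
        unfolding frozen_drift_def by (rule divide_right_mono) simp
      then show "norm (frozen_drift u a m X j /\<^sub>R 2 ^ m) \<le> C / 2 ^ m + C / 2 ^ m * norm (X (real (coarse_index a m j) / 2 ^ m))"
        by (simp add: field_simps)
    qed
    also have "\<dots> = C * (real k / 2 ^ m) + C / 2 ^ m * (\<Sum>j<k. norm (X (real (coarse_index a m j) / 2 ^ m)))"
      by (simp add: sum.distrib sum_distrib_left)
    also have "\<dots> \<le> C + C / 2 ^ m * (\<Sum>j<k. norm (X (real (coarse_index a m j) / 2 ^ m)))"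
      using mult_left_mono[OF _ C_nonneg, of "real k / 2 ^ m" 1] tm[OF k] by simp
    finally show "norm (X (real k / 2 ^ m)) \<le> C + S + C / 2 ^ m * (\<Sum>j<k. norm (X (real (coarse_index a m j) / 2 ^ m)))"
      using \<beta>[OF tm[OF k]] by linarith
  qed (use C_nonneg S that coarse_index_le in auto)
  have "norm (X t) = norm (X (real (dyadic_index m t) / 2 ^ m))"
    using X t unfolding euler_path_def dyadic_floor_def by metis
  also have "\<dots> \<le> (C + S) * (1 + C / 2 ^ m) ^ dyadic_index m t"
    using t by (intro grid dyadic_index_le) auto
  also have "\<dots> \<le> (C + S) * exp C"
    using C_nonneg S t by (intro mult_left_mono one_plus_power_le_exp dyadic_index_le) auto
  finally show ?thesis .
qed

end

text \<open>The equation for one fixed outcome. As the noise is additive, it is a deterministic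
  integral equation driven by a continuous function, and the convergence of the scheme needs no
  probability.\<close>

locale drift_ode = regular_drift u C
    for u :: "real \<Rightarrow> 'a::euclidean_space \<Rightarrow> 'a" and C :: real +
  fixes \<beta> \<theta> :: "real \<Rightarrow> 'a"
  assumes \<beta>: "continuous_on {0..1} \<beta>" and \<theta>: "continuous_on {0..1} \<theta>"
    and ode: "\<And>t. t \<in> {0..1} \<Longrightarrow> \<theta> t = (LBINT s:{0..t}. u s (\<theta> s)) + \<beta> t"
begin

text \<open>One ball contains the solution and every Euler path, so that a single local Lipschitz
  constant serves for all meshes. For the solution compactness suffices, for the Euler paths the
  uniform growth bound is needed.\<close>

lemma ex_bound:
  "\<exists>R\<ge>0. (\<forall>t\<in>{0..1}. norm (\<theta> t) \<le> R) \<and>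
     (\<forall>a m X. euler_path u \<beta> a m X \<longrightarrow> a \<le> m \<longrightarrow> (\<forall>t\<in>{0..1}. norm (X t) \<le> R))"
proof -
  obtain S where S: "\<forall>t\<in>{0..1}. norm (\<beta> t) \<le> S"
    using compact_imp_bounded[OF compact_continuous_image[OF \<beta> compact_Icc]] by (auto simp: bounded_iff)
  obtain T where T: "\<forall>t\<in>{0..1}. norm (\<theta> t) \<le> T"
    using compact_imp_bounded[OF compact_continuous_image[OF \<theta> compact_Icc]] by (auto simp: bounded_iff)
  show ?thesis
    by (rule exI[of _ "max 0 (max T ((C + S) * exp C))"])
       (use T euler_path_bound[OF _ _ S[rule_format]] in \<open>fastforce simp: le_max_iff_disj\<close>)
qed

text \<open>Freezing moves the time by at most \<open>1 / 2 ^ a\<close> and the solution by its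
  oscillation over that time; each of these costs \<eta>. What remains is the Euler error at the
  coarse grid point, which Gronwall controls.\<close>

lemma frozen_drift_error:
  assumes L: "L \<ge> 0" "\<forall>s\<in>{0..1}. \<forall>t\<in>{0..1}. \<forall>x\<in>cball 0 R. \<forall>y\<in>cball 0 R.
      norm (u s x - u t y) \<le> L * (\<bar>s - t\<bar> + norm (x - y))"
    and R: "\<And>t. t \<in> {0..1} \<Longrightarrow> norm (\<theta> t) \<le> R" "\<And>t. t \<in> {0..1} \<Longrightarrow> norm (X t) \<le> R"
    and osc: "\<And>s t. s \<in> {0..1} \<Longrightarrow> t \<in> {0..1} \<Longrightarrow> \<bar>s - t\<bar> \<le> 1 / 2 ^ a \<Longrightarrow> norm (\<theta> s - \<theta> t) \<le> \<eta>"
    and a: "1 / 2 ^ a \<le> \<eta>" "a \<le> m" and j: "j < 2 ^ m" "real j / 2 ^ m \<le> s" "s \<le> real (Suc j) / 2 ^ m"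
  shows "norm (frozen_drift u a m X j - u s (\<theta> s))
    \<le> L * (2 * \<eta> + norm (X (real (coarse_index a m j) / 2 ^ m) - \<theta> (real (coarse_index a m j) / 2 ^ m)))"
proof -
  let ?t = "real (coarse_index a m j) / 2 ^ m"
  have t: "?t \<in> {0..1}" "\<bar>?t - s\<bar> \<le> 1 / 2 ^ a" using coarse_index_time[OF a(2) j] by auto
  have "real (Suc j) / 2 ^ m \<le> 1" using grid_mem[of "Suc j" m] j(1) by simp
  moreover have "0 \<le> s" using j(2) by (smt (verit) divide_nonneg_nonneg of_nat_0_le_iff zero_le_power)
  ultimately have s: "s \<in> {0..1}" using j(3) unfolding atLeastAtMost_iff by linarith
  have "norm (frozen_drift u a m X j - u s (\<theta> s)) \<le> L * (\<bar>?t - s\<bar> + norm (X ?t - \<theta> s))"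
    unfolding frozen_drift_def using L(2) t s R by auto
  also have "\<dots> \<le> L * (2 * \<eta> + norm (X ?t - \<theta> ?t))"
  proof (rule mult_left_mono[OF _ L(1)])
    have "norm (X ?t - \<theta> s) \<le> norm (X ?t - \<theta> ?t) + norm (\<theta> ?t - \<theta> s)"
      using norm_triangle_ineq[of "X ?t - \<theta> ?t" "\<theta> ?t - \<theta> s"] by simp
    then show "\<bar>?t - s\<bar> + norm (X ?t - \<theta> s) \<le> 2 * \<eta> + norm (X ?t - \<theta> ?t)"
      using osc[OF t(1) s t(2)] t(2) a(1) by linarith
  qed
  finally show ?thesis .
qed

lemma ex_oscillation:
  assumes "\<eta> > 0"
  obtains n where "\<And>a s t. a \<ge> n \<Longrightarrow> s \<in> {0..1} \<Longrightarrow> t \<in> {0..1} \<Longrightarrow> \<bar>s - t\<bar> \<le> 1 / 2 ^ a \<Longrightarrow> norm (\<theta> s - \<theta> t) \<le> \<eta>"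
    "\<And>a. a \<ge> n \<Longrightarrow> 1 / 2 ^ a \<le> \<eta>"
proof -
  obtain d where d: "d > 0" "\<forall>s\<in>{0..1}. \<forall>t\<in>{0..1}. dist t s < d \<longrightarrow> dist (\<theta> t) (\<theta> s) < \<eta>"
    using compact_uniformly_continuous[OF \<theta> compact_Icc] assms unfolding uniformly_continuous_on_def by metis
  obtain n where n: "(1/2)^n < min d \<eta>"
    using real_arch_pow_inv[of "min d \<eta>" "1/2"] d assms by auto
  have n': "1 / 2 ^ a < min d \<eta>" if "a \<ge> n" for a
  proof -
    have "(1/2::real)^a \<le> (1/2)^n" using that by (intro power_decreasing) auto
    then show ?thesis using n by (simp add: power_one_over)
  qed
  show thesis
  proof (rule that[of n])
    fix a and s t :: real assume "a \<ge> n" "s \<in> {0..1}" "t \<in> {0..1}" "\<bar>s - t\<bar> \<le> 1 / 2 ^ a"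
    then show "norm (\<theta> s - \<theta> t) \<le> \<eta>"
      using d(2)[rule_format, of t s] n'[of a] by (simp add: dist_norm)
  next
    fix a assume "a \<ge> n" then show "1 / 2 ^ a \<le> \<eta>" using n'[of a] by simp
  qed
qed

proposition euler_path_converges:
  assumes "\<epsilon> > 0"
  obtains n where "\<And>a m X t. n \<le> a \<Longrightarrow> a \<le> m \<Longrightarrow> euler_path u \<beta> a m X \<Longrightarrow> t \<in> {0..1} \<Longrightarrow> norm (X t - \<theta> t) \<le> \<epsilon>"
proof -
  obtain R where R: "R \<ge> 0" "\<And>t. t \<in> {0..1} \<Longrightarrow> norm (\<theta> t) \<le> R"
    "\<And>a m X t. euler_path u \<beta> a m X \<Longrightarrow> a \<le> m \<Longrightarrow> t \<in> {0..1} \<Longrightarrow> norm (X t) \<le> R"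
    using ex_bound by blast
  obtain L where L: "L \<ge> 0" "\<forall>s\<in>{0..1}. \<forall>t\<in>{0..1}. \<forall>x\<in>cball 0 R. \<forall>y\<in>cball 0 R.
      norm (u s x - u t y) \<le> L * (\<bar>s - t\<bar> + norm (x - y))"
    using lipschitz by blast
  \<comment> \<open>With this choice the Gronwall error \<open>2 * L * \<eta> * exp L\<close> at
    grid points and the oscillation \<eta> between a grid point and \<open>t\<close> add up to
    \<epsilon>.\<close>
  define \<eta> where "\<eta> = \<epsilon> / (2 * L * exp L + 1)"
  have den: "2 * L * exp L + 1 > 0" using L by (intro add_nonneg_pos) auto
  have \<eta>: "\<eta> > 0" "\<eta> * (2 * L * exp L + 1) = \<epsilon>" using assms den by (auto simp: \<eta>_def)
  obtain n where n: "\<And>a s t. a \<ge> n \<Longrightarrow> s \<in> {0..1} \<Longrightarrow> t \<in> {0..1} \<Longrightarrow> \<bar>s - t\<bar> \<le> 1 / 2 ^ a \<Longrightarrow> norm (\<theta> s - \<theta> t) \<le> \<eta>"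
    "\<And>a. a \<ge> n \<Longrightarrow> 1 / 2 ^ a \<le> \<eta>"
    using ex_oscillation[OF \<eta>(1)] by blast
  show thesis
  proof (rule that[of n])
    fix a m X t assume am: "n \<le> a" "a \<le> m" and X: "euler_path u \<beta> a m X" and t: "t \<in> {0..1::real}"
    have tm: "real k / 2 ^ m \<in> {0..1}" if "k \<le> 2 ^ m" for k
      using that by (rule grid_mem)
    define e where "e k = norm (X (real k / 2 ^ m) - \<theta> (real k / 2 ^ m))" for k
    have grid: "e k \<le> (2 * L * \<eta>) * (1 + L / 2 ^ m) ^ k" if "k \<le> 2 ^ m" for k
    proof (rule discrete_gronwall[where n = "2 ^ m" and c = "coarse_index a m"])
      fix k :: nat assume k: "k \<le> 2 ^ m"
      have "X (real k / 2 ^ m) = (\<Sum>j<k. frozen_drift u a m X j /\<^sub>R 2 ^ m) + \<beta> (real k / 2 ^ m)"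
        using X k unfolding euler_path_def by blast
      then have "X (real k / 2 ^ m) - \<theta> (real k / 2 ^ m)
          = (\<Sum>j<k. frozen_drift u a m X j /\<^sub>R 2 ^ m) - (LBINT s:{0..real k / 2 ^ m}. u s (\<theta> s))"
        using ode[OF tm[OF k]] by simp
      then have "e k \<le> (\<Sum>j<k. L * (2 * \<eta> + e (coarse_index a m j)) / 2 ^ m)"
        unfolding e_def
        by (simp only:) (rule riemann_sum_error, auto intro!: continuous_on_u_path \<theta> k frozen_drift_error[OF L] R X am n
             intro: less_le_trans[OF _ k])
      also have "\<dots> = 2 * L * \<eta> * (real k / 2 ^ m) + L / 2 ^ m * (\<Sum>j<k. e (coarse_index a m j))"
        by (simp add: distrib_left add_divide_distrib sum.distrib sum_distrib_left)
      also have "\<dots> \<le> 2 * L * \<eta> + L / 2 ^ m * (\<Sum>j<k. e (coarse_index a m j))"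
        using mult_left_mono[of "real k / 2 ^ m" 1 "2 * L * \<eta>"] tm[OF k] L \<eta> by simp
      finally show "e k \<le> 2 * L * \<eta> + L / 2 ^ m * (\<Sum>j<k. e (coarse_index a m j))" .
    qed (use L \<eta> that coarse_index_le in auto)
    have k: "dyadic_index m t \<le> 2 ^ m" using t by (intro dyadic_index_le) auto
    have "e (dyadic_index m t) \<le> (2 * L * \<eta>) * exp L"
      by (rule order_trans[OF grid[OF k]]) (use L \<eta> k in \<open>auto intro!: mult_left_mono one_plus_power_le_exp\<close>)
    moreover have "norm (\<theta> (dyadic_floor m t) - \<theta> t) \<le> \<eta>"
    proof (rule n(1))
      show "\<bar>dyadic_floor m t - t\<bar> \<le> 1 / 2 ^ m" using dyadic_floor_bounds[of t m] t by auto
    qed (use am t dyadic_floor_mem[of t m] in auto)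
    moreover have "X t = X (dyadic_floor m t)" using X t by (simp add: euler_path_def)
    moreover have "norm (X t - \<theta> t) \<le> norm (X t - \<theta> (dyadic_floor m t)) + norm (\<theta> (dyadic_floor m t) - \<theta> t)"
      using norm_triangle_ineq[of "X t - \<theta> (dyadic_floor m t)" "\<theta> (dyadic_floor m t) - \<theta> t"] by simp
    ultimately have "norm (X t - \<theta> t) \<le> 2 * L * \<eta> * exp L + \<eta>"
      unfolding e_def dyadic_floor_def by simp
    also have "\<dots> = \<epsilon>" using \<eta>(2) by (simp add: algebra_simps)
    finally show "norm (X t - \<theta> t) \<le> \<epsilon>" .
  qed
qed

text \<open>The mesh \<open>c\<close> on which the drift is read may differ from the mesh
  \<open>a\<close> of the scheme that produced \<open>X\<close>. Comparing two such readings along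
  one path is what relative entropies of schemes require.\<close>

lemma frozen_drift_converges:
  assumes "\<epsilon> > 0"
  obtains n where "\<And>a c m X j s. n \<le> a \<Longrightarrow> n \<le> c \<Longrightarrow> a \<le> m \<Longrightarrow> c \<le> m \<Longrightarrow> euler_path u \<beta> a m X \<Longrightarrow> j < 2 ^ m
     \<Longrightarrow> real j / 2 ^ m \<le> s \<Longrightarrow> s \<le> real (Suc j) / 2 ^ m \<Longrightarrow> norm (frozen_drift u c m X j - u s (\<theta> s)) \<le> \<epsilon>"
proof -
  obtain R where R: "R \<ge> 0" "\<And>t. t \<in> {0..1} \<Longrightarrow> norm (\<theta> t) \<le> R"
    "\<And>a m X t. euler_path u \<beta> a m X \<Longrightarrow> a \<le> m \<Longrightarrow> t \<in> {0..1} \<Longrightarrow> norm (X t) \<le> R"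
    using ex_bound by blast
  obtain L where L: "L \<ge> 0" "\<forall>s\<in>{0..1}. \<forall>t\<in>{0..1}. \<forall>x\<in>cball 0 R. \<forall>y\<in>cball 0 R.
      norm (u s x - u t y) \<le> L * (\<bar>s - t\<bar> + norm (x - y))"
    using lipschitz by blast
  \<comment> \<open>Two shares of \<eta> go to freezing and one to the Euler error; the added 1
    keeps the denominator positive when \<open>L = 0\<close>.\<close>
  define \<eta> where "\<eta> = \<epsilon> / (3 * L + 1)"
  have \<eta>: "\<eta> > 0" "\<eta> * (3 * L + 1) = \<epsilon>" using assms L by (auto simp: \<eta>_def)
  obtain n where n: "\<And>a s t. a \<ge> n \<Longrightarrow> s \<in> {0..1} \<Longrightarrow> t \<in> {0..1} \<Longrightarrow> \<bar>s - t\<bar> \<le> 1 / 2 ^ a \<Longrightarrow> norm (\<theta> s - \<theta> t) \<le> \<eta>"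
    "\<And>a. a \<ge> n \<Longrightarrow> 1 / 2 ^ a \<le> \<eta>"
    using ex_oscillation[OF \<eta>(1)] by blast
  obtain n' where n': "\<And>a m X t. n' \<le> a \<Longrightarrow> a \<le> m \<Longrightarrow> euler_path u \<beta> a m X \<Longrightarrow> t \<in> {0..1} \<Longrightarrow> norm (X t - \<theta> t) \<le> \<eta>"
    using euler_path_converges[OF \<eta>(1)] by blast
  show thesis
  proof (rule that[of "max n n'"])
    fix a c m X j s
    assume ac: "max n n' \<le> a" "max n n' \<le> c" "a \<le> m" "c \<le> m" and X: "euler_path u \<beta> a m X"
      and j: "j < 2 ^ m" "real j / 2 ^ m \<le> s" "s \<le> real (Suc j) / 2 ^ m"
    have "norm (frozen_drift u c m X j - u s (\<theta> s))
      \<le> L * (2 * \<eta> + norm (X (real (coarse_index c m j) / 2 ^ m) - \<theta> (real (coarse_index c m j) / 2 ^ m)))"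
      by (rule frozen_drift_error[OF L R(2) R(3)[OF X]]) (use ac j n in auto)
    also have "\<dots> \<le> L * (2 * \<eta> + \<eta>)"
      using ac by (intro mult_left_mono add_left_mono n'[OF _ _ X] coarse_index_time(1)[OF _ j] L) auto
    also have "\<dots> \<le> \<epsilon>" using \<eta> by (simp add: algebra_simps)
    finally show "norm (frozen_drift u c m X j - u s (\<theta> s)) \<le> \<epsilon>" .
  qed
qed

end

section \<open>The law of the Euler scheme\<close>

lemma girsanov_exponent_cong:
  assumes "\<And>k. k \<le> 2 ^ n \<Longrightarrow> w (real k / 2 ^ n) = w' (real k / 2 ^ n)"
  shows "girsanov_exponent \<gamma> u n w = girsanov_exponent \<gamma> u n w'"
  unfolding girsanov_exponent_def
  by (intro arg_cong[of _ _ "\<lambda>x. x / \<gamma>"] sum.cong refl) (auto simp: assms simp del: of_nat_Suc)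

lemma grid_refine:
  assumes "n \<le> m"
  shows "real k / 2 ^ n = real (k * 2 ^ (m - n)) / (2::real) ^ m"
proof -
  have "(2::real) ^ m = 2 ^ n * 2 ^ (m - n)" using assms by (simp flip: power_add)
  then show ?thesis by simp
qed

lemma dyadic_floor_grid:
  assumes "n \<le> m"
  shows "dyadic_floor m (real k / 2 ^ n) = real k / 2 ^ n"
  unfolding grid_refine[OF assms] dyadic_floor_def dyadic_index_grid ..

text \<open>\<open>Z\<close> solves the equation without drift, so it agrees almost surely with the
  scaled Brownian path and its path law is the Wiener measure of variance \<gamma>.\<close>

locale controlled_diffusion = brownian_motion M B + regular_drift u C
  for M :: "'w measure" and B :: "real \<Rightarrow> 'w \<Rightarrow> 'a::euclidean_space" and u :: "real \<Rightarrow> 'a \<Rightarrow> 'a" and C :: real +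
  fixes \<gamma> :: real and \<Theta> Z :: "real \<Rightarrow> 'w \<Rightarrow> 'a"
  assumes \<gamma>_pos: "\<gamma> > 0"
    and sde: "sde_solution M B \<gamma> u \<Theta>"
    and sde0: "sde_solution M B \<gamma> (\<lambda>_ _. 0) Z"
begin

text \<open>Subtracting \<open>B 0\<close> makes the path start at 0 for every outcome and not just
  almost surely, so that the Euler equation below holds without exceptional sets.\<close>

definition noise_path :: "'w \<Rightarrow> real \<Rightarrow> 'a" where
  "noise_path \<omega> t = sqrt \<gamma> *\<^sub>R (B t \<omega> - B 0 \<omega>)"

definition grid_path :: "nat \<Rightarrow> (nat \<Rightarrow> 'a) \<Rightarrow> real \<Rightarrow> 'a" where
  "grid_path m \<eta> t = sqrt \<gamma> *\<^sub>R (\<Sum>j<dyadic_index m t. \<eta> j)"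

text \<open>The drift in units of Brownian increments: \<open>grid_path\<close> multiplies
  increments by \<open>sqrt \<gamma>\<close>, so a displacement of the path by drift times
  \<open>1 / 2 ^ m\<close> is a shift of the increment by that amount over
  \<open>sqrt \<gamma>\<close>.\<close>

definition scaled_drift :: "nat \<Rightarrow> nat \<Rightarrow> nat \<Rightarrow> (nat \<Rightarrow> 'a) \<Rightarrow> 'a" where
  "scaled_drift a m k \<eta> = frozen_drift u a m (grid_path m \<eta>) k /\<^sub>R (2 ^ m * sqrt \<gamma>)"

definition increments :: "nat \<Rightarrow> 'w \<Rightarrow> nat \<Rightarrow> 'a" where
  "increments m \<omega> = (\<lambda>k\<in>{..<2^m}. increment m k \<omega>)"

definition euler :: "nat \<Rightarrow> nat \<Rightarrow> 'w \<Rightarrow> real \<Rightarrow> 'a" where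
  "euler a m \<omega> = grid_path m (triangular_shift (scaled_drift a m) (increments m \<omega>) (2 ^ m))"

text \<open>For \<open>c = a\<close> this is the drift that drives the scheme; for other
  \<open>c\<close> it is the drift a competing scheme would use along the same path.\<close>

definition drift :: "nat \<Rightarrow> nat \<Rightarrow> nat \<Rightarrow> nat \<Rightarrow> 'w \<Rightarrow> 'a" where
  "drift a c m j \<omega> = frozen_drift u c m (euler a m \<omega>) j"

lemma sqrt_\<gamma>_pos: "sqrt \<gamma> > 0" "sqrt \<gamma> * sqrt \<gamma> = \<gamma>"
  using \<gamma>_pos by auto

lemma grid_path_grid [simp]: "grid_path m \<eta> (real k / 2 ^ m) = sqrt \<gamma> *\<^sub>R (\<Sum>j<k. \<eta> j)"
  by (simp add: grid_path_def)

lemma grid_path_floor: "grid_path m \<eta> t = grid_path m \<eta> (dyadic_floor m t)"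
  unfolding dyadic_floor_def grid_path_grid by (simp add: grid_path_def)

lemma frozen_drift_grid_path_cong:
  assumes "\<And>j. j < k \<Longrightarrow> \<eta> j = \<eta>' j"
  shows "frozen_drift u c m (grid_path m \<eta>) k = frozen_drift u c m (grid_path m \<eta>') k"
  unfolding frozen_drift_def grid_path_grid
  using assms coarse_index_le[of c m k]
  by (intro arg_cong[of _ _ "\<lambda>s. u _ (sqrt \<gamma> *\<^sub>R s)"] sum.cong) auto

lemma scaled_drift_restrict: "scaled_drift a m k (restrict \<eta> {..<k}) = scaled_drift a m k \<eta>"
  unfolding scaled_drift_def by (subst frozen_drift_grid_path_cong[of k _ \<eta>]) auto

lemma measurable_grid_path:
  assumes "t \<in> {0..1}"
  shows "(\<lambda>\<eta>. grid_path m \<eta> t) \<in> borel_measurable (PiM {..<2^m} (\<lambda>_. borel))"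
  unfolding grid_path_def
  using dyadic_index_le[of t m] assms
  by (intro borel_measurable_scaleR borel_measurable_sum borel_measurable_const measurable_component_singleton) auto

lemma measurable_frozen_drift_grid_path:
  assumes "k < 2 ^ m" "{..<k} \<subseteq> I"
  shows "(\<lambda>\<eta>. frozen_drift u c m (grid_path m \<eta>) k) \<in> borel_measurable (PiM I (\<lambda>_. borel))"
proof -
  have "coarse_index c m k \<le> 2 ^ m" using coarse_index_le[of c m k] assms by simp
  from measurable_u[OF grid_mem[OF this]] show ?thesis
    unfolding frozen_drift_def grid_path_grid
    using assms coarse_index_le[of c m k]
    by (elim measurable_compose[rotated])
       (intro borel_measurable_scaleR borel_measurable_sum borel_measurable_const measurable_component_singleton, auto)
qed

lemma measurable_scaled_drift:
  assumes "k < 2 ^ m"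
  shows "scaled_drift a m k \<in> borel_measurable (PiM {..<k} (\<lambda>_. borel))"
  unfolding scaled_drift_def[abs_def]
  using measurable_frozen_drift_grid_path[OF assms order_refl] by measurable

lemma measurable_increments [measurable]: "increments m \<in> M \<rightarrow>\<^sub>M PiM {..<2^m} (\<lambda>_. borel)"
  unfolding increments_def[abs_def] by measurable

lemma measurable_euler_shift [measurable]:
  "(\<lambda>\<xi>. triangular_shift (scaled_drift a m) \<xi> (2 ^ m))
     \<in> PiM {..<2^m} (\<lambda>_. borel) \<rightarrow>\<^sub>M PiM {..<2^m} (\<lambda>_. borel)"
  by (rule measurable_triangular_shift) (auto intro: measurable_scaled_drift)

lemma measurable_euler [measurable]:
  assumes "t \<in> {0..1}"
  shows "(\<lambda>\<omega>. euler a m \<omega> t) \<in> borel_measurable M"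
  unfolding euler_def
  by (rule measurable_compose[OF _ measurable_grid_path[OF assms]]) measurable

lemma measurable_drift [measurable]:
  assumes "j < 2 ^ m"
  shows "drift a c m j \<in> borel_measurable M"
  unfolding drift_def[abs_def] euler_def
  by (rule measurable_compose[OF _ measurable_frozen_drift_grid_path[OF assms, of "{..<2^m}"]])
     (use assms in auto)

lemma measurable_girsanov_exponent:
  assumes "\<And>t. t \<in> {0..1} \<Longrightarrow> (\<lambda>x. w x t) \<in> borel_measurable N"
  shows "(\<lambda>x. girsanov_exponent \<gamma> u n (w x)) \<in> borel_measurable N"
proof -
  have [measurable]: "(\<lambda>x. w x (real k / 2 ^ n)) \<in> borel_measurable N" if "k \<le> 2 ^ n" for k
    using assms grid_mem[OF that] by blast
  have [measurable]: "(\<lambda>x. u (real k / 2 ^ n) (w x (real k / 2 ^ n))) \<in> borel_measurable N" if "k < 2 ^ n" for k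
    using that by (intro measurable_compose[OF _ measurable_u] grid_mem) auto
  show ?thesis
    unfolding girsanov_exponent_def
    by (intro borel_measurable_divide borel_measurable_sum borel_measurable_diff borel_measurable_inner
          borel_measurable_power borel_measurable_norm borel_measurable_const
          measurable_compose[OF _ borel_measurable_norm]) (auto simp del: of_nat_Suc)
qed

lemma increments_nth: "k < 2 ^ m \<Longrightarrow> increments m \<omega> k = increment m k \<omega>"
  by (simp add: increments_def)

lemma sum_increments:
  assumes "k \<le> 2 ^ m"
  shows "sqrt \<gamma> *\<^sub>R (\<Sum>j<k. increments m \<omega> j) = noise_path \<omega> (real k / 2 ^ m)"
proof -
  have "(\<Sum>j<k. increments m \<omega> j) = (\<Sum>j<k. B (real (Suc j) / 2 ^ m) \<omega> - B (real j / 2 ^ m) \<omega>)"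
    using assms by (intro sum.cong) (auto simp: increments_nth increment_def)
  also have "\<dots> = B (real k / 2 ^ m) \<omega> - B (real 0 / 2 ^ m) \<omega>"
    using sum_lessThan_telescope[of "\<lambda>j. B (real j / 2 ^ m) \<omega>" k] by (simp del: of_nat_Suc)
  finally show ?thesis by (simp add: noise_path_def)
qed

lemma euler_step:
  assumes "k < 2 ^ m"
  shows "euler a m \<omega> (real (Suc k) / 2 ^ m) - euler a m \<omega> (real k / 2 ^ m)
       = drift a a m k \<omega> /\<^sub>R 2 ^ m + sqrt \<gamma> *\<^sub>R increment m k \<omega>"
proof -
  let ?\<eta> = "triangular_shift (scaled_drift a m) (increments m \<omega>)"
  have "euler a m \<omega> (real (Suc k) / 2 ^ m) - euler a m \<omega> (real k / 2 ^ m) = sqrt \<gamma> *\<^sub>R ?\<eta> (2 ^ m) k"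
    unfolding euler_def grid_path_grid by (simp add: scaleR_right_distrib)
  also have "?\<eta> (2 ^ m) k = increment m k \<omega> + scaled_drift a m k (?\<eta> (2 ^ m))"
    using assms scaled_drift_restrict[of a m k "?\<eta> (2 ^ m)"]
    by (simp add: triangular_shift_nth increments_nth restrict_triangular_shift)
  also have "sqrt \<gamma> *\<^sub>R \<dots> = drift a a m k \<omega> /\<^sub>R 2 ^ m + sqrt \<gamma> *\<^sub>R increment m k \<omega>"
    using sqrt_\<gamma>_pos by (simp add: scaled_drift_def drift_def euler_def scaleR_right_distrib)
  finally show ?thesis .
qed

text \<open>Links the two descriptions of the scheme: the shifted Gaussian increments, for which the
  law is explicit, and the summed equation, to which the pathwise convergence applies.\<close>

lemma euler_path_euler: "euler_path u (noise_path \<omega>) a m (euler a m \<omega>)"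
  unfolding euler_path_def
proof (intro conjI allI impI ballI)
  fix k :: nat assume "k \<le> 2 ^ m"
  then show "euler a m \<omega> (real k / 2 ^ m)
      = (\<Sum>j<k. frozen_drift u a m (euler a m \<omega>) j /\<^sub>R 2 ^ m) + noise_path \<omega> (real k / 2 ^ m)"
  proof (induction k)
    case 0
    have "euler a m \<omega> (real 0 / 2 ^ m) = 0" unfolding euler_def grid_path_grid by simp
    then show ?case by (simp add: noise_path_def)
  next
    case (Suc k)
    then have "sqrt \<gamma> *\<^sub>R increment m k \<omega> = noise_path \<omega> (real (Suc k) / 2 ^ m) - noise_path \<omega> (real k / 2 ^ m)"
      by (simp add: noise_path_def increment_def algebra_simps del: of_nat_Suc)
    then show ?case
      using euler_step[of k m a \<omega>] Suc unfolding drift_def by (simp add: algebra_simps del: of_nat_Suc)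
  qed
next
  fix t show "euler a m \<omega> t = euler a m \<omega> (dyadic_floor m t)"
    unfolding euler_def by (rule grid_path_floor)
qed

text \<open>The density of the law of the Euler scheme with respect to the law of the scaled Brownian path.\<close>

lemma nn_integral_euler:
  assumes "a \<le> m" and f: "(\<lambda>\<eta>. f (grid_path m \<eta>)) \<in> borel_measurable (PiM {..<2^m} (\<lambda>_. borel))"
  shows "(\<integral>\<^sup>+\<omega>. f (euler a m \<omega>) \<partial>M) = (\<integral>\<^sup>+\<omega>. f (grid_path m (increments m \<omega>))
     * ennreal (exp (girsanov_exponent \<gamma> u a (grid_path m (increments m \<omega>)))) \<partial>M)"
proof -
  let ?\<mu> = "gaussian_measure (1 / 2 ^ m) :: 'a measure"
  let ?tri = "\<lambda>\<xi>. triangular_shift (scaled_drift a m) \<xi> (2 ^ m)"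
  have distr: "distr M (PiM {..<2^m} (\<lambda>_. borel)) (increments m) = PiM {..<2^m} (\<lambda>_. ?\<mu>)"
    unfolding increments_def[abs_def] by (rule distr_increments) simp
  have [measurable]: "(\<lambda>\<eta>. girsanov_exponent \<gamma> u a (grid_path m \<eta>)) \<in> borel_measurable (PiM {..<2^m} (\<lambda>_. borel))"
    by (intro measurable_girsanov_exponent measurable_grid_path)
  \<comment> \<open>The shift carries \<open>1 / (2 ^ m * sqrt \<gamma>)\<close> and the increments
    have variance \<open>1 / 2 ^ m\<close>, so the exponent of the Gaussian translations is the
    Girsanov exponent on the fine grid, and by refinement the one of mesh \<open>a\<close>.\<close>
  have exponent: "(\<Sum>k<2^m. \<eta> k \<bullet> scaled_drift a m k (restrict \<eta> {..<k})
             - (norm (scaled_drift a m k (restrict \<eta> {..<k})))\<^sup>2 / 2) / (1 / 2 ^ m)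
      = girsanov_exponent \<gamma> u a (grid_path m \<eta>)" for \<eta>
    unfolding girsanov_exponent_refine[OF assms(1)] sum_divide_distrib scaled_drift_restrict
  proof (rule sum.cong[OF refl])
    fix k
    let ?F = "frozen_drift u a m (grid_path m \<eta>) k"
    have "grid_path m \<eta> (real (Suc k) / 2 ^ m) - grid_path m \<eta> (real k / 2 ^ m) = sqrt \<gamma> *\<^sub>R \<eta> k"
      unfolding grid_path_grid by (simp add: scaleR_right_distrib)
    then have 1: "?F \<bullet> (grid_path m \<eta> (real (Suc k) / 2 ^ m) - grid_path m \<eta> (real k / 2 ^ m)) / \<gamma>
        = \<eta> k \<bullet> scaled_drift a m k \<eta> / (1 / 2 ^ m)"
      using sqrt_\<gamma>_pos \<gamma>_pos by (simp add: scaled_drift_def inner_commute field_simps)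
    have 2: "(norm (scaled_drift a m k \<eta>))\<^sup>2 / 2 / (1 / 2 ^ m) = (norm ?F)\<^sup>2 / 2 ^ m / 2 / \<gamma>"
      using sqrt_\<gamma>_pos \<gamma>_pos by (simp add: scaled_drift_def power2_eq_square field_simps)
    show "(\<eta> k \<bullet> scaled_drift a m k \<eta> - (norm (scaled_drift a m k \<eta>))\<^sup>2 / 2) / (1 / 2 ^ m)
      = (?F \<bullet> (grid_path m \<eta> (real (Suc k) / 2 ^ m) - grid_path m \<eta> (real k / 2 ^ m)) - (norm ?F)\<^sup>2 / 2 ^ m / 2) / \<gamma>"
      unfolding diff_divide_distrib 1[symmetric] 2[symmetric] ..
  qed
  have "(\<integral>\<^sup>+\<omega>. f (euler a m \<omega>) \<partial>M) = (\<integral>\<^sup>+\<xi>. f (grid_path m (?tri \<xi>)) \<partial>PiM {..<2^m} (\<lambda>_. ?\<mu>))"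
    unfolding distr[symmetric] euler_def
    by (rule nn_integral_distr[symmetric]) (auto intro: measurable_compose[OF measurable_euler_shift f])
  also have "\<dots> = (\<integral>\<^sup>+\<eta>. f (grid_path m \<eta>) * ennreal (exp (girsanov_exponent \<gamma> u a (grid_path m \<eta>))) \<partial>PiM {..<2^m} (\<lambda>_. ?\<mu>))"
    using nn_integral_triangular_shift[of "1 / 2 ^ m" "2 ^ m" "scaled_drift a m" "\<lambda>\<eta>. f (grid_path m \<eta>)"]
    by (simp only: exponent prob_space_gaussian_measure measurable_scaled_drift f) simp
  also have "\<dots> = (\<integral>\<^sup>+\<omega>. f (grid_path m (increments m \<omega>))
     * ennreal (exp (girsanov_exponent \<gamma> u a (grid_path m (increments m \<omega>)))) \<partial>M)"
    unfolding distr[symmetric]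
    by (rule nn_integral_distr) (use f in measurable)
  finally show ?thesis .
qed

lemma measurable_\<Theta> [measurable]: "t \<in> {0..1} \<Longrightarrow> \<Theta> t \<in> borel_measurable M"
  and measurable_Z [measurable]: "t \<in> {0..1} \<Longrightarrow> Z t \<in> borel_measurable M"
  and continuous_\<Theta>: "\<omega> \<in> space M \<Longrightarrow> continuous_on {0..1} (\<lambda>t. \<Theta> t \<omega>)"
  and continuous_Z: "\<omega> \<in> space M \<Longrightarrow> continuous_on {0..1} (\<lambda>t. Z t \<omega>)"
  using sde sde0 by (auto simp: sde_solution_def)

lemma AE_drift_ode: "AE \<omega> in M. drift_ode u C (noise_path \<omega>) (\<lambda>t. \<Theta> t \<omega>)"
proof -
  have "AE \<omega> in M. \<Theta> 0 \<omega> = 0 \<and> (\<forall>t\<in>{0..1}. \<Theta> t \<omega> = (LBINT s:{0..t}. u s (\<Theta> s \<omega>)) + sqrt \<gamma> *\<^sub>R B t \<omega>)"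
    using sde by (simp add: sde_solution_def)
  then show ?thesis using AE_B_0 AE_space
  proof eventually_elim
    case (elim \<omega>)
    have "continuous_on {0..1} (\<lambda>t. B t \<omega>)"
      by (rule continuous_on_subset[OF continuous_B]) (use elim in auto)
    then have "continuous_on {0..1} (noise_path \<omega>)"
      unfolding noise_path_def by (intro continuous_intros)
    then show ?case
      using elim continuous_\<Theta> by unfold_locales (auto simp: noise_path_def)
  qed
qed

lemma AE_Z: "AE \<omega> in M. \<forall>t\<in>{0..1}. Z t \<omega> = noise_path \<omega> t"
proof -
  have "AE \<omega> in M. Z 0 \<omega> = 0 \<and> (\<forall>t\<in>{0..1}. Z t \<omega> = (LBINT s:{0..t}. 0) + sqrt \<gamma> *\<^sub>R B t \<omega>)"
    using sde0 by (simp add: sde_solution_def)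
  then show ?thesis using AE_B_0 by eventually_elim (simp add: noise_path_def)
qed

lemma AE_grid_path_increments:
  "AE \<omega> in M. \<forall>m. \<forall>t\<in>{0..1}. grid_path m (increments m \<omega>) t = Z (dyadic_floor m t) \<omega>"
  using AE_Z
proof eventually_elim
  case (elim \<omega>)
  show ?case
  proof (intro allI ballI)
    fix m and t :: real assume t: "t \<in> {0..1}"
    then have "dyadic_index m t \<le> 2 ^ m" by (intro dyadic_index_le) auto
    from sum_increments[OF this] show "grid_path m (increments m \<omega>) t = Z (dyadic_floor m t) \<omega>"
      using elim dyadic_floor_mem[OF t, of m] by (simp add: grid_path_def dyadic_floor_def)
  qed
qed

text \<open>The exponent of level \<open>n\<close> reads a path at points of grid \<open>n\<close>
  only; these belong to grid \<open>m\<close>, where the step path coincides with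
  \<open>Z\<close>.\<close>

lemma AE_girsanov_exponent_increments:
  "AE \<omega> in M. \<forall>n m. n \<le> m \<longrightarrow> girsanov_exponent \<gamma> u n (grid_path m (increments m \<omega>)) = girsanov_exponent \<gamma> u n (\<lambda>t. Z t \<omega>)"
  using AE_grid_path_increments
  by eventually_elim (auto intro!: girsanov_exponent_cong simp: dyadic_floor_grid grid_mem simp del: atLeastAtMost_iff)

end

section \<open>Convergence of the energies\<close>

text \<open>Only uniform closeness on each cell is asked, so the summands may come from a path that
  itself varies with \<open>n\<close>, as for the energies of the schemes.\<close>

lemma riemann_sum_tendsto:
  fixes f :: "real \<Rightarrow> real"
  assumes f: "continuous_on {0..1} f"
    and g: "\<And>\<epsilon>. \<epsilon> > 0 \<Longrightarrow> \<exists>N. \<forall>n\<ge>N. \<forall>j<2^n. \<forall>s. real j / 2 ^ n \<le> s \<longrightarrow> s \<le> real (Suc j) / 2 ^ n \<longrightarrow> \<bar>g n j - f s\<bar> \<le> \<epsilon>"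
  shows "(\<lambda>n. \<Sum>j<2^n. g n j / 2 ^ n) \<longlonglongrightarrow> (LBINT s:{0..1}. f s)"
proof (rule LIMSEQ_I)
  fix r :: real assume "r > 0"
  then obtain N where N: "\<And>n j s. n \<ge> N \<Longrightarrow> j < 2^n \<Longrightarrow> real j / 2 ^ n \<le> s \<Longrightarrow> s \<le> real (Suc j) / 2 ^ n \<Longrightarrow> \<bar>g n j - f s\<bar> \<le> r / 2"
    using g[of "r / 2"] by (metis half_gt_zero)
  show "\<exists>N. \<forall>n\<ge>N. norm ((\<Sum>j<2^n. g n j / 2 ^ n) - (LBINT s:{0..1}. f s)) < r"
  proof (intro exI allI impI)
    fix n assume n: "n \<ge> N"
    have eq: "(\<Sum>j<2^n. g n j /\<^sub>R 2 ^ n) = (\<Sum>j<2^n. g n j / 2 ^ n)"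
      by (simp only: real_scaleR_def divide_inverse_commute)
    have "norm ((\<Sum>j<2^n. g n j /\<^sub>R 2 ^ n) - (LBINT s:{0..real (2^n) / 2 ^ n}. f s)) \<le> (\<Sum>j<(2::nat)^n. r / 2 / 2 ^ n)"
      by (intro riemann_sum_error[OF f order_refl]) (use N n in \<open>auto simp del: of_nat_Suc\<close>)
    also have "\<dots> = r / 2" by simp
    finally show "norm ((\<Sum>j<2^n. g n j / 2 ^ n) - (LBINT s:{0..1}. f s)) < r"
      using \<open>r > 0\<close> unfolding eq by simp
  qed
qed

lemma riemann_sum_tendsto_continuous:
  fixes f :: "real \<Rightarrow> real"
  assumes f: "continuous_on {0..1} f"
  shows "(\<lambda>n. \<Sum>j<2^n. f (real j / 2 ^ n) / 2 ^ n) \<longlonglongrightarrow> (LBINT s:{0..1}. f s)"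
proof (rule riemann_sum_tendsto[OF f])
  fix \<epsilon> :: real assume "\<epsilon> > 0"
  then obtain d where d: "d > 0" "\<forall>s\<in>{0..1}. \<forall>t\<in>{0..1}. dist t s < d \<longrightarrow> dist (f t) (f s) < \<epsilon>"
    using compact_uniformly_continuous[OF f compact_Icc] unfolding uniformly_continuous_on_def by metis
  obtain N where N: "(1/2)^N < d" using real_arch_pow_inv[of d "1/2"] d by auto
  show "\<exists>N. \<forall>n\<ge>N. \<forall>j<2^n. \<forall>s. real j / 2 ^ n \<le> s \<longrightarrow> s \<le> real (Suc j) / 2 ^ n \<longrightarrow> \<bar>f (real j / 2 ^ n) - f s\<bar> \<le> \<epsilon>"
  proof (intro exI allI impI)
    fix n j s assume n: "n \<ge> N" and j: "j < 2^n" and s: "real j / 2 ^ n \<le> s" "s \<le> real (Suc j) / 2 ^ n"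
    have p: "(1/2::real)^n \<le> (1/2)^N" using n by (intro power_decreasing) auto
    moreover have "real (Suc j) / 2 ^ n = real j / 2 ^ n + (1/2)^n" by (simp add: add_divide_distrib power_one_over)
    ultimately have "dist (real j / 2 ^ n) s < d" using s N unfolding dist_real_def by linarith
    moreover have "real j / 2 ^ n \<in> {0..1}" "real (Suc j) / 2 ^ n \<in> {0..1}"
      using j by (auto intro!: grid_mem simp del: atLeastAtMost_iff of_nat_Suc)
    then have "real j / 2 ^ n \<in> {0..1}" "s \<in> {0..1}" using s unfolding atLeastAtMost_iff by linarith+
    ultimately have "dist (f (real j / 2 ^ n)) (f s) < \<epsilon>" using d(2) by blast
    then show "\<bar>f (real j / 2 ^ n) - f s\<bar> \<le> \<epsilon>" by (simp add: dist_real_def)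
  qed
qed

lemma abs_diff_norm_squares_le:
  "\<bar>(norm x)\<^sup>2 - (norm y)\<^sup>2\<bar> \<le> norm (x - y) * (norm x + norm y)" for x y :: "'b::real_normed_vector"
proof -
  have "\<bar>(norm x)\<^sup>2 - (norm y)\<^sup>2\<bar> = \<bar>norm x - norm y\<bar> * (norm x + norm y)"
    by (simp add: power2_eq_square square_diff_square_factored abs_mult)
  then show ?thesis using norm_triangle_ineq3[of x y] by (simp add: mult_right_mono)
qed

lemma norm_diff_square_le: "(norm (x - y))\<^sup>2 \<le> 2 * (norm x)\<^sup>2 + 2 * (norm y)\<^sup>2"
  for x y :: "'b::real_inner"
proof -
  have "(norm (x - y))\<^sup>2 + (norm (x + y))\<^sup>2 = 2 * (norm x)\<^sup>2 + 2 * (norm y)\<^sup>2"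
    by (simp add: power2_norm_eq_inner inner_diff inner_add)
  then show ?thesis by (smt (verit) zero_le_power2)
qed

lemma abs_inner_le_squares: "\<bar>x \<bullet> y\<bar> \<le> (norm x)\<^sup>2 + (norm y)\<^sup>2" for x y :: "'b::real_inner"
proof -
  have "\<bar>x \<bullet> y\<bar> \<le> norm x * norm y" by (rule Cauchy_Schwarz_ineq2)
  also have "\<dots> \<le> (norm x)\<^sup>2 + (norm y)\<^sup>2"
    using sum_squares_bound[of "norm x" "norm y"] mult_nonneg_nonneg[OF norm_ge_zero[of x] norm_ge_zero[of y]]
    by linarith
  finally show ?thesis .
qed

section \<open>The energy of a path and bounds from linear growth\<close>

context regular_drift
begin

definition energy :: "(real \<Rightarrow> 'a) \<Rightarrow> real" where
  "energy w = (LBINT t:{0..1}. (norm (u t (w t)))\<^sup>2)"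

lemma energy_riemann:
  assumes "continuous_on {0..1} w"
  shows "(\<lambda>n. \<Sum>j<2^n. (norm (u (real j / 2 ^ n) (w (real j / 2 ^ n))))\<^sup>2 / 2 ^ n) \<longlonglongrightarrow> energy w"
  unfolding energy_def
  by (rule riemann_sum_tendsto_continuous) (intro continuous_intros continuous_on_u_path assms order_refl)

lemma energy_nonneg: "0 \<le> energy w"
  unfolding energy_def set_lebesgue_integral_def by (rule Bochner_Integration.integral_nonneg) simp

lemma measurable_energy:
  assumes "\<And>t. t \<in> {0..1} \<Longrightarrow> (\<lambda>x. w x t) \<in> borel_measurable N"
    and "\<And>x. x \<in> space N \<Longrightarrow> continuous_on {0..1} (w x)"
  shows "(\<lambda>x. energy (w x)) \<in> borel_measurable N"
proof (rule borel_measurable_LIMSEQ_real)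
  fix x assume "x \<in> space N"
  then show "(\<lambda>n. \<Sum>j<2^n. (norm (u (real j / 2 ^ n) (w x (real j / 2 ^ n))))\<^sup>2 / 2 ^ n) \<longlonglongrightarrow> energy (w x)"
    by (intro energy_riemann assms)
next
  fix n
  have [measurable]: "(\<lambda>x. u (real j / 2 ^ n) (w x (real j / 2 ^ n))) \<in> borel_measurable N" if "j < 2 ^ n" for j
    using that by (intro measurable_compose[OF assms(1) measurable_u] grid_mem) auto
  show "(\<lambda>x. \<Sum>j<2^n. (norm (u (real j / 2 ^ n) (w x (real j / 2 ^ n))))\<^sup>2 / 2 ^ n) \<in> borel_measurable N"
    by (intro borel_measurable_sum borel_measurable_divide borel_measurable_power
          measurable_compose[OF _ borel_measurable_norm]) auto
qed

lemma energy_le: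
  assumes "\<And>t. t \<in> {0..1} \<Longrightarrow> (norm (u t (w t)))\<^sup>2 \<le> V" "continuous_on {0..1} w"
  shows "energy w \<le> V"
proof (rule LIMSEQ_le_const2[OF energy_riemann[OF assms(2)]], intro exI allI impI)
  fix n :: nat
  have "(\<Sum>j<2^n. (norm (u (real j / 2 ^ n) (w (real j / 2 ^ n))))\<^sup>2 / 2 ^ n) \<le> (\<Sum>j<(2::nat)^n. V / 2 ^ n)"
    by (intro sum_mono divide_right_mono assms(1) grid_mem) auto
  then show "(\<Sum>j<2^n. (norm (u (real j / 2 ^ n) (w (real j / 2 ^ n))))\<^sup>2 / 2 ^ n) \<le> V" by simp
qed

lemma growth_square:
  assumes "t \<in> {0..1}" "(norm x)\<^sup>2 \<le> W"
  shows "(norm (u t x))\<^sup>2 \<le> 2 * C\<^sup>2 * (1 + W)"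
proof -
  have "(norm (u t x))\<^sup>2 \<le> (C * (1 + norm x))\<^sup>2"
    using growth[OF assms(1), of x] by (intro power_mono) auto
  also have "\<dots> = C\<^sup>2 * (1 + norm x)\<^sup>2" by (simp add: power_mult_distrib)
  also have "\<dots> \<le> C\<^sup>2 * (2 * (1 + W))"
    using sum_squares_bound[of 1 "norm x"] assms(2) by (intro mult_left_mono) (simp_all add: power2_sum)
  finally show ?thesis by (simp only: mult_ac)
qed

text \<open>A crude bound term by term. The factor \<open>2 ^ n\<close> is harmless, since
  \<open>n\<close> stays fixed while the scheme is refined; what counts is that the bound is affine
  in \<open>W\<close>, hence integrable for an integrable envelope.\<close>

lemma girsanov_exponent_bound:
  assumes "\<gamma> > 0" and w: "\<And>t. t \<in> {0..1} \<Longrightarrow> (norm (w t))\<^sup>2 \<le> W"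
  shows "\<bar>girsanov_exponent \<gamma> u n w\<bar> \<le> 2 ^ n * (4 * C\<^sup>2 * (1 + W) + 4 * W) / \<gamma>"
proof -
  let ?t = "\<lambda>k. u (real k / 2 ^ n) (w (real k / 2 ^ n)) \<bullet> (w (real (Suc k) / 2 ^ n) - w (real k / 2 ^ n))
        - (norm (u (real k / 2 ^ n) (w (real k / 2 ^ n))))\<^sup>2 / 2 ^ n / 2"
  have "\<bar>\<Sum>k<2^n. ?t k\<bar> \<le> (\<Sum>k<(2::nat)^n. 4 * C\<^sup>2 * (1 + W) + 4 * W)"
  proof (rule order_trans[OF sum_abs], rule sum_mono)
    fix k assume "k \<in> {..<(2::nat) ^ n}"
    then have k: "real k / 2 ^ n \<in> {0..1}" "real (Suc k) / 2 ^ n \<in> {0..1}" by (auto intro!: grid_mem simp del: atLeastAtMost_iff of_nat_Suc)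
    let ?u = "u (real k / 2 ^ n) (w (real k / 2 ^ n))"
    have 1: "(norm ?u)\<^sup>2 \<le> 2 * C\<^sup>2 * (1 + W)" by (intro growth_square w k)
    have 2: "(norm (w (real (Suc k) / 2 ^ n) - w (real k / 2 ^ n)))\<^sup>2 \<le> 4 * W"
      using norm_diff_square_le[of "w (real (Suc k) / 2 ^ n)" "w (real k / 2 ^ n)"] w[OF k(1)] w[OF k(2)] by linarith
    define q where "q = (norm ?u)\<^sup>2 / 2 ^ n"
    have "q \<le> (norm ?u)\<^sup>2 / 1" unfolding q_def by (intro divide_left_mono) auto
    then have "q \<le> (norm ?u)\<^sup>2" "0 \<le> q" by (simp_all add: q_def)
    then have 3: "\<bar>(norm ?u)\<^sup>2 / 2 ^ n / 2\<bar> \<le> (norm ?u)\<^sup>2" unfolding q_def[symmetric] by linarith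
    show "\<bar>?t k\<bar> \<le> 4 * C\<^sup>2 * (1 + W) + 4 * W"
      using abs_triangle_ineq4[of "?u \<bullet> (w (real (Suc k) / 2 ^ n) - w (real k / 2 ^ n))" "(norm ?u)\<^sup>2 / 2 ^ n / 2"]
        abs_inner_le_squares[of ?u "w (real (Suc k) / 2 ^ n) - w (real k / 2 ^ n)"] 1 2 3 by linarith
  qed
  also have "\<dots> = 2 ^ n * (4 * C\<^sup>2 * (1 + W) + 4 * W)" by simp
  finally show ?thesis
    using assms(1) unfolding girsanov_exponent_def abs_divide by (simp add: divide_right_mono)
qed

end

section \<open>A common envelope, and the limits of energies and exponents\<close>

context controlled_diffusion
begin

definition is_envelope :: "('w \<Rightarrow> real) \<Rightarrow> bool" where
  "is_envelope W \<longleftrightarrow> integrable M W \<and> (\<forall>\<omega>. 0 \<le> W \<omega>) \<and> (AE \<omega> in M.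
     (\<forall>a m. a \<le> m \<longrightarrow> (\<forall>t\<in>{0..1}. (norm (euler a m \<omega> t))\<^sup>2 \<le> W \<omega>)) \<and>
     (\<forall>t\<in>{0..1}. (norm (\<Theta> t \<omega>))\<^sup>2 \<le> W \<omega>) \<and> (\<forall>t\<in>{0..1}. (norm (B t \<omega>))\<^sup>2 \<le> W \<omega>))"

text \<open>Gronwall is applied to the schemes only; the solution inherits their bound as their
  pointwise limit.\<close>

lemma ex_envelope: "\<exists>W. is_envelope W"
proof -
  obtain G where G: "integrable M G" "\<And>\<omega>. 0 \<le> G \<omega>" "AE \<omega> in M. \<forall>t\<in>{0..1}. (norm (B t \<omega>))\<^sup>2 \<le> G \<omega>"
    using square_integrable_sup_B by blast
  \<comment> \<open>The first term dominates the square of the Gronwall bound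
    \<open>(C + sqrt (\<gamma> * G \<omega>)) * exp C\<close>, by
    \<open>(a + b)\<^sup>2 \<le> 2 * (a\<^sup>2 + b\<^sup>2)\<close>; the second covers the Brownian
    path itself.\<close>
  define W where "W \<omega> = 2 * (exp C)\<^sup>2 * (C\<^sup>2 + \<gamma> * G \<omega>) + G \<omega>" for \<omega>
  have W0: "0 \<le> W \<omega>" for \<omega> using G(2)[of \<omega>] \<gamma>_pos by (simp add: W_def)
  show ?thesis
    unfolding is_envelope_def
  proof (intro exI conjI)
    show "integrable M W" unfolding W_def using G(1) by simp
    show "\<forall>\<omega>. 0 \<le> W \<omega>" using W0 by simp
    show "AE \<omega> in M. (\<forall>a m. a \<le> m \<longrightarrow> (\<forall>t\<in>{0..1}. (norm (euler a m \<omega> t))\<^sup>2 \<le> W \<omega>)) \<and>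
     (\<forall>t\<in>{0..1}. (norm (\<Theta> t \<omega>))\<^sup>2 \<le> W \<omega>) \<and> (\<forall>t\<in>{0..1}. (norm (B t \<omega>))\<^sup>2 \<le> W \<omega>)"
      using G(3) AE_drift_ode AE_B_0
    proof eventually_elim
      case (elim \<omega>)
      interpret drift_ode u C "noise_path \<omega>" "\<lambda>t. \<Theta> t \<omega>" by (rule elim)
      have b: "norm (noise_path \<omega> t) \<le> sqrt (\<gamma> * G \<omega>)" if "t \<in> {0..1}" for t
        using elim that \<gamma>_pos by (auto simp: noise_path_def real_sqrt_mult intro!: mult_left_mono real_le_rsqrt)
      have "((C + sqrt (\<gamma> * G \<omega>)) * exp C)\<^sup>2 = (exp C)\<^sup>2 * (C + sqrt (\<gamma> * G \<omega>))\<^sup>2"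
        by (simp add: power_mult_distrib mult.commute)
      also have "(C + sqrt (\<gamma> * G \<omega>))\<^sup>2 \<le> 2 * (C\<^sup>2 + \<gamma> * G \<omega>)"
        using sum_squares_bound[of C "sqrt (\<gamma> * G \<omega>)"] G(2)[of \<omega>] \<gamma>_pos by (simp add: power2_sum)
      finally have "((C + sqrt (\<gamma> * G \<omega>)) * exp C)\<^sup>2 \<le> (exp C)\<^sup>2 * (2 * (C\<^sup>2 + \<gamma> * G \<omega>))"
        by (simp add: mult_left_mono)
      then have W: "((C + sqrt (\<gamma> * G \<omega>)) * exp C)\<^sup>2 \<le> W \<omega>"
        using G(2)[of \<omega>] unfolding W_def by (simp only: mult.left_commute)
      have e: "norm (euler a m \<omega> t) \<le> (C + sqrt (\<gamma> * G \<omega>)) * exp C" if "a \<le> m" "t \<in> {0..1}" for a m t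
        by (rule euler_path_bound[OF euler_path_euler that(1) b that(2)])
      have "norm (\<Theta> t \<omega>) \<le> (C + sqrt (\<gamma> * G \<omega>)) * exp C" if t: "t \<in> {0..1}" for t
      proof (rule field_le_epsilon)
        fix \<epsilon> :: real assume "\<epsilon> > 0"
        then obtain n where "norm (euler n n \<omega> t - \<Theta> t \<omega>) \<le> \<epsilon>"
          using euler_path_converges[of \<epsilon>] euler_path_euler t by (metis order_refl)
        then show "norm (\<Theta> t \<omega>) \<le> (C + sqrt (\<gamma> * G \<omega>)) * exp C + \<epsilon>"
          using e[of n n t] t norm_triangle_ineq2[of "\<Theta> t \<omega>" "euler n n \<omega> t"] by (simp add: norm_minus_commute)
      qed
      then have "(norm (\<Theta> t \<omega>))\<^sup>2 \<le> W \<omega>" if "t \<in> {0..1}" for t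
        using that by (intro order_trans[OF power_mono W]) auto
      moreover have "(norm (euler a m \<omega> t))\<^sup>2 \<le> W \<omega>" if "a \<le> m" "t \<in> {0..1}" for a m t
        using e[OF that] by (intro order_trans[OF power_mono W]) auto
      moreover have "G \<omega> \<le> W \<omega>" using G(2)[of \<omega>] \<gamma>_pos by (simp add: W_def)
      then have "(norm (B t \<omega>))\<^sup>2 \<le> W \<omega>" if "t \<in> {0..1}" for t
        using elim(1) that by force
      ultimately show ?case by blast
    qed
  qed
qed

definition envelope :: "'w \<Rightarrow> real" where
  "envelope = (SOME W. is_envelope W)"

lemma integrable_envelope: "integrable M envelope"
  and envelope_nonneg: "0 \<le> envelope \<omega>"
  and AE_envelope: "AE \<omega> in M.
     (\<forall>a m. a \<le> m \<longrightarrow> (\<forall>t\<in>{0..1}. (norm (euler a m \<omega> t))\<^sup>2 \<le> envelope \<omega>)) \<and>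
     (\<forall>t\<in>{0..1}. (norm (\<Theta> t \<omega>))\<^sup>2 \<le> envelope \<omega>) \<and> (\<forall>t\<in>{0..1}. (norm (B t \<omega>))\<^sup>2 \<le> envelope \<omega>)"
  using someI_ex[OF ex_envelope, folded envelope_def] unfolding is_envelope_def by auto

definition drift_envelope :: "'w \<Rightarrow> real" where
  "drift_envelope \<omega> = 2 * C\<^sup>2 * (1 + envelope \<omega>)"

lemma integrable_drift_envelope: "integrable M drift_envelope"
  unfolding drift_envelope_def using integrable_envelope by simp

lemma drift_envelope_nonneg: "0 \<le> drift_envelope \<omega>"
  by (simp add: drift_envelope_def envelope_nonneg)

lemma drift_bound:
  assumes "a \<le> m" "c \<le> m" "j < 2 ^ m"
    and "\<forall>t\<in>{0..1}. (norm (euler a m \<omega> t))\<^sup>2 \<le> envelope \<omega>"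
  shows "(norm (drift a c m j \<omega>))\<^sup>2 \<le> drift_envelope \<omega>"
proof -
  have "coarse_index c m j \<le> 2 ^ m" using coarse_index_le[of c m j] assms by simp
  from grid_mem[OF this] show ?thesis
    unfolding drift_def frozen_drift_def drift_envelope_def by (intro growth_square) (use assms in auto)
qed

lemma AE_drift_bound:
  "AE \<omega> in M. \<forall>a c m j. a \<le> m \<longrightarrow> c \<le> m \<longrightarrow> j < 2 ^ m \<longrightarrow> (norm (drift a c m j \<omega>))\<^sup>2 \<le> drift_envelope \<omega>"
  using AE_envelope by eventually_elim (auto intro!: drift_bound)

lemma integrable_drift_inner:
  assumes "a \<le> m" "c \<le> m" "c' \<le> m" "j < 2 ^ m"
  shows "integrable M (\<lambda>\<omega>. drift a c m j \<omega> \<bullet> drift a c' m j \<omega>)"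
proof (rule Bochner_Integration.integrable_bound)
  show "integrable M (\<lambda>\<omega>. 2 * drift_envelope \<omega>)" using integrable_drift_envelope by simp
  show "(\<lambda>\<omega>. drift a c m j \<omega> \<bullet> drift a c' m j \<omega>) \<in> borel_measurable M"
    using assms by (intro borel_measurable_inner measurable_drift)
  show "AE \<omega> in M. norm (drift a c m j \<omega> \<bullet> drift a c' m j \<omega>) \<le> norm (2 * drift_envelope \<omega>)"
    using AE_drift_bound
  proof eventually_elim
    case (elim \<omega>)
    then show ?case
      using abs_inner_le_squares[of "drift a c m j \<omega>" "drift a c' m j \<omega>"] assms drift_envelope_nonneg[of \<omega>]
      by (auto simp: abs_mult) (smt (verit))
  qed
qed

text \<open>The drift at step \<open>j\<close> is a function of the increments before
  \<open>j\<close>, hence uncorrelated with the next increment. Integrability comes from the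
  envelopes of both factors.\<close>

lemma drift_increment:
  assumes "a \<le> m" "c \<le> m" "j < 2 ^ m"
  shows "integrable M (\<lambda>\<omega>. drift a c m j \<omega> \<bullet> increment m j \<omega>)" (is ?int)
    and "expectation (\<lambda>\<omega>. drift a c m j \<omega> \<bullet> increment m j \<omega>) = 0"
proof -
  show ?int
  proof (rule Bochner_Integration.integrable_bound)
    show "integrable M (\<lambda>\<omega>. drift_envelope \<omega> + 4 * envelope \<omega>)"
      using integrable_drift_envelope integrable_envelope by simp
    show "(\<lambda>\<omega>. drift a c m j \<omega> \<bullet> increment m j \<omega>) \<in> borel_measurable M"
      using assms by (intro borel_measurable_inner measurable_drift measurable_increment)
    show "AE \<omega> in M. norm (drift a c m j \<omega> \<bullet> increment m j \<omega>) \<le> norm (drift_envelope \<omega> + 4 * envelope \<omega>)"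
      using AE_drift_bound AE_envelope
    proof eventually_elim
      case (elim \<omega>)
      have "real j / 2 ^ m \<in> {0..1}" "real (Suc j) / 2 ^ m \<in> {0..1}"
        using assms(3) by (auto intro!: grid_mem simp del: atLeastAtMost_iff of_nat_Suc)
      then have "(norm (increment m j \<omega>))\<^sup>2 \<le> 4 * envelope \<omega>"
        using norm_diff_square_le[of "B (real (Suc j) / 2 ^ m) \<omega>" "B (real j / 2 ^ m) \<omega>"] elim(2)
        unfolding increment_def by (smt (verit))
      moreover have "(norm (drift a c m j \<omega>))\<^sup>2 \<le> drift_envelope \<omega>" using elim(1) assms by blast
      ultimately show ?case
        using abs_inner_le_squares[of "drift a c m j \<omega>" "increment m j \<omega>"] by (simp del: of_nat_Suc)
    qed
  qed
  \<comment> \<open>The recursion is stopped at \<open>j\<close> instead of \<open>2 ^ m\<close>.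
    The coordinates before \<open>j\<close> are the same, and the dependence on earlier increments
    alone becomes explicit.\<close>
  define \<psi> where "\<psi> \<xi> = frozen_drift u c m (grid_path m (triangular_shift (scaled_drift a m) \<xi> j)) j" for \<xi>
  have past: "\<psi> (\<lambda>i\<in>{..<j}. increment m i \<omega>) = drift a c m j \<omega>" for \<omega>
    unfolding \<psi>_def drift_def euler_def
  proof (rule frozen_drift_grid_path_cong)
    fix i assume i: "i < j"
    have "triangular_shift (scaled_drift a m) (\<lambda>i\<in>{..<j}. increment m i \<omega>) i
        = triangular_shift (scaled_drift a m) (increments m \<omega>) i"
      using i assms by (intro triangular_shift_cong) (auto simp: increments_def)
    then show "triangular_shift (scaled_drift a m) (\<lambda>i\<in>{..<j}. increment m i \<omega>) j i
        = triangular_shift (scaled_drift a m) (increments m \<omega>) (2 ^ m) i"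
      using i assms by (simp add: triangular_shift_nth increments_def)
  qed
  have "\<psi> \<in> borel_measurable (PiM {..<j} (\<lambda>_. borel))"
    unfolding \<psi>_def
    by (rule measurable_compose[OF measurable_triangular_shift measurable_frozen_drift_grid_path[of _ _ "{..<j}"]])
       (use assms in \<open>auto intro: measurable_scaled_drift\<close>)
  from expectation_past_increment[OF this, of m] \<open>?int\<close>
  show "expectation (\<lambda>\<omega>. drift a c m j \<omega> \<bullet> increment m j \<omega>) = 0" by (simp only: past)
qed

text \<open>Its expectation divided by \<open>2 * \<gamma>\<close> is the relative entropy of the
  law of scheme \<open>a\<close> with respect to that of scheme \<open>c\<close>.\<close>

definition drift_gap :: "nat \<Rightarrow> nat \<Rightarrow> nat \<Rightarrow> 'w \<Rightarrow> real" where
  "drift_gap a c m \<omega> = (\<Sum>j<2^m. (norm (drift a a m j \<omega> - drift a c m j \<omega>))\<^sup>2 / 2 ^ m)"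

definition euler_energy :: "nat \<Rightarrow> nat \<Rightarrow> 'w \<Rightarrow> real" where
  "euler_energy a m \<omega> = (\<Sum>j<2^m. (norm (drift a a m j \<omega>))\<^sup>2 / 2 ^ m)"

lemma girsanov_exponent_euler:
  assumes "c \<le> m"
  shows "girsanov_exponent \<gamma> u c (euler a m \<omega>)
     = (\<Sum>j<2^m. (drift a c m j \<omega> \<bullet> drift a a m j \<omega> - drift a c m j \<omega> \<bullet> drift a c m j \<omega> / 2) / 2 ^ m
         + sqrt \<gamma> * (drift a c m j \<omega> \<bullet> increment m j \<omega>)) / \<gamma>"
  unfolding girsanov_exponent_refine[OF assms] drift_def[symmetric]
  by (intro arg_cong[of _ _ "\<lambda>x. x / \<gamma>"] sum.cong refl)
     (simp add: euler_step inner_right_distrib power2_norm_eq_inner field_simps del: of_nat_Suc)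

text \<open>With \<open>x\<close> the drift of the scheme and \<open>y\<close> the drift read on
  mesh \<open>c\<close>, each step contributes \<open>x \<bullet> y - (norm y)\<^sup>2 / 2\<close>,
  which polarisation turns into half of \<open>(norm x)\<^sup>2 - (norm (x - y))\<^sup>2\<close>.
  The noise terms have mean zero.\<close>

lemma expectation_girsanov_exponent_euler:
  assumes "a \<le> m" "c \<le> m"
  shows "integrable M (\<lambda>\<omega>. girsanov_exponent \<gamma> u c (euler a m \<omega>))"
    and "expectation (\<lambda>\<omega>. girsanov_exponent \<gamma> u c (euler a m \<omega>))
      = (expectation (euler_energy a m) - expectation (drift_gap a c m)) / (2 * \<gamma>)"
proof -
  note int = integrable_drift_inner[OF assms(1)] drift_increment(1)[OF assms]
  show "integrable M (\<lambda>\<omega>. girsanov_exponent \<gamma> u c (euler a m \<omega>))"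
    unfolding girsanov_exponent_euler[OF assms(2)] using assms int
    by (intro integrable_divide Bochner_Integration.integrable_sum Bochner_Integration.integrable_add
          Bochner_Integration.integrable_diff integrable_mult_right) auto
  have norms: "(norm (drift a a m j \<omega> - drift a c m j \<omega>))\<^sup>2
      = drift a a m j \<omega> \<bullet> drift a a m j \<omega> - 2 * (drift a c m j \<omega> \<bullet> drift a a m j \<omega>) + drift a c m j \<omega> \<bullet> drift a c m j \<omega>" for j \<omega>
    by (simp add: power2_norm_eq_inner inner_diff inner_commute)
  have "girsanov_exponent \<gamma> u c (euler a m \<omega>) = (euler_energy a m \<omega> - drift_gap a c m \<omega>) / (2 * \<gamma>)
      + (\<Sum>j<2^m. drift a c m j \<omega> \<bullet> increment m j \<omega>) * (sqrt \<gamma> / \<gamma>)" for \<omega>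
  proof -
    have "(\<Sum>j<2^m. (drift a c m j \<omega> \<bullet> drift a a m j \<omega> - drift a c m j \<omega> \<bullet> drift a c m j \<omega> / 2) / 2 ^ m
         + sqrt \<gamma> * (drift a c m j \<omega> \<bullet> increment m j \<omega>))
       = (\<Sum>j<2^m. ((norm (drift a a m j \<omega>))\<^sup>2 / 2 ^ m - (norm (drift a a m j \<omega> - drift a c m j \<omega>))\<^sup>2 / 2 ^ m) / 2
         + sqrt \<gamma> * (drift a c m j \<omega> \<bullet> increment m j \<omega>))"
      unfolding norms unfolding power2_norm_eq_inner by (intro sum.cong refl) (simp add: field_simps)
    also have "\<dots> = (euler_energy a m \<omega> - drift_gap a c m \<omega>) / 2
         + sqrt \<gamma> * (\<Sum>j<2^m. drift a c m j \<omega> \<bullet> increment m j \<omega>)"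
      unfolding euler_energy_def drift_gap_def
      by (simp only: sum.distrib sum_subtractf sum_divide_distrib[symmetric] sum_distrib_left)
    finally show ?thesis
      unfolding girsanov_exponent_euler[OF assms(2)] by (simp add: add_divide_distrib)
  qed
  moreover have "integrable M (\<lambda>\<omega>. (\<Sum>j<2^m. drift a c m j \<omega> \<bullet> increment m j \<omega>))"
    using int by (intro Bochner_Integration.integrable_sum) auto
  moreover have "expectation (\<lambda>\<omega>. (\<Sum>j<2^m. drift a c m j \<omega> \<bullet> increment m j \<omega>)) = 0"
    using int drift_increment(2)[OF assms] by (subst Bochner_Integration.integral_sum) auto
  moreover have "integrable M (euler_energy a m)"
    unfolding euler_energy_def[abs_def] power2_norm_eq_inner using assms int
    by (intro integrable_divide Bochner_Integration.integrable_sum) auto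
  moreover have "integrable M (drift_gap a c m)"
    unfolding drift_gap_def[abs_def] norms using assms int
    by (intro integrable_divide Bochner_Integration.integrable_sum Bochner_Integration.integrable_add
          Bochner_Integration.integrable_diff integrable_mult_right) auto
  ultimately show "expectation (\<lambda>\<omega>. girsanov_exponent \<gamma> u c (euler a m \<omega>))
      = (expectation (euler_energy a m) - expectation (drift_gap a c m)) / (2 * \<gamma>)"
    by simp
qed

lemma drift_gap_same: "drift_gap a a m = (\<lambda>_. 0)"
  by (simp add: drift_gap_def fun_eq_iff)

lemma drift_gap_nonneg: "0 \<le> drift_gap a c m \<omega>"
  by (simp add: drift_gap_def sum_nonneg)

lemma measurable_drift_gap [measurable]: "drift_gap a c m \<in> borel_measurable M"
  unfolding drift_gap_def[abs_def]
  by (intro borel_measurable_sum borel_measurable_divide borel_measurable_power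
        measurable_compose[OF _ borel_measurable_norm] borel_measurable_diff measurable_drift) auto

lemma measurable_euler_energy [measurable]: "euler_energy a m \<in> borel_measurable M"
  unfolding euler_energy_def[abs_def]
  by (intro borel_measurable_sum borel_measurable_divide borel_measurable_power
        measurable_compose[OF _ borel_measurable_norm] borel_measurable_diff measurable_drift) auto

text \<open>Uniformity in all three indices is reached by contradiction: failure gives a sequence of
  triples, and along it dominated convergence applies, since both readings of the drift converge to
  the drift of the solution.\<close>

lemma drift_gap_small:
  assumes "\<epsilon> > 0"
  shows "\<exists>n. \<forall>a\<ge>n. \<forall>c\<ge>n. \<forall>m. a \<le> m \<longrightarrow> c \<le> m \<longrightarrow> expectation (drift_gap a c m) < \<epsilon>"
proof (rule ccontr)
  assume "\<nexists>n. \<forall>a\<ge>n. \<forall>c\<ge>n. \<forall>m. a \<le> m \<longrightarrow> c \<le> m \<longrightarrow> expectation (drift_gap a c m) < \<epsilon>"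
  then obtain a c m where acm: "\<And>n. n \<le> a n" "\<And>n. n \<le> c n" "\<And>n. a n \<le> m n" "\<And>n. c n \<le> m n"
    and ge: "\<And>n. \<epsilon> \<le> expectation (drift_gap (a n) (c n) (m n))"
    by (metis not_less)
  have "(\<lambda>n. expectation (drift_gap (a n) (c n) (m n))) \<longlonglongrightarrow> expectation (\<lambda>_. 0)"
  proof (rule integral_dominated_convergence)
    show "integrable M (\<lambda>\<omega>. 4 * drift_envelope \<omega>)" using integrable_drift_envelope by simp
    show "AE \<omega> in M. norm (drift_gap (a n) (c n) (m n) \<omega>) \<le> 4 * drift_envelope \<omega>" for n
      using AE_drift_bound
    proof eventually_elim
      case (elim \<omega>)
      have "drift_gap (a n) (c n) (m n) \<omega> \<le> (\<Sum>j<(2::nat)^m n. 4 * drift_envelope \<omega> / 2 ^ m n)"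
        unfolding drift_gap_def
      proof (intro sum_mono divide_right_mono)
        fix j assume "j \<in> {..<(2::nat) ^ m n}"
        then show "(norm (drift (a n) (a n) (m n) j \<omega> - drift (a n) (c n) (m n) j \<omega>))\<^sup>2 \<le> 4 * drift_envelope \<omega>"
          using norm_diff_square_le[of "drift (a n) (a n) (m n) j \<omega>" "drift (a n) (c n) (m n) j \<omega>"]
            elim[rule_format, of "a n" "m n" "a n" j] elim[rule_format, of "a n" "m n" "c n" j] acm by force
      qed simp
      then show ?case using drift_gap_nonneg by simp
    qed
    show "AE \<omega> in M. (\<lambda>n. drift_gap (a n) (c n) (m n) \<omega>) \<longlonglongrightarrow> 0"
      using AE_drift_ode
    proof eventually_elim
      case (elim \<omega>)
      interpret drift_ode u C "noise_path \<omega>" "\<lambda>t. \<Theta> t \<omega>" by (rule elim)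
      show ?case
      proof (rule LIMSEQ_I)
        fix r :: real assume r: "r > 0"
        \<comment> \<open>Both drifts lie within \<eta> of the same vector, so their squared
          distance is at most \<open>4 * \<eta>\<^sup>2 = r / 2\<close>.\<close>
        define \<eta> where "\<eta> = sqrt (r / 8)"
        have \<eta>: "\<eta> > 0" "\<eta>\<^sup>2 = r / 8" using r by (auto simp: \<eta>_def)
        obtain n0 where n0: "\<And>a c m X j s. n0 \<le> a \<Longrightarrow> n0 \<le> c \<Longrightarrow> a \<le> m \<Longrightarrow> c \<le> m \<Longrightarrow>
           euler_path u (noise_path \<omega>) a m X \<Longrightarrow> j < 2 ^ m \<Longrightarrow> real j / 2 ^ m \<le> s \<Longrightarrow>
           s \<le> real (Suc j) / 2 ^ m \<Longrightarrow> norm (frozen_drift u c m X j - u s (\<Theta> s \<omega>)) \<le> \<eta>"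
          using frozen_drift_converges[OF \<eta>(1)] by blast
        show "\<exists>no. \<forall>n\<ge>no. norm (drift_gap (a n) (c n) (m n) \<omega> - 0) < r"
        proof (intro exI allI impI)
          fix n assume n: "n \<ge> n0"
          then have ac: "n0 \<le> a n" "n0 \<le> c n" using acm(1,2)[of n] by auto
          have "drift_gap (a n) (c n) (m n) \<omega> \<le> (\<Sum>j<(2::nat)^m n. (r / 2) / 2 ^ m n)"
            unfolding drift_gap_def
          proof (intro sum_mono divide_right_mono)
            fix j assume "j \<in> {..<(2::nat) ^ m n}"
            then have j: "j < 2 ^ m n" by simp
            let ?s = "real j / 2 ^ m n"
            have s: "?s \<le> ?s" "?s \<le> real (Suc j) / 2 ^ m n" by (auto intro: divide_right_mono)
            have 1: "norm (drift (a n) (a n) (m n) j \<omega> - u ?s (\<Theta> ?s \<omega>)) \<le> \<eta>"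
              unfolding drift_def by (rule n0[OF ac(1) ac(1) acm(3) acm(3) euler_path_euler j s])
            have 2: "norm (drift (a n) (c n) (m n) j \<omega> - u ?s (\<Theta> ?s \<omega>)) \<le> \<eta>"
              unfolding drift_def by (rule n0[OF ac acm(3) acm(4) euler_path_euler j s])
            have "(norm (drift (a n) (a n) (m n) j \<omega> - drift (a n) (c n) (m n) j \<omega>))\<^sup>2
                = (norm ((drift (a n) (a n) (m n) j \<omega> - u ?s (\<Theta> ?s \<omega>)) - (drift (a n) (c n) (m n) j \<omega> - u ?s (\<Theta> ?s \<omega>))))\<^sup>2"
              by simp
            also have "\<dots> \<le> 2 * \<eta>\<^sup>2 + 2 * \<eta>\<^sup>2"
              by (rule order_trans[OF norm_diff_square_le])
                 (intro add_mono mult_left_mono power_mono 1 2, auto)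
            finally show "(norm (drift (a n) (a n) (m n) j \<omega> - drift (a n) (c n) (m n) j \<omega>))\<^sup>2 \<le> r / 2"
              using \<eta>(2) by simp
          qed simp
          also have "\<dots> = r / 2" by simp
          finally show "norm (drift_gap (a n) (c n) (m n) \<omega> - 0) < r" using r drift_gap_nonneg by simp
        qed
      qed
    qed
  qed (auto simp: measurable_drift_gap)
  then have "\<epsilon> \<le> expectation (\<lambda>_. 0)" by (rule LIMSEQ_le_const) (use ge in auto)
  with assms show False by simp
qed

lemma measurable_energy_\<Theta> [measurable]: "(\<lambda>\<omega>. energy (\<lambda>t. \<Theta> t \<omega>)) \<in> borel_measurable M"
  by (rule measurable_energy) (auto intro: continuous_\<Theta> measurable_\<Theta>)

lemma integrable_energy: "integrable M (\<lambda>\<omega>. energy (\<lambda>t. \<Theta> t \<omega>))"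
proof (rule Bochner_Integration.integrable_bound[OF integrable_drift_envelope])
  show "AE \<omega> in M. norm (energy (\<lambda>t. \<Theta> t \<omega>)) \<le> norm (drift_envelope \<omega>)"
    using AE_envelope AE_space
  proof eventually_elim
    case (elim \<omega>)
    have "energy (\<lambda>t. \<Theta> t \<omega>) \<le> drift_envelope \<omega>"
      unfolding drift_envelope_def by (intro energy_le growth_square continuous_\<Theta>) (use elim in auto)
    then show ?case using energy_nonneg drift_envelope_nonneg by simp
  qed
qed measurable

lemma euler_energy_tendsto:
  "(\<lambda>n. expectation (euler_energy n n)) \<longlonglongrightarrow> expectation (\<lambda>\<omega>. energy (\<lambda>t. \<Theta> t \<omega>))"
proof (rule integral_dominated_convergence[OF _ _ integrable_drift_envelope])
  show "AE \<omega> in M. norm (euler_energy n n \<omega>) \<le> drift_envelope \<omega>" for n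
    using AE_drift_bound
  proof eventually_elim
    case (elim \<omega>)
    have "euler_energy n n \<omega> \<le> (\<Sum>j<(2::nat)^n. drift_envelope \<omega> / 2 ^ n)"
      unfolding euler_energy_def by (intro sum_mono divide_right_mono) (use elim in auto)
    moreover have "0 \<le> euler_energy n n \<omega>" by (simp add: euler_energy_def sum_nonneg)
    ultimately show ?case by simp
  qed
  show "AE \<omega> in M. (\<lambda>n. euler_energy n n \<omega>) \<longlonglongrightarrow> energy (\<lambda>t. \<Theta> t \<omega>)"
    using AE_drift_ode
  proof eventually_elim
    case (elim \<omega>)
    interpret drift_ode u C "noise_path \<omega>" "\<lambda>t. \<Theta> t \<omega>" by (rule elim)
    obtain R where R: "R \<ge> 0" "\<And>t. t \<in> {0..1} \<Longrightarrow> norm (\<Theta> t \<omega>) \<le> R"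
      "\<And>a m X t. euler_path u (noise_path \<omega>) a m X \<Longrightarrow> a \<le> m \<Longrightarrow> t \<in> {0..1} \<Longrightarrow> norm (X t) \<le> R"
      using ex_bound by blast
    show ?case
      unfolding energy_def euler_energy_def
    proof (rule riemann_sum_tendsto)
      show "continuous_on {0..1} (\<lambda>t. (norm (u t (\<Theta> t \<omega>)))\<^sup>2)"
        by (intro continuous_intros continuous_on_u_path \<theta> order_refl)
      fix \<epsilon> :: real assume \<epsilon>: "\<epsilon> > 0"
      \<comment> \<open>A bound for the sum of the two norms in the difference of squares; the 1
        makes it positive.\<close>
      define K where "K = 2 * (C * (1 + R)) + 1"
      have K: "K > 0" using C_nonneg R(1) by (simp add: K_def add_nonneg_pos)
      then have "\<epsilon> / K > 0" using \<epsilon> by simp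
      then obtain n0 where n0: "\<And>a c m X j s. n0 \<le> a \<Longrightarrow> n0 \<le> c \<Longrightarrow> a \<le> m \<Longrightarrow> c \<le> m \<Longrightarrow>
           euler_path u (noise_path \<omega>) a m X \<Longrightarrow> j < 2 ^ m \<Longrightarrow> real j / 2 ^ m \<le> s \<Longrightarrow>
           s \<le> real (Suc j) / 2 ^ m \<Longrightarrow> norm (frozen_drift u c m X j - u s (\<Theta> s \<omega>)) \<le> \<epsilon> / K"
        using frozen_drift_converges by blast
      show "\<exists>N. \<forall>n\<ge>N. \<forall>j<2 ^ n. \<forall>s. real j / 2 ^ n \<le> s \<longrightarrow> s \<le> real (Suc j) / 2 ^ n \<longrightarrow>
          \<bar>(norm (drift n n n j \<omega>))\<^sup>2 - (norm (u s (\<Theta> s \<omega>)))\<^sup>2\<bar> \<le> \<epsilon>"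
      proof (intro exI allI impI)
        fix n j s assume n: "n \<ge> n0" and j: "j < 2 ^ n" and s: "real j / 2 ^ n \<le> s" "s \<le> real (Suc j) / 2 ^ n"
        have t: "real j / 2 ^ n \<in> {0..1}" "real (Suc j) / 2 ^ n \<in> {0..1}"
          using j by (auto intro!: grid_mem simp del: atLeastAtMost_iff of_nat_Suc)
        have s1: "s \<in> {0..1}" using t s unfolding atLeastAtMost_iff by linarith
        have b: "norm (drift n n n j \<omega>) \<le> C * (1 + R)" "norm (u s (\<Theta> s \<omega>)) \<le> C * (1 + R)"
          unfolding drift_def frozen_drift_same
          by (intro growth_ball t R(2) R(3)[OF euler_path_euler] s1 order_refl)+
        have "\<bar>(norm (drift n n n j \<omega>))\<^sup>2 - (norm (u s (\<Theta> s \<omega>)))\<^sup>2\<bar>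
            \<le> norm (drift n n n j \<omega> - u s (\<Theta> s \<omega>)) * (norm (drift n n n j \<omega>) + norm (u s (\<Theta> s \<omega>)))"
          by (rule abs_diff_norm_squares_le)
        also have "\<dots> \<le> \<epsilon> / K * K"
        proof (rule mult_mono)
          show "norm (drift n n n j \<omega> - u s (\<Theta> s \<omega>)) \<le> \<epsilon> / K"
            unfolding drift_def by (rule n0[OF n n order_refl order_refl euler_path_euler j s])
        qed (use b \<epsilon> K in \<open>auto simp: K_def\<close>)
        finally show "\<bar>(norm (drift n n n j \<omega>))\<^sup>2 - (norm (u s (\<Theta> s \<omega>)))\<^sup>2\<bar> \<le> \<epsilon>" using K by simp
      qed
    qed
  qed
qed measurable

lemma AE_euler_tendsto: "AE \<omega> in M. \<forall>t\<in>{0..1}. (\<lambda>m. euler m m \<omega> t) \<longlonglongrightarrow> \<Theta> t \<omega>"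
  using AE_drift_ode
proof eventually_elim
  case (elim \<omega>)
  interpret drift_ode u C "noise_path \<omega>" "\<lambda>t. \<Theta> t \<omega>" by (rule elim)
  show ?case
  proof (rule ballI, rule LIMSEQ_I)
    fix t r :: real assume t: "t \<in> {0..1}" and "r > 0"
    then obtain n where n: "\<And>a m X t. n \<le> a \<Longrightarrow> a \<le> m \<Longrightarrow> euler_path u (noise_path \<omega>) a m X \<Longrightarrow> t \<in> {0..1}
        \<Longrightarrow> norm (X t - \<Theta> t \<omega>) \<le> r / 2"
      using euler_path_converges[of "r / 2"] half_gt_zero by blast
    show "\<exists>no. \<forall>m\<ge>no. norm (euler m m \<omega> t - \<Theta> t \<omega>) < r"
    proof (intro exI allI impI)
      fix m assume "m \<ge> n"
      then have "norm (euler m m \<omega> t - \<Theta> t \<omega>) \<le> r / 2" by (rule n[OF _ order_refl euler_path_euler t])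
      then show "norm (euler m m \<omega> t - \<Theta> t \<omega>) < r" using \<open>r > 0\<close> by linarith
    qed
  qed
qed

text \<open>The level \<open>n\<close> of the exponent is frozen while the scheme is refined. The
  exponent is then a fixed continuous function of finitely many path values, and the envelope
  dominates it.\<close>

lemma girsanov_exponent_\<Theta>:
  shows "integrable M (\<lambda>\<omega>. girsanov_exponent \<gamma> u n (\<lambda>t. \<Theta> t \<omega>))"
    and "(\<lambda>m. expectation (\<lambda>\<omega>. girsanov_exponent \<gamma> u n (euler m m \<omega>)))
       \<longlonglongrightarrow> expectation (\<lambda>\<omega>. girsanov_exponent \<gamma> u n (\<lambda>t. \<Theta> t \<omega>))"
proof -
  have 1: "(\<lambda>\<omega>. girsanov_exponent \<gamma> u n (\<lambda>t. \<Theta> t \<omega>)) \<in> borel_measurable M"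
    by (rule measurable_girsanov_exponent) (rule measurable_\<Theta>)
  have 2: "(\<lambda>\<omega>. girsanov_exponent \<gamma> u n (euler m m \<omega>)) \<in> borel_measurable M" for m
    by (rule measurable_girsanov_exponent) (rule measurable_euler)
  have 3: "integrable M (\<lambda>\<omega>. 2 ^ n * (4 * C\<^sup>2 * (1 + envelope \<omega>) + 4 * envelope \<omega>) / \<gamma>)"
    using integrable_envelope by simp
  have 4: "AE \<omega> in M. (\<lambda>m. girsanov_exponent \<gamma> u n (euler m m \<omega>)) \<longlonglongrightarrow> girsanov_exponent \<gamma> u n (\<lambda>t. \<Theta> t \<omega>)"
    using AE_euler_tendsto
  proof eventually_elim
    case (elim \<omega>)
    note lim = elim[rule_format]
    have limu: "(\<lambda>m. u t (euler m m \<omega> t)) \<longlonglongrightarrow> u t (\<Theta> t \<omega>)" if t: "t \<in> {0..1}" for t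
    proof -
      have "continuous_on UNIV (\<lambda>x. case_prod u (t, x))"
        by (rule continuous_on_compose2[OF continuous_on_u]) (use t in \<open>auto intro!: continuous_intros\<close>)
      then have "continuous_on UNIV (u t)" by simp
      from continuous_on_tendsto_compose[OF this lim[OF t]] show ?thesis by simp
    qed
    show ?case
      unfolding girsanov_exponent_def
    proof (intro tendsto_divide tendsto_sum tendsto_diff tendsto_inner tendsto_power tendsto_norm tendsto_const)
      fix k assume "k \<in> {..<(2::nat) ^ n}"
      then have k: "real k / 2 ^ n \<in> {0..1}" "real (Suc k) / 2 ^ n \<in> {0..1}"
        by (auto intro!: grid_mem simp del: atLeastAtMost_iff of_nat_Suc)
      show "(\<lambda>m. u (real k / 2 ^ n) (euler m m \<omega> (real k / 2 ^ n))) \<longlonglongrightarrow> u (real k / 2 ^ n) (\<Theta> (real k / 2 ^ n) \<omega>)"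
        "(\<lambda>m. u (real k / 2 ^ n) (euler m m \<omega> (real k / 2 ^ n))) \<longlonglongrightarrow> u (real k / 2 ^ n) (\<Theta> (real k / 2 ^ n) \<omega>)"
        "(\<lambda>m. euler m m \<omega> (real (Suc k) / 2 ^ n)) \<longlonglongrightarrow> \<Theta> (real (Suc k) / 2 ^ n) \<omega>"
        "(\<lambda>m. euler m m \<omega> (real k / 2 ^ n)) \<longlonglongrightarrow> \<Theta> (real k / 2 ^ n) \<omega>"
        by (intro limu lim k)+
    qed (use \<gamma>_pos in auto)
  qed
  have 5: "AE \<omega> in M. norm (girsanov_exponent \<gamma> u n (euler m m \<omega>))
      \<le> 2 ^ n * (4 * C\<^sup>2 * (1 + envelope \<omega>) + 4 * envelope \<omega>) / \<gamma>" for m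
    using AE_envelope
  proof eventually_elim
    case (elim \<omega>)
    then show ?case unfolding real_norm_def by (intro girsanov_exponent_bound \<gamma>_pos) auto
  qed
  show "integrable M (\<lambda>\<omega>. girsanov_exponent \<gamma> u n (\<lambda>t. \<Theta> t \<omega>))"
    by (rule integrable_dominated_convergence[OF 1 2 3 4 5])
  show "(\<lambda>m. expectation (\<lambda>\<omega>. girsanov_exponent \<gamma> u n (euler m m \<omega>)))
       \<longlonglongrightarrow> expectation (\<lambda>\<omega>. girsanov_exponent \<gamma> u n (\<lambda>t. \<Theta> t \<omega>))"
    by (rule integral_dominated_convergence[OF 1 2 3 4 5])
qed

definition control_cost :: real where
  "control_cost = expectation (\<lambda>\<omega>. energy (\<lambda>t. \<Theta> t \<omega>)) / (2 * \<gamma>)"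

lemma expectation_girsanov_exponent_tendsto:
  "(\<lambda>n. expectation (\<lambda>\<omega>. girsanov_exponent \<gamma> u n (euler n n \<omega>))) \<longlonglongrightarrow> control_cost"
  unfolding expectation_girsanov_exponent_euler(2)[OF order_refl order_refl] control_cost_def drift_gap_same
  using tendsto_divide[OF euler_energy_tendsto tendsto_const, of "2 * \<gamma>"] \<gamma>_pos by simp

text \<open>Under scheme \<open>m\<close> the mean exponents of levels \<open>m\<close> and
  \<open>n\<close> differ by the mean drift gap over \<open>2 * \<gamma>\<close>, which is small for
  all \<open>m \<ge> n\<close>. Letting \<open>m\<close> grow with \<open>n\<close> fixed replaces
  the scheme by the solution.\<close>

lemma expectation_girsanov_exponent_\<Theta>_ge:
  assumes "\<epsilon> > 0"
  shows "\<exists>n. control_cost - \<epsilon> \<le> expectation (\<lambda>\<omega>. girsanov_exponent \<gamma> u n (\<lambda>t. \<Theta> t \<omega>))"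
proof -
  obtain n where n: "\<And>m. m \<ge> n \<Longrightarrow> expectation (drift_gap m n m) < \<epsilon> * (2 * \<gamma>)"
    using drift_gap_small[of "\<epsilon> * (2 * \<gamma>)"] assms \<gamma>_pos by (auto simp: zero_less_mult_iff)
  have "control_cost - \<epsilon> \<le> expectation (\<lambda>\<omega>. girsanov_exponent \<gamma> u n (\<lambda>t. \<Theta> t \<omega>))"
  proof (rule LIMSEQ_le)
    show "(\<lambda>m. expectation (\<lambda>\<omega>. girsanov_exponent \<gamma> u m (euler m m \<omega>)) - \<epsilon>) \<longlonglongrightarrow> control_cost - \<epsilon>"
      by (intro tendsto_intros expectation_girsanov_exponent_tendsto)
    show "(\<lambda>m. expectation (\<lambda>\<omega>. girsanov_exponent \<gamma> u n (euler m m \<omega>)))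
       \<longlonglongrightarrow> expectation (\<lambda>\<omega>. girsanov_exponent \<gamma> u n (\<lambda>t. \<Theta> t \<omega>))"
      by (rule girsanov_exponent_\<Theta>)
    show "\<exists>N. \<forall>m\<ge>N. expectation (\<lambda>\<omega>. girsanov_exponent \<gamma> u m (euler m m \<omega>)) - \<epsilon>
        \<le> expectation (\<lambda>\<omega>. girsanov_exponent \<gamma> u n (euler m m \<omega>))"
    proof (intro exI allI impI)
      fix m assume m: "m \<ge> n"
      show "expectation (\<lambda>\<omega>. girsanov_exponent \<gamma> u m (euler m m \<omega>)) - \<epsilon>
        \<le> expectation (\<lambda>\<omega>. girsanov_exponent \<gamma> u n (euler m m \<omega>))"
      proof -
        have "expectation (drift_gap m n m) / (2 * \<gamma>) \<le> \<epsilon>" using n[OF m] \<gamma>_pos by (simp add: field_simps)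
        then show ?thesis
          by (simp add: expectation_girsanov_exponent_euler(2)[OF order_refl order_refl]
                expectation_girsanov_exponent_euler(2)[OF order_refl m] drift_gap_same diff_divide_distrib)
      qed
    qed
  qed
  then show ?thesis by blast
qed

end

section \<open>Measures on path space\<close>

lemma measurable_path:
  assumes "\<And>t. t \<in> {0..1} \<Longrightarrow> X t \<in> borel_measurable M"
    and "\<And>\<omega>. \<omega> \<in> space M \<Longrightarrow> continuous_on {0..1} (\<lambda>t. X t \<omega>)"
  shows "(\<lambda>\<omega>. \<lambda>t\<in>{0..1}. X t \<omega>) \<in> M \<rightarrow>\<^sub>M path_space"
  unfolding path_space_def
proof (rule measurable_restrict_space2)
  show "(\<lambda>\<omega>. \<lambda>t\<in>{0..1}. X t \<omega>) \<in> M \<rightarrow>\<^sub>M PiM {0..1} (\<lambda>_. borel)"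
    by (rule measurable_restrict) (rule assms)
  have "continuous_on {0..1} (\<lambda>t\<in>{0..1}. X t \<omega>)" if "\<omega> \<in> space M" for \<omega>
    using assms(2)[OF that] by (subst continuous_on_cong[OF refl, of _ _ "\<lambda>t. X t \<omega>"]) auto
  then show "(\<lambda>\<omega>. \<lambda>t\<in>{0..1}. X t \<omega>) \<in> space M \<rightarrow> {w. continuous_on {0..1} w}"
    by auto
qed

lemma measurable_path_eval [measurable]:
  "t \<in> {0..1} \<Longrightarrow> (\<lambda>w. w t) \<in> borel_measurable path_space"
  unfolding path_space_def by (intro measurable_restrict_space1 measurable_component_singleton)

lemma continuous_path: "w \<in> space path_space \<Longrightarrow> continuous_on {0..1} w"
  by (simp add: path_space_def space_restrict_space)

lemma sets_path_law [simp, measurable_cong]: "sets (path_law M X) = sets path_space"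
  by (simp add: path_law_def)

lemma space_path_law [simp]: "space (path_law M X) = space path_space"
  by (simp add: path_law_def)

text \<open>The empty set is treated apart because \<open>infdist x {} = 0\<close> by convention,
  which would make the approximation 1 instead of 0.\<close>

lemma closed_box_indicator_tendsto:
  fixes C :: "real \<Rightarrow> 'a::metric_space set"
  assumes "finite J" "\<And>t. t \<in> J \<Longrightarrow> closed (C t)"
  shows "(\<lambda>k. \<Prod>t\<in>J. if C t = {} then 0 else max 0 (1 - real k * infdist (w t) (C t)))
     \<longlonglongrightarrow> (\<Prod>t\<in>J. indicator (C t) (w t))"
proof (rule tendsto_prod)
  fix t assume t: "t \<in> J"
  show "(\<lambda>k. if C t = {} then 0 else max 0 (1 - real k * infdist (w t) (C t))) \<longlonglongrightarrow> indicator (C t) (w t)"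
  proof (cases "w t \<in> C t")
    case True
    then have "C t \<noteq> {}" "infdist (w t) (C t) = 0" by auto
    then show ?thesis using True by simp
  next
    case False
    show ?thesis
    proof (cases "C t = {}")
      case ne: False
      then have d: "infdist (w t) (C t) > 0"
        using False assms(2)[OF t] by (simp add: infdist_pos_not_in_closed)
      obtain K where K: "1 < real K * infdist (w t) (C t)" using reals_Archimedean3[OF d] by blast
      have "\<forall>\<^sub>F k in sequentially. max 0 (1 - real k * infdist (w t) (C t)) = 0"
      proof (rule eventually_sequentiallyI[of K])
        fix k assume "K \<le> k"
        then have "real K * infdist (w t) (C t) \<le> real k * infdist (w t) (C t)"
          using d by (intro mult_right_mono) auto
        then show "max 0 (1 - real k * infdist (w t) (C t)) = 0" using K by simp
      qed
      then show ?thesis using ne False by (auto intro: tendsto_eventually)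
    qed (use False in auto)
  qed
qed

text \<open>Passing to the limit gives access to means of products of continuous functions of
  finitely many coordinates. These approximate indicators of boxes with closed sides, which are
  stable under intersection and generate the product sigma-algebra.\<close>

lemma path_measure_eqI:
  fixes Q Q' :: "(real \<Rightarrow> 'a::euclidean_space) measure"
  assumes sets: "sets Q = sets path_space" "sets Q' = sets path_space"
    and "finite_measure Q" "finite_measure Q'"
    and eq: "\<And>J h. finite J \<Longrightarrow> J \<subseteq> {0..1} \<Longrightarrow> (\<And>t. continuous_on UNIV (h t)) \<Longrightarrow>
      (\<And>t x. 0 \<le> h t x \<and> h t x \<le> 1) \<Longrightarrow> (\<integral>w. (\<Prod>t\<in>J. h t (w t)) \<partial>Q) = (\<integral>w. (\<Prod>t\<in>J. h t (w t) :: real) \<partial>Q')"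
  shows "Q = Q'"
proof -
  interpret Q: finite_measure Q by fact
  interpret Q': finite_measure Q' by fact
  let ?I = "{0..1::real}"
  let ?\<Omega> = "\<Pi>\<^sub>E i\<in>?I. (UNIV :: 'a set)"
  let ?E = "{{f \<in> ?\<Omega>. \<forall>i\<in>j. f i \<in> A i} |A j. j \<in> {j. finite j \<and> j \<subseteq> ?I} \<and> A \<in> Pi j (\<lambda>_. {S. closed S})}"
  have space: "space Q = space path_space" "space Q' = space path_space"
    using sets by (auto dest: sets_eq_imp_space_eq)
  have id: "(\<lambda>w. w) \<in> path_space \<rightarrow>\<^sub>M PiM ?I (\<lambda>_. borel :: 'a measure)"
    unfolding path_space_def by (rule measurable_restrict_space1) simp
  note [measurable_cong] = sets
  have idQ: "(\<lambda>w. w) \<in> Q \<rightarrow>\<^sub>M PiM ?I (\<lambda>_. borel)" "(\<lambda>w. w) \<in> Q' \<rightarrow>\<^sub>M PiM ?I (\<lambda>_. borel)"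
    using id sets by (simp_all cong: measurable_cong_sets)
  have borel: "(borel :: 'a measure) = sigma UNIV {S. closed S}"
    by (rule borel_eq_closed)
  have gen: "sets (PiM ?I (\<lambda>_. borel :: 'a measure)) = sigma_sets ?\<Omega> ?E"
  proof -
    have "sets (PiM ?I (\<lambda>_. borel :: 'a measure)) = sets (PiM ?I (\<lambda>_. sigma UNIV {S :: 'a set. closed S}))"
      by (simp add: borel)
    also have "\<dots> = sets (sigma ?\<Omega> ?E)"
    proof (rule sets_PiM_sigma)
      show "\<exists>S\<subseteq>{S. closed S}. countable S \<and> (UNIV :: 'a set) = \<Union> S"
        by (intro exI[of _ "{UNIV}"]) auto
      show "\<Union> {j. finite j \<and> j \<subseteq> ?I} = ?I" by auto
    qed auto
    also have "\<dots> = sigma_sets ?\<Omega> ?E" by (rule sets_measure_of) auto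
    finally show ?thesis .
  qed
  have box: "emeasure Q {w \<in> space path_space. \<forall>i\<in>j. w i \<in> A i} = emeasure Q' {w \<in> space path_space. \<forall>i\<in>j. w i \<in> A i}"
    if j: "finite j" "j \<subseteq> ?I" and A: "\<And>i. i \<in> j \<Longrightarrow> closed (A i)" for j and A :: "real \<Rightarrow> 'a set"
  proof -
    define h where "h k t x = (if A t = {} then 0 else max 0 (1 - real k * infdist x (A t)))" for k t x
    have h: "continuous_on UNIV (h k t)" "0 \<le> h k t x \<and> h k t x \<le> 1" for k t x
    proof -
      show "continuous_on UNIV (h k t)"
        unfolding h_def by (cases "A t = {}") (auto intro!: continuous_intros)
      show "0 \<le> h k t x \<and> h k t x \<le> 1" by (auto simp: h_def infdist_nonneg)
    qed
    have hm: "h k t \<in> borel_measurable borel" for k t using h(1) by (rule borel_measurable_continuous_onI)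
    have A': "A t \<in> sets borel" if "t \<in> j" for t using A[OF that] by simp
    have meas: "(\<lambda>w. \<Prod>t\<in>j. h k t (w t)) \<in> borel_measurable path_space"
      "(\<lambda>w. \<Prod>t\<in>j. indicator (A t) (w t) :: real) \<in> borel_measurable path_space" for k
      using j A'
      by (auto intro!: borel_measurable_prod measurable_compose[OF measurable_path_eval hm]
            measurable_compose[OF measurable_path_eval borel_measurable_indicator])
    have bound: "norm (\<Prod>t\<in>j. h k t (w t)) \<le> 1" for k w
      using h(2) by (auto simp: abs_prod intro!: prod_le_1)
    have lim: "(\<lambda>k. \<integral>w. (\<Prod>t\<in>j. h k t (w t)) \<partial>R) \<longlonglongrightarrow> measure R {w \<in> space path_space. \<forall>i\<in>j. w i \<in> A i}"
      if R: "sets R = sets path_space" "finite_measure R" for R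
    proof -
      interpret R: finite_measure R by (rule R)
      have sp: "space R = space path_space" using R(1) by (rule sets_eq_imp_space_eq)
      have "{w \<in> space R. \<forall>i\<in>j. w i \<in> A i} \<in> sets R"
        unfolding sp R(1) using j A' by (intro sets.sets_Collect_finite_All measurable_sets_Collect[OF measurable_path_eval]) auto
      then have "measure R {w \<in> space path_space. \<forall>i\<in>j. w i \<in> A i} = (\<integral>w. indicator {w \<in> space R. \<forall>i\<in>j. w i \<in> A i} w \<partial>R)"
        by (simp add: sp) (rule arg_cong[of _ _ "measure R"], auto)
      also have "\<dots> = (\<integral>w. (\<Prod>t\<in>j. indicator (A t) (w t)) \<partial>R)"
        using j(1) by (intro Bochner_Integration.integral_cong refl)
          (auto simp: indicator_def prod.If_cases intro!: prod_zero split: if_splits)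
      finally have eq: "measure R {w \<in> space path_space. \<forall>i\<in>j. w i \<in> A i} = (\<integral>w. (\<Prod>t\<in>j. indicator (A t) (w t)) \<partial>R)" .
      have "(\<lambda>k. \<integral>w. (\<Prod>t\<in>j. h k t (w t)) \<partial>R) \<longlonglongrightarrow> (\<integral>w. (\<Prod>t\<in>j. indicator (A t) (w t)) \<partial>R)"
      proof (rule integral_dominated_convergence)
        show "(\<lambda>w. \<Prod>t\<in>j. indicator (A t) (w t) :: real) \<in> borel_measurable R"
          "(\<lambda>w. \<Prod>t\<in>j. h k t (w t)) \<in> borel_measurable R" for k
          using meas R(1) by (simp_all cong: measurable_cong_sets)
        show "AE w in R. (\<lambda>k. \<Prod>t\<in>j. h k t (w t)) \<longlonglongrightarrow> (\<Prod>t\<in>j. indicator (A t) (w t))"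
          unfolding h_def using closed_box_indicator_tendsto[OF j(1) A] by simp
        show "integrable R (\<lambda>_. 1::real)" by simp
        show "AE w in R. norm (\<Prod>t\<in>j. h k t (w t)) \<le> 1" for k using bound by simp
      qed
      then show ?thesis by (simp add: eq)
    qed
    have "(\<lambda>k. \<integral>w. (\<Prod>t\<in>j. h k t (w t)) \<partial>Q) = (\<lambda>k. \<integral>w. (\<Prod>t\<in>j. h k t (w t)) \<partial>Q')"
      using eq[OF j h] by simp
    then have "measure Q {w \<in> space path_space. \<forall>i\<in>j. w i \<in> A i} = measure Q' {w \<in> space path_space. \<forall>i\<in>j. w i \<in> A i}"
      using lim[OF sets(1) Q.finite_measure_axioms] lim[OF sets(2) Q'.finite_measure_axioms]
      by (auto intro: LIMSEQ_unique)
    then show ?thesis by (simp add: Q.emeasure_eq_measure Q'.emeasure_eq_measure)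
  qed
  \<comment> \<open>The uniqueness argument runs on the full product space, where boxes generate. It
    carries over because each measurable set of paths is the trace of a product-measurable
    set.\<close>
  have "distr Q (PiM ?I (\<lambda>_. borel)) (\<lambda>w. w) = distr Q' (PiM ?I (\<lambda>_. borel)) (\<lambda>w. w)"
  proof (rule measure_eqI_generator_eq[where \<Omega> = ?\<Omega> and E = ?E and A = "\<lambda>_. ?\<Omega>"])
    show "Int_stable ?E"
    proof (rule Int_stableI)
      fix a b assume "a \<in> ?E" "b \<in> ?E"
      then obtain A j A' j' where a: "a = {f \<in> ?\<Omega>. \<forall>i\<in>j. f i \<in> A i}" "finite j" "j \<subseteq> ?I" "\<forall>i\<in>j. closed (A i)"
        and b: "b = {f \<in> ?\<Omega>. \<forall>i\<in>j'. f i \<in> A' i}" "finite j'" "j' \<subseteq> ?I" "\<forall>i\<in>j'. closed (A' i)"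
        by (auto simp: Pi_iff)
      define A'' where "A'' i = (if i \<in> j then A i else UNIV) \<inter> (if i \<in> j' then A' i else UNIV)" for i
      have "a \<inter> b = {f \<in> ?\<Omega>. \<forall>i\<in>j \<union> j'. f i \<in> A'' i}"
        unfolding a b A''_def by auto
      moreover have "\<forall>i\<in>j \<union> j'. closed (A'' i)" using a b by (auto simp: A''_def)
      ultimately show "a \<inter> b \<in> ?E"
        using a(2,3) b(2,3) by (intro CollectI exI[of _ A''] exI[of _ "j \<union> j'"]) auto
    qed
    show "?E \<subseteq> Pow ?\<Omega>" by auto
    fix X assume "X \<in> ?E"
    then obtain A j where X: "X = {f \<in> ?\<Omega>. \<forall>i\<in>j. f i \<in> A i}" and j: "finite j" "j \<subseteq> ?I" "\<And>i. i \<in> j \<Longrightarrow> closed (A i)"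
      by (auto simp: Pi_iff)
    have XE: "X \<in> sets (PiM ?I (\<lambda>_. borel))" unfolding gen using \<open>X \<in> ?E\<close> by (rule sigma_sets.Basic)
    have "X \<inter> space path_space = {w \<in> space path_space. \<forall>i\<in>j. w i \<in> A i}"
      unfolding X by (auto simp: path_space_def space_restrict_space space_PiM)
    then show "emeasure (distr Q (PiM ?I (\<lambda>_. borel)) (\<lambda>w. w)) X = emeasure (distr Q' (PiM ?I (\<lambda>_. borel)) (\<lambda>w. w)) X"
      using box[OF j] XE idQ by (simp add: emeasure_distr space)
  next
    show "range (\<lambda>_::nat. ?\<Omega>) \<subseteq> ?E"
      by (auto intro!: exI[of _ "\<lambda>_. UNIV"] exI[of _ "{}"])
  next
    fix i :: nat
    show "emeasure (distr Q (PiM ?I (\<lambda>_. borel)) (\<lambda>w. w)) ?\<Omega> \<noteq> \<infinity>"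
      using finite_measure.emeasure_finite[OF Q.finite_measure_distr[OF idQ(1)]] by simp
  qed (simp_all add: gen)
  then have R: "emeasure (distr Q (PiM ?I (\<lambda>_. borel)) (\<lambda>w. w)) X = emeasure (distr Q' (PiM ?I (\<lambda>_. borel)) (\<lambda>w. w)) X" for X
    by simp
  show ?thesis
  proof (rule measure_eqI)
    show "sets Q = sets Q'" using sets by simp
    fix X assume "X \<in> sets Q"
    then obtain Y where Y: "Y \<in> sets (PiM ?I (\<lambda>_. borel :: 'a measure))" "X = Y \<inter> space path_space"
      unfolding sets by (auto simp: path_space_def sets_restrict_space space_restrict_space)
        (metis (no_types, lifting) Int_assoc inf_commute sets.Int_space_eq2)
    then show "emeasure Q X = emeasure Q' X"
      using R[of Y] idQ by (simp add: emeasure_distr space)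
  qed
qed

section \<open>Elementary estimates for exponentials and entropies\<close>

lemma integrable_nonneg_of_nn_integral:
  fixes f :: "'b \<Rightarrow> real"
  assumes "f \<in> borel_measurable N" "\<And>x. 0 \<le> f x" "(\<integral>\<^sup>+x. ennreal (f x) \<partial>N) = ennreal r" "0 \<le> r"
  shows "integrable N f" "(\<integral>x. f x \<partial>N) = r"
  using nn_integral_eq_integrable[of f N r] assms by auto

text \<open>With \<open>x = exp (a / 2)\<close> and \<open>y = exp (c / 2)\<close> the left side is
  \<open>\<bar>x - y\<bar> * (x + y)\<close>, split by AM-GM with free weight \<open>s\<close>. For
  two densities the first numerator is the Hellinger square and integrates to twice one minus the
  affinity; the last term integrates to \<open>2 * s\<close>.\<close>

lemma abs_exp_diff_le:
  fixes a c :: real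
  assumes "s > 0"
  shows "\<bar>exp a - exp c\<bar> \<le> (exp a + exp c - 2 * exp ((a + c) / 2)) / (2 * s) + s * (exp a + exp c)"
proof -
  define x y where "x = exp (a / 2)" and "y = exp (c / 2)"
  have e: "exp a = x\<^sup>2" "exp c = y\<^sup>2" "exp ((a + c) / 2) = x * y"
    by (simp_all add: x_def y_def exp_double[symmetric] exp_add[symmetric] add_divide_distrib)
  have "0 \<le> (\<bar>x - y\<bar> / sqrt (2 * s) - sqrt (s / 2) * (x + y))\<^sup>2" by simp
  also have "\<dots> = (x - y)\<^sup>2 / (2 * s) + s / 2 * (x + y)\<^sup>2 - \<bar>x - y\<bar> * (x + y)"
  proof -
    have "sqrt (s / 2) / sqrt (2 * s) = 1 / 2"
      using assms by (simp add: real_sqrt_divide real_sqrt_mult)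
    then have "2 * (\<bar>x - y\<bar> / sqrt (2 * s)) * (sqrt (s / 2) * (x + y)) = \<bar>x - y\<bar> * (x + y)"
      by (simp add: field_simps)
    then show ?thesis using assms by (simp add: power2_diff power_divide power_mult_distrib)
  qed
  finally have 1: "\<bar>x - y\<bar> * (x + y) \<le> (x - y)\<^sup>2 / (2 * s) + s / 2 * (x + y)\<^sup>2" by simp
  have 2: "(x + y)\<^sup>2 \<le> 2 * (x\<^sup>2 + y\<^sup>2)" using sum_squares_bound[of x y] by (simp add: power2_sum)
  have "\<bar>exp a - exp c\<bar> = \<bar>x - y\<bar> * (x + y)"
    unfolding e by (simp add: power2_eq_square square_diff_square_factored abs_mult x_def y_def)
  also have "\<dots> \<le> (x - y)\<^sup>2 / (2 * s) + s / 2 * (2 * (x\<^sup>2 + y\<^sup>2))"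
    using 1 mult_left_mono[OF 2, of "s / 2"] assms by linarith
  also have "\<dots> = (x\<^sup>2 + y\<^sup>2 - 2 * (x * y)) / (2 * s) + s * (x\<^sup>2 + y\<^sup>2)"
    by (simp add: power2_diff mult.assoc)
  finally show ?thesis unfolding e .
qed

text \<open>The limit density may vanish. There \<open>l * ln l\<close> is 0, the right continuous
  extension, and the bound \<open>- 2 * sqrt x \<le> x * ln x\<close> gives the limit from
  below.\<close>

lemma tendsto_x_ln_x:
  fixes x :: "nat \<Rightarrow> real"
  assumes "x \<longlonglongrightarrow> l" "\<And>n. x n > 0"
  shows "(\<lambda>n. x n * ln (x n)) \<longlonglongrightarrow> l * ln l"
proof (cases "l = 0")
  case False
  then have "l > 0" using LIMSEQ_le_const[OF assms(1), of 0] assms(2) by (force intro: less_imp_le)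
  then show ?thesis using assms by (intro tendsto_mult tendsto_ln) auto
next
  case True
  have "(\<lambda>n. x n * ln (x n)) \<longlonglongrightarrow> 0"
  proof (rule tendsto_sandwich)
    show "\<forall>\<^sub>F n in sequentially. - 2 * sqrt (x n) \<le> x n * ln (x n)"
    proof (rule always_eventually, rule allI)
      fix n
      define y where "y = sqrt (x n)"
      have y: "y > 0" "x n = y\<^sup>2" using assms(2)[of n] by (auto simp: y_def)
      have "ln (1 / y) \<le> 1 / y - 1" using y by (intro ln_le_minus_one) auto
      then have "- ln y \<le> 1 / y" using y by (simp add: ln_div)
      then have "2 * y\<^sup>2 * (- ln y) \<le> 2 * y\<^sup>2 * (1 / y)" by (intro mult_left_mono) auto
      also have "\<dots> = 2 * y" using y by (simp add: power2_eq_square)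
      finally have "2 * y\<^sup>2 * (- ln y) \<le> 2 * y" .
      moreover have "ln (x n) = 2 * ln y" unfolding y(2) using ln_realpow[of y 2] by simp
      ultimately show "- 2 * sqrt (x n) \<le> x n * ln (x n)"
        unfolding y_def[symmetric] by (simp only: y(2))
    qed
    show "\<forall>\<^sub>F n in sequentially. x n * ln (x n) \<le> x n * (x n - 1)"
      using assms(2) by (intro always_eventually allI mult_left_mono ln_le_minus_one less_imp_le)
    show "(\<lambda>n. - 2 * sqrt (x n)) \<longlonglongrightarrow> 0"
      using tendsto_mult[OF tendsto_const[of "- 2"] tendsto_real_sqrt[OF assms(1)]] True by simp
    show "(\<lambda>n. x n * (x n - 1)) \<longlonglongrightarrow> 0"
      using tendsto_mult[OF assms(1) tendsto_diff[OF assms(1) tendsto_const[of 1]]] True by simp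
  qed
  then show ?thesis using True by simp
qed

text \<open>Makes the entropy integrand, shifted by a constant, nonnegative, so that Fatou's lemma
  applies to it.\<close>

lemma x_ln_x_plus_one_nonneg: "0 \<le> x * ln x + 1" if "0 \<le> x" for x :: real
proof (cases "x = 0")
  case False
  with that have x: "x > 0" by simp
  then have "ln (1 / x) \<le> 1 / x - 1" by (intro ln_le_minus_one) auto
  then have "x * (- ln x) \<le> x * (1 / x - 1)" using x by (intro mult_left_mono) (auto simp: ln_div)
  then show ?thesis using x by (simp add: algebra_simps)
qed simp

section \<open>The density of the law of the solution as an L1 limit\<close>

context controlled_diffusion
begin

abbreviation "P \<equiv> path_law M Z"
abbreviation "Q \<equiv> path_law M \<Theta>"

definition path_of :: "(real \<Rightarrow> 'w \<Rightarrow> 'a) \<Rightarrow> 'w \<Rightarrow> real \<Rightarrow> 'a" where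
  "path_of X \<omega> = (\<lambda>t\<in>{0..1}. X t \<omega>)"

lemma measurable_path_of [measurable]:
  "path_of Z \<in> M \<rightarrow>\<^sub>M path_space" "path_of \<Theta> \<in> M \<rightarrow>\<^sub>M path_space"
  unfolding path_of_def[abs_def]
  by (rule measurable_path measurable_Z continuous_Z measurable_\<Theta> continuous_\<Theta> | assumption)+

lemma P_eq: "P = distr M path_space (path_of Z)" and Q_eq: "Q = distr M path_space (path_of \<Theta>)"
  by (simp_all add: path_law_def path_of_def[abs_def])

lemma prob_space_P: "prob_space P" and prob_space_Q: "prob_space Q"
  unfolding P_eq Q_eq by (rule prob_space_distr; measurable)+

lemma girsanov_exponent_path_of:
  "girsanov_exponent \<gamma> u n (path_of X \<omega>) = girsanov_exponent \<gamma> u n (\<lambda>t. X t \<omega>)"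
  by (rule girsanov_exponent_cong) (use grid_mem in \<open>auto simp: path_of_def\<close>)

definition exponent :: "nat \<Rightarrow> (real \<Rightarrow> 'a) \<Rightarrow> real" where
  "exponent n w = girsanov_exponent \<gamma> u n w"

lemma measurable_exponent [measurable]: "exponent n \<in> borel_measurable path_space"
  unfolding exponent_def[abs_def] by (rule measurable_girsanov_exponent) (rule measurable_path_eval)

lemma measurable_exponent_euler [measurable]: "(\<lambda>\<omega>. exponent n (euler a m \<omega>)) \<in> borel_measurable M"
  unfolding exponent_def by (rule measurable_girsanov_exponent) (rule measurable_euler)

lemma AE_exponent_increments:
  "AE \<omega> in M. \<forall>n m. n \<le> m \<longrightarrow> exponent n (grid_path m (increments m \<omega>)) = exponent n (path_of Z \<omega>)"
  unfolding exponent_def girsanov_exponent_path_of by (rule AE_girsanov_exponent_increments)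

abbreviation dens :: "nat \<Rightarrow> (real \<Rightarrow> 'a) \<Rightarrow> real" where
  "dens n w \<equiv> exp (exponent n w)"

text \<open>The change of measure for functionals that see the path through two exponents only.
  Normalisation, affinity and entropy are the choices of \<open>f\<close> made below.\<close>

lemma nn_integral_euler_exponents:
  assumes "a \<le> m" "c \<le> m" and [measurable]: "(\<lambda>(x, y). f x y) \<in> borel_measurable (borel \<Otimes>\<^sub>M borel)"
  shows "(\<integral>\<^sup>+\<omega>. f (exponent a (euler a m \<omega>)) (exponent c (euler a m \<omega>)) \<partial>M)
       = (\<integral>\<^sup>+w. f (exponent a w) (exponent c w) * ennreal (dens a w) \<partial>P)"
proof -
  have [measurable]: "(\<lambda>\<eta>. exponent n (grid_path m \<eta>)) \<in> borel_measurable (PiM {..<2^m} (\<lambda>_. borel))" for n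
    unfolding exponent_def by (intro measurable_girsanov_exponent measurable_grid_path)
  have "(\<integral>\<^sup>+\<omega>. f (exponent a (euler a m \<omega>)) (exponent c (euler a m \<omega>)) \<partial>M)
     = (\<integral>\<^sup>+\<omega>. f (exponent a (grid_path m (increments m \<omega>))) (exponent c (grid_path m (increments m \<omega>)))
         * ennreal (exp (girsanov_exponent \<gamma> u a (grid_path m (increments m \<omega>)))) \<partial>M)"
    by (rule nn_integral_euler[OF assms(1)]) measurable
  also have "\<dots> = (\<integral>\<^sup>+\<omega>. f (exponent a (path_of Z \<omega>)) (exponent c (path_of Z \<omega>))
         * ennreal (exp (exponent a (path_of Z \<omega>))) \<partial>M)"
    unfolding exponent_def[symmetric]
    by (rule nn_integral_cong_AE) (use AE_exponent_increments in \<open>eventually_elim, use assms in simp\<close>)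
  also have "\<dots> = (\<integral>\<^sup>+w. f (exponent a w) (exponent c w) * ennreal (dens a w) \<partial>P)"
    unfolding P_eq by (rule nn_integral_distr[symmetric]) measurable
  finally show ?thesis .
qed

text \<open>Taking \<open>f = 1\<close>, the total mass of the density is that of \<open>M\<close>.
  No Novikov-type condition enters, as only finitely many Gaussian translations are
  composed.\<close>

lemma integrable_exp_exponent: "integrable P (\<lambda>w. dens n w)"
  and integral_exp_exponent: "(\<integral>w. dens n w \<partial>P) = 1"
proof -
  have "(\<integral>\<^sup>+w. ennreal (dens n w) \<partial>P) = 1"
    using nn_integral_euler_exponents[of n n n "\<lambda>_ _. 1"] by (simp add: emeasure_space_1)
  then show "integrable P (\<lambda>w. dens n w)" "(\<integral>w. dens n w \<partial>P) = 1"
    using integrable_nonneg_of_nn_integral[of "\<lambda>w. dens n w" P 1] by auto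
qed

lemma integrable_exponent_euler:
  assumes "a \<le> m" "c \<le> m"
  shows "integrable M (\<lambda>\<omega>. exponent c (euler a m \<omega>))"
  unfolding exponent_def by (rule expectation_girsanov_exponent_euler(1)[OF assms])

text \<open>The integral is the Hellinger affinity of the laws of two Euler schemes, and the gap term is half
  their relative entropy; this replaces Pinsker's inequality.\<close>

lemma affinity_ge:
  assumes "a \<le> m" "c \<le> m"
  shows "integrable P (\<lambda>w. exp ((exponent a w + exponent c w) / 2))"
    and "1 - expectation (drift_gap a c m) / (4 * \<gamma>) \<le> (\<integral>w. exp ((exponent a w + exponent c w) / 2) \<partial>P)"
proof -
  show int: "integrable P (\<lambda>w. exp ((exponent a w + exponent c w) / 2))"
  proof (rule Bochner_Integration.integrable_bound)
    show "integrable P (\<lambda>w. dens a w + dens c w)"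
      using integrable_exp_exponent by simp
    have "exp ((x + y) / 2) \<le> exp x + exp y" for x y :: real
      by (rule order_trans[of _ "exp (max x y)"]) (auto simp: max_def)
    then show "AE w in P. norm (exp ((exponent a w + exponent c w) / 2)) \<le> norm (dens a w + dens c w)"
      by simp
  qed measurable
  \<comment> \<open>Half the log-likelihood ratio of the two schemes under the law of scheme
    \<open>a\<close>: the mean of \<open>exp Y\<close> is the affinity, the mean of \<open>Y\<close>
    is minus half the relative entropy.\<close>
  define Y where "Y \<omega> = (exponent c (euler a m \<omega>) - exponent a (euler a m \<omega>)) / 2" for \<omega>
  have Y: "integrable M Y"
    unfolding Y_def using assms integrable_exponent_euler[of a m] by simp
  have EY: "expectation Y = - expectation (drift_gap a c m) / (4 * \<gamma>)"
    unfolding Y_def exponent_def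
    using assms expectation_girsanov_exponent_euler[OF assms] expectation_girsanov_exponent_euler[OF assms(1) assms(1)]
    by (simp add: drift_gap_same diff_divide_distrib)
  have "(\<integral>\<^sup>+\<omega>. ennreal (exp (Y \<omega>)) \<partial>M) = (\<integral>\<^sup>+w. ennreal (exp ((exponent a w + exponent c w) / 2)) \<partial>P)"
    unfolding Y_def
    by (subst nn_integral_euler_exponents[OF assms, of "\<lambda>x y. ennreal (exp ((y - x) / 2))"])
       (auto simp: ennreal_mult[symmetric] exp_add[symmetric] field_simps intro!: nn_integral_cong)
  also have "\<dots> = ennreal (\<integral>w. exp ((exponent a w + exponent c w) / 2) \<partial>P)"
    by (rule nn_integral_eq_integral[OF int]) simp
  finally have eY: "integrable M (\<lambda>\<omega>. exp (Y \<omega>))" "expectation (\<lambda>\<omega>. exp (Y \<omega>)) = (\<integral>w. exp ((exponent a w + exponent c w) / 2) \<partial>P)"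
    using integrable_nonneg_of_nn_integral[of "\<lambda>\<omega>. exp (Y \<omega>)" M "\<integral>w. exp ((exponent a w + exponent c w) / 2) \<partial>P"] Y
    by (auto simp: Bochner_Integration.integral_nonneg)
  \<comment> \<open>The tangent line of \<open>exp\<close> at 0 does the work of Jensen's
    inequality.\<close>
  have "expectation (\<lambda>\<omega>. 1 + Y \<omega>) \<le> expectation (\<lambda>\<omega>. exp (Y \<omega>))"
    using Y eY(1) by (intro integral_mono) (auto intro: exp_ge_add_one_self)
  then show "1 - expectation (drift_gap a c m) / (4 * \<gamma>) \<le> (\<integral>w. exp ((exponent a w + exponent c w) / 2) \<partial>P)"
    using Y by (simp add: eY(2) EY prob_space)
qed

lemma L1_Cauchy_exp_exponent:
  assumes "\<epsilon> > 0"
  shows "\<exists>N. \<forall>a\<ge>N. \<forall>c\<ge>N. (\<integral>w. norm (dens a w - dens c w) \<partial>P) < \<epsilon>"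
proof -
  \<comment> \<open>The weight \<open>s\<close> makes the second term
    \<open>2 * s = \<epsilon> / 2\<close>; the threshold \<open>d\<close> for the gap then makes the
    Hellinger term smaller than \<open>\<epsilon> / 4\<close>.\<close>
  define s where "s = \<epsilon> / 4"
  have s: "s > 0" using assms by (simp add: s_def)
  define d where "d = s * \<epsilon> * \<gamma>"
  have d: "d > 0" using s assms \<gamma>_pos by (simp add: d_def)
  obtain N where N: "\<And>a c m. N \<le> a \<Longrightarrow> N \<le> c \<Longrightarrow> a \<le> m \<Longrightarrow> c \<le> m \<Longrightarrow> expectation (drift_gap a c m) < d"
    using drift_gap_small[OF d] by blast
  show ?thesis
  proof (intro exI allI impI)
    fix a c assume ac: "N \<le> a" "N \<le> c"
    let ?m = "max a c"
    let ?A = "\<integral>w. exp ((exponent a w + exponent c w) / 2) \<partial>P"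
    note int = integrable_exp_exponent[of a] integrable_exp_exponent[of c] affinity_ge(1)[of a ?m c]
    have "(\<integral>w. norm (dens a w - dens c w) \<partial>P)
       \<le> (\<integral>w. (dens a w + dens c w - 2 * exp ((exponent a w + exponent c w) / 2)) / (2 * s)
             + s * (dens a w + dens c w) \<partial>P)"
      using int by (intro integral_mono) (auto intro: abs_exp_diff_le[OF s])
    also have "\<dots> = (2 - 2 * ?A) / (2 * s) + s * 2"
      using int by (simp add: integral_exp_exponent)
    also have "\<dots> < \<epsilon>"
    proof -
      have "1 - ?A \<le> expectation (drift_gap a c ?m) / (4 * \<gamma>)" using affinity_ge(2)[of a ?m c] by simp
      also have "\<dots> < d / (4 * \<gamma>)" using N[OF ac, of ?m] \<gamma>_pos by (intro divide_strict_right_mono) auto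
      also have "\<dots> = s * \<epsilon> / 4" using \<gamma>_pos by (simp add: d_def)
      finally have "(1 - ?A) / s < s * \<epsilon> / 4 / s" using s by (intro divide_strict_right_mono)
      also have "\<dots> = \<epsilon> / 4" using s by simp
      finally have "(1 - ?A) / s < \<epsilon> / 4" .
      moreover have "(2 - 2 * ?A) / (2 * s) = (1 - ?A) / s" using s by (simp add: field_simps)
      moreover have "s * 2 = \<epsilon> / 2" by (simp add: s_def)
      ultimately show ?thesis using assms by (simp only:)
    qed
    finally show "(\<integral>w. norm (dens a w - dens c w) \<partial>P) < \<epsilon>" .
  qed
qed

text \<open>A subsequence is Cauchy almost everywhere, which produces the limit; Fatou's lemma
  applied to the Cauchy estimate upgrades this to convergence in L1. Almost sure convergence is kept
  in the conclusion, as the entropy bound needs it.\<close>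

lemma ex_L1_limit:
  "\<exists>L r. L \<in> borel_measurable path_space \<and> (\<forall>w. 0 \<le> L w) \<and> strict_mono r \<and> integrable P L \<and>
     (AE w in P. (\<lambda>i. dens (r i) w) \<longlonglongrightarrow> L w) \<and>
     (\<lambda>i. \<integral>w. norm (dens (r i) w - L w) \<partial>P) \<longlonglongrightarrow> 0"
proof -
  obtain r where r: "strict_mono r" and Cauchy: "AE w in P. Cauchy (\<lambda>i. dens (r i) w)"
    using cauchy_L1_AE_cauchy_subseq[where s = "\<lambda>n w. dens n w",
        OF integrable_exp_exponent L1_Cauchy_exp_exponent] by blast
  \<comment> \<open>The maximum secures nonnegativity on the null set where the sequence diverges
    and \<open>lim\<close> is arbitrary.\<close>
  define L where "L w = max 0 (lim (\<lambda>i. dens (r i) w))" for w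
  have L[measurable]: "L \<in> borel_measurable path_space"
    unfolding L_def[abs_def] by measurable
  have lim: "AE w in P. (\<lambda>i. dens (r i) w) \<longlonglongrightarrow> L w"
    using Cauchy
  proof eventually_elim
    case (elim w)
    then have *: "(\<lambda>i. dens (r i) w) \<longlonglongrightarrow> lim (\<lambda>i. dens (r i) w)"
      by (simp add: Cauchy_convergent_iff convergent_LIMSEQ_iff)
    moreover have "0 \<le> lim (\<lambda>i. dens (r i) w)"
      by (rule LIMSEQ_le_const[OF *]) auto
    ultimately show ?case by (simp add: L_def)
  qed
  have fatou: "\<exists>N. \<forall>i\<ge>N. (\<integral>\<^sup>+w. ennreal (norm (dens (r i) w - L w)) \<partial>P) \<le> ennreal \<epsilon>" if \<epsilon>: "\<epsilon> > 0" for \<epsilon>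
  proof -
    obtain N where N: "\<And>a c. N \<le> a \<Longrightarrow> N \<le> c \<Longrightarrow> (\<integral>w. norm (dens a w - dens c w) \<partial>P) < \<epsilon>"
      using L1_Cauchy_exp_exponent[OF \<epsilon>] by blast
    show ?thesis
    proof (intro exI allI impI)
      fix i assume i: "N \<le> i"
      have ri: "N \<le> r j" if "N \<le> j" for j using that seq_suble[OF r, of j] by simp
      have "(\<integral>\<^sup>+w. ennreal (norm (dens (r i) w - L w)) \<partial>P)
          = (\<integral>\<^sup>+w. liminf (\<lambda>j. ennreal (norm (dens (r i) w - dens (r j) w))) \<partial>P)"
      proof (rule nn_integral_cong_AE, use lim in eventually_elim)
        case (elim w)
        then have "(\<lambda>j. ennreal (norm (dens (r i) w - dens (r j) w))) \<longlonglongrightarrow> ennreal (norm (dens (r i) w - L w))"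
          by (intro tendsto_intros)
        then show ?case by (rule lim_imp_Liminf[OF sequentially_bot, symmetric])
      qed
      also have "\<dots> \<le> liminf (\<lambda>j. \<integral>\<^sup>+w. ennreal (norm (dens (r i) w - dens (r j) w)) \<partial>P)"
        by (rule nn_integral_liminf) measurable
      also have "\<dots> \<le> ennreal \<epsilon>"
      proof (rule Liminf_le)
        show "\<forall>\<^sub>F j in sequentially. (\<integral>\<^sup>+w. ennreal (norm (dens (r i) w - dens (r j) w)) \<partial>P) \<le> ennreal \<epsilon>"
        proof (rule eventually_sequentiallyI[of N])
          fix j assume "N \<le> j"
          then show "(\<integral>\<^sup>+w. ennreal (norm (dens (r i) w - dens (r j) w)) \<partial>P) \<le> ennreal \<epsilon>"
            using N[OF ri[OF i] ri, of j] integrable_exp_exponent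
            by (subst nn_integral_eq_integral) (auto intro: ennreal_leI)
        qed
      qed simp
      finally show "(\<integral>\<^sup>+w. ennreal (norm (dens (r i) w - L w)) \<partial>P) \<le> ennreal \<epsilon>" .
    qed
  qed
  have int: "integrable P L"
  proof -
    obtain i where i: "(\<integral>\<^sup>+w. ennreal (norm (dens (r i) w - L w)) \<partial>P) \<le> ennreal 1"
      using fatou[of 1] by auto
    have "integrable P (\<lambda>w. dens (r i) w - L w)"
      by (rule integrableI_bounded) (use i in \<open>auto intro: le_less_trans\<close>)
    from Bochner_Integration.integrable_diff[OF integrable_exp_exponent[of "r i"] this] show ?thesis by simp
  qed
  have "(\<lambda>i. \<integral>w. norm (dens (r i) w - L w) \<partial>P) \<longlonglongrightarrow> 0"
  proof (rule LIMSEQ_I)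
    fix \<epsilon> :: real assume "\<epsilon> > 0"
    then obtain N where N: "\<And>i. i \<ge> N \<Longrightarrow> (\<integral>\<^sup>+w. ennreal (norm (dens (r i) w - L w)) \<partial>P) \<le> ennreal (\<epsilon> / 2)"
      using fatou[of "\<epsilon> / 2"] half_gt_zero by blast
    show "\<exists>no. \<forall>i\<ge>no. norm ((\<integral>w. norm (dens (r i) w - L w) \<partial>P) - 0) < \<epsilon>"
    proof (intro exI allI impI)
      fix i assume i: "i \<ge> N"
      have "ennreal (\<integral>w. norm (dens (r i) w - L w) \<partial>P) = (\<integral>\<^sup>+w. ennreal (norm (dens (r i) w - L w)) \<partial>P)"
        using int integrable_exp_exponent by (intro nn_integral_eq_integral[symmetric]) auto
      with N[OF i] have "ennreal (\<integral>w. norm (dens (r i) w - L w) \<partial>P) \<le> ennreal (\<epsilon> / 2)"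
        by (simp only:)
      then have "(\<integral>w. norm (dens (r i) w - L w) \<partial>P) \<le> \<epsilon> / 2"
        by (rule ennreal_le_iff[THEN iffD1, rotated]) (use \<open>\<epsilon> > 0\<close> in simp)
      moreover have "0 \<le> (\<integral>w. norm (dens (r i) w - L w) \<partial>P)"
        by (rule Bochner_Integration.integral_nonneg) simp
      ultimately show "norm ((\<integral>w. norm (dens (r i) w - L w) \<partial>P) - 0) < \<epsilon>"
        using \<open>\<epsilon> > 0\<close> by simp
    qed
  qed
  then show ?thesis using L r int lim by (intro exI[of _ L] exI[of _ r]) (auto simp: L_def)
qed

text \<open>The scheme is constant between grid points, so under \<open>P\<close> the path has to be
  read at \<open>dyadic_floor n t\<close>; continuity of paths removes this in the limit.\<close>

lemma integral_euler_product:
  assumes J: "finite J" "J \<subseteq> {0..1}" and h: "\<And>t. continuous_on UNIV (h t)" "\<And>t x. 0 \<le> h t x \<and> h t x \<le> (1::real)"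
  shows "expectation (\<lambda>\<omega>. \<Prod>t\<in>J. h t (euler n n \<omega> t))
       = (\<integral>w. (\<Prod>t\<in>J. h t (w (dyadic_floor n t))) * dens n w \<partial>P)"
proof -
  have hm: "h t \<in> borel_measurable borel" for t using h(1) by (rule borel_measurable_continuous_onI)
  have m1: "(\<lambda>\<omega>. \<Prod>t\<in>J. h t (euler n n \<omega> t)) \<in> borel_measurable M"
    using J by (intro borel_measurable_prod measurable_compose[OF measurable_euler hm]) auto
  have m2: "(\<lambda>w. (\<Prod>t\<in>J. h t (w (dyadic_floor n t)))) \<in> borel_measurable path_space"
    using J by (intro borel_measurable_prod measurable_compose[OF measurable_path_eval hm] dyadic_floor_mem) auto
  have m3: "(\<lambda>\<eta>. \<Prod>t\<in>J. h t (grid_path n \<eta> t)) \<in> borel_measurable (PiM {..<2^n} (\<lambda>_. borel))"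
    using J by (intro borel_measurable_prod measurable_compose[OF measurable_grid_path hm]) auto
  have nonneg: "0 \<le> (\<Prod>t\<in>J. h t (w t))" for w using h(2) by (intro prod_nonneg) auto
  have "(\<integral>\<^sup>+\<omega>. ennreal (\<Prod>t\<in>J. h t (euler n n \<omega> t)) \<partial>M)
     = (\<integral>\<^sup>+\<omega>. ennreal (\<Prod>t\<in>J. h t (grid_path n (increments n \<omega>) t))
         * ennreal (exp (girsanov_exponent \<gamma> u n (grid_path n (increments n \<omega>)))) \<partial>M)"
    by (rule nn_integral_euler[OF order_refl, of "\<lambda>w. ennreal (\<Prod>t\<in>J. h t (w t))"])
       (rule measurable_compose[OF m3 measurable_ennreal])
  also have "\<dots> = (\<integral>\<^sup>+\<omega>. ennreal (\<Prod>t\<in>J. h t (path_of Z \<omega> (dyadic_floor n t)))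
         * ennreal (exp (exponent n (path_of Z \<omega>))) \<partial>M)"
    unfolding exponent_def[symmetric]
  proof (rule nn_integral_cong_AE, use AE_exponent_increments AE_grid_path_increments in eventually_elim)
    case (elim \<omega>)
    have "(\<Prod>t\<in>J. h t (grid_path n (increments n \<omega>) t)) = (\<Prod>t\<in>J. h t (path_of Z \<omega> (dyadic_floor n t)))"
    proof (rule prod.cong[OF refl])
      fix t assume "t \<in> J"
      then have t: "t \<in> {0..1}" using J by auto
      show "h t (grid_path n (increments n \<omega>) t) = h t (path_of Z \<omega> (dyadic_floor n t))"
        using elim(2) t dyadic_floor_mem[OF t, of n] by (simp add: path_of_def)
    qed
    then show ?case using elim(1) by simp
  qed
  also have "\<dots> = (\<integral>\<^sup>+w. ennreal ((\<Prod>t\<in>J. h t (w (dyadic_floor n t))) * dens n w) \<partial>P)"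
    unfolding P_eq using m2
    by (subst nn_integral_distr) (auto simp: ennreal_mult'' intro!: measurable_compose[OF _ measurable_ennreal] borel_measurable_times)
  finally show ?thesis
    using m1 m2 nonneg h(2)
    by (subst (1 2) integral_eq_nn_integral) (auto intro!: borel_measurable_times prod_nonneg mult_nonneg_nonneg)
qed

text \<open>The change of measure for the schemes is passed to the limit on both sides: on
  \<open>M\<close> by pathwise convergence of the schemes, under \<open>P\<close> by L1 convergence
  of the densities.\<close>

lemma Q_eq_density:
  assumes L[measurable]: "L \<in> borel_measurable path_space" and L0: "\<And>w. 0 \<le> L w" and r: "strict_mono r"
    and int: "integrable P L"
    and lim: "(\<lambda>i. \<integral>w. norm (dens (r i) w - L w) \<partial>P) \<longlonglongrightarrow> 0"
  shows "Q = density P (\<lambda>w. ennreal (L w))"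
proof (rule path_measure_eqI)
  interpret P: prob_space P by (rule prob_space_P)
  interpret Q: prob_space Q by (rule prob_space_Q)
  show "finite_measure Q" by unfold_locales
  have "emeasure (density P (\<lambda>w. ennreal (L w))) (space (density P (\<lambda>w. ennreal (L w)))) = (\<integral>\<^sup>+w. ennreal (L w) \<partial>P)"
    by (subst emeasure_density) (auto intro!: nn_integral_cong simp: indicator_def)
  also have "\<dots> = ennreal (\<integral>w. L w \<partial>P)"
    using int L0 by (intro nn_integral_eq_integral) auto
  finally show "finite_measure (density P (\<lambda>w. ennreal (L w)))"
    by (intro finite_measureI) simp
  fix J :: "real set" and h :: "real \<Rightarrow> 'a \<Rightarrow> real"
  assume J: "finite J" "J \<subseteq> {0..1}" and h: "\<And>t. continuous_on UNIV (h t)" "\<And>t x. 0 \<le> h t x \<and> h t x \<le> 1"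
  have hm: "h t \<in> borel_measurable borel" for t using h(1) by (rule borel_measurable_continuous_onI)
  have bound: "\<bar>\<Prod>t\<in>J. h t (w t)\<bar> \<le> 1" "0 \<le> (\<Prod>t\<in>J. h t (w t))" "(\<Prod>t\<in>J. h t (w t)) \<le> 1" for w
    using h(2) by (auto simp: abs_prod intro!: prod_le_1 prod_nonneg)
  have me[measurable]: "(\<lambda>w. (\<Prod>t\<in>J. h t (w (f t)))) \<in> borel_measurable path_space" if "\<And>t. t \<in> J \<Longrightarrow> f t \<in> {0..1}" for f
    using that by (intro borel_measurable_prod measurable_compose[OF measurable_path_eval hm]) auto
  define \<phi> where "\<phi> w = (\<Prod>t\<in>J. h t (w t))" for w
  define \<phi>n where "\<phi>n n w = (\<Prod>t\<in>J. h t (w (dyadic_floor n t)))" for n w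
  have \<phi>: "\<bar>\<phi> w\<bar> \<le> 1" "0 \<le> \<phi> w" "\<phi> w \<le> 1" for w unfolding \<phi>_def by (rule bound)+
  have \<phi>n: "\<bar>\<phi>n n w\<bar> \<le> 1" "0 \<le> \<phi>n n w" "\<phi>n n w \<le> 1" for n w
    unfolding \<phi>n_def using bound[of "\<lambda>t. w (dyadic_floor n t)"] by auto
  have [measurable]: "\<phi> \<in> borel_measurable path_space" "\<phi>n n \<in> borel_measurable path_space" for n
    unfolding \<phi>_def[abs_def] \<phi>n_def[abs_def] using J by (intro me dyadic_floor_mem; auto)+
  have lhs: "(\<lambda>i. expectation (\<lambda>\<omega>. \<phi> (euler (r i) (r i) \<omega>))) \<longlonglongrightarrow> expectation (\<lambda>\<omega>. \<phi> (path_of \<Theta> \<omega>))"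
  proof (rule integral_dominated_convergence)
    show "AE \<omega> in M. (\<lambda>i. \<phi> (euler (r i) (r i) \<omega>)) \<longlonglongrightarrow> \<phi> (path_of \<Theta> \<omega>)"
      using AE_euler_tendsto
    proof eventually_elim
      case (elim \<omega>)
      show ?case
        unfolding \<phi>_def
      proof (rule tendsto_prod)
        fix t assume "t \<in> J"
        then have t: "t \<in> {0..1}" using J by auto
        have "(\<lambda>i. euler (r i) (r i) \<omega> t) \<longlonglongrightarrow> \<Theta> t \<omega>"
          using LIMSEQ_subseq_LIMSEQ[OF elim[rule_format, OF t] r] by (simp add: o_def)
        from continuous_on_tendsto_compose[OF h(1) this]
        show "(\<lambda>i. h t (euler (r i) (r i) \<omega> t)) \<longlonglongrightarrow> h t (path_of \<Theta> \<omega> t)" using t by (simp add: path_of_def)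
      qed
    qed
    show "(\<lambda>\<omega>. \<phi> (euler (r i) (r i) \<omega>)) \<in> borel_measurable M" for i
      unfolding \<phi>_def using J by (intro borel_measurable_prod measurable_compose[OF measurable_euler hm]) auto
    show "(\<lambda>\<omega>. \<phi> (path_of \<Theta> \<omega>)) \<in> borel_measurable M" by measurable
    show "integrable M (\<lambda>_. 1::real)" by simp
  qed (use \<phi> in auto)
  have rhs: "(\<lambda>i. \<integral>w. \<phi>n (r i) w * dens (r i) w \<partial>P) \<longlonglongrightarrow> (\<integral>w. \<phi> w * L w \<partial>P)"
  proof -
    have i1: "integrable P (\<lambda>w. \<phi>n n w * dens m w)" "integrable P (\<lambda>w. \<phi>n n w * L w)" "integrable P (\<lambda>w. \<phi> w * L w)" for n m
      by (rule Bochner_Integration.integrable_bound[OF integrable_exp_exponent[of m]] Bochner_Integration.integrable_bound[OF int];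
          use \<phi> \<phi>n L0 in \<open>auto simp: abs_mult intro!: mult_left_le_one_le\<close>)+
    \<comment> \<open>Density and test function vary together. The density is replaced first,
      uniformly over test functions bounded by 1; then the density is fixed and the test functions
      converge pointwise.\<close>
    have d0: "(\<lambda>i. (\<integral>w. \<phi>n (r i) w * dens (r i) w \<partial>P) - (\<integral>w. \<phi>n (r i) w * L w \<partial>P)) \<longlonglongrightarrow> 0"
    proof (rule Lim_null_comparison[OF always_eventually lim], rule allI)
      fix i
      have "(\<integral>w. \<phi>n (r i) w * dens (r i) w \<partial>P) - (\<integral>w. \<phi>n (r i) w * L w \<partial>P)
          = (\<integral>w. \<phi>n (r i) w * (dens (r i) w - L w) \<partial>P)"
        using i1 by (subst Bochner_Integration.integral_diff[symmetric]) (auto simp: right_diff_distrib)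
      also have "norm \<dots> \<le> (\<integral>w. norm (\<phi>n (r i) w * (dens (r i) w - L w)) \<partial>P)"
        by (rule integral_norm_bound)
      also have "\<dots> \<le> (\<integral>w. norm (dens (r i) w - L w) \<partial>P)"
      proof (intro integral_mono integrable_norm)
        show "integrable P (\<lambda>w. \<phi>n (r i) w * (dens (r i) w - L w))"
          using Bochner_Integration.integrable_diff[OF i1(1)[of "r i" "r i"] i1(2)[of "r i"]]
          by (simp add: right_diff_distrib)
        show "integrable P (\<lambda>w. dens (r i) w - L w)" using int integrable_exp_exponent by simp
      qed (simp add: abs_mult mult_left_le_one_le \<phi>n)
      finally show "norm ((\<integral>w. \<phi>n (r i) w * dens (r i) w \<partial>P) - (\<integral>w. \<phi>n (r i) w * L w \<partial>P))
          \<le> (\<integral>w. norm (dens (r i) w - L w) \<partial>P)" .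
    qed
    have d1: "(\<lambda>i. \<integral>w. \<phi>n (r i) w * L w \<partial>P) \<longlonglongrightarrow> (\<integral>w. \<phi> w * L w \<partial>P)"
    proof (rule integral_dominated_convergence[OF _ _ int])
      show "AE w in P. (\<lambda>i. \<phi>n (r i) w * L w) \<longlonglongrightarrow> \<phi> w * L w"
        using AE_space
      proof eventually_elim
        case (elim w)
        then have w: "continuous_on {0..1} w" by (intro continuous_path) simp
        have "(\<lambda>n. \<phi>n n w) \<longlonglongrightarrow> \<phi> w"
          unfolding \<phi>n_def \<phi>_def
        proof (rule tendsto_prod)
          fix t assume "t \<in> J"
          then have t: "t \<in> {0..1}" using J by auto
          have "(\<lambda>n. w (dyadic_floor n t)) \<longlonglongrightarrow> w t"
            by (rule continuous_on_tendsto_compose[OF w tendsto_dyadic_floor])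
               (use t dyadic_floor_mem[OF t] in auto)
          from continuous_on_tendsto_compose[OF h(1) this]
          show "(\<lambda>n. h t (w (dyadic_floor n t))) \<longlonglongrightarrow> h t (w t)" by simp
        qed
        from LIMSEQ_subseq_LIMSEQ[OF this r] show ?case by (intro tendsto_intros) (simp add: o_def)
      qed
      show "AE w in P. norm (\<phi>n (r i) w * L w) \<le> L w" for i
        using \<phi>n L0 by (auto simp: abs_mult intro!: mult_left_le_one_le)
    qed measurable
    from tendsto_add[OF d0 d1] show ?thesis by simp
  qed
  have "expectation (\<lambda>\<omega>. \<phi> (euler n n \<omega>)) = (\<integral>w. \<phi>n n w * dens n w \<partial>P)" for n
    unfolding \<phi>_def \<phi>n_def by (rule integral_euler_product[OF J h])
  with lhs rhs have "expectation (\<lambda>\<omega>. \<phi> (path_of \<Theta> \<omega>)) = (\<integral>w. \<phi> w * L w \<partial>P)"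
    by (auto intro: LIMSEQ_unique)
  moreover have "(\<integral>w. \<phi> w \<partial>Q) = expectation (\<lambda>\<omega>. \<phi> (path_of \<Theta> \<omega>))"
    unfolding Q_eq by (rule integral_distr) measurable
  moreover have "(\<integral>w. \<phi> w \<partial>density P (\<lambda>w. ennreal (L w))) = (\<integral>w. \<phi> w * L w \<partial>P)"
    using L0 by (subst integral_density) (auto simp: mult.commute)
  ultimately show "(\<integral>w. (\<Prod>t\<in>J. h t (w t)) \<partial>Q) = (\<integral>w. (\<Prod>t\<in>J. h t (w t)) \<partial>density P (\<lambda>w. ennreal (L w)))"
    by (simp add: \<phi>_def)
qed simp_all

end

section \<open>The relative entropy of the path laws\<close>

text \<open>\<open>L\<close> is a version of the Radon-Nikodym derivative. Its logarithm is weighted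
  by \<open>L\<close>, so the convention for \<open>ln 0\<close> does not affect the
  integral.\<close>

lemma KL_density_eq:
  fixes L :: "'b \<Rightarrow> real"
  assumes "sigma_finite_measure P" and L[measurable]: "L \<in> borel_measurable P" and L0: "\<And>w. 0 \<le> L w"
    and int: "integrable P (\<lambda>w. L w * ln (L w))"
  shows "KL (density P (\<lambda>w. ennreal (L w))) P = ereal (\<integral>w. L w * ln (L w) \<partial>P)"
proof -
  interpret sigma_finite_measure P by fact
  let ?Q = "density P (\<lambda>w. ennreal (L w))"
  have ac: "absolutely_continuous P ?Q" by (rule absolutely_continuousI_density) measurable
  have log: "log (exp 1) x = ln x" for x :: real by (simp add: log_def)
  have RN: "AE w in P. ennreal (L w) = RN_deriv P ?Q w"
    by (rule RN_deriv_unique) simp_all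
  have "integrable P (\<lambda>w. L w *\<^sub>R entropy_density (exp 1) P ?Q w)"
  proof (rule integrable_cong_AE_imp[OF int])
    show "AE w in P. L w * ln (L w) = L w *\<^sub>R entropy_density (exp 1) P ?Q w"
      using RN
    proof eventually_elim
      case (elim w)
      then show ?case by (simp add: entropy_density_def log elim[symmetric] L0)
    qed
  qed measurable
  then have "integrable ?Q (entropy_density (exp 1) P ?Q)"
    using L0 by (subst integrable_density) auto
  moreover have "KL_divergence (exp 1) P ?Q = (\<integral>w. L w * ln (L w) \<partial>P)"
    using KL_density[of "exp 1" L] L0 by (simp add: log)
  ultimately show ?thesis using ac by (simp add: KL_def)
qed

text \<open>Integrates the Fenchel inequality \<open>l * F + l \<le> l * ln l + exp F\<close>, a
  form of \<open>ln z \<le> z - 1\<close> at \<open>z = exp F / l\<close>. The masses stay on both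
  sides; they cancel when \<open>L\<close> and \<open>exp F\<close> are probability
  densities.\<close>

lemma integral_times_exponent_le_entropy:
  fixes L F :: "'b \<Rightarrow> real"
  assumes L0: "\<And>w. 0 \<le> L w" and int: "integrable P (\<lambda>w. L w * ln (L w))" "integrable P (\<lambda>w. L w * F w)"
    "integrable P L" "integrable P (\<lambda>w. exp (F w))"
  shows "(\<integral>w. L w * F w \<partial>P) + (\<integral>w. L w \<partial>P) \<le> (\<integral>w. L w * ln (L w) \<partial>P) + (\<integral>w. exp (F w) \<partial>P)"
proof -
  have *: "L w * F w + L w \<le> L w * ln (L w) + exp (F w)" for w
  proof (cases "L w = 0")
    case False
    then have l: "L w > 0" using L0[of w] by simp
    have "ln (exp (F w) / L w) \<le> exp (F w) / L w - 1" using l by (intro ln_le_minus_one) auto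
    then have "L w * (F w - ln (L w)) \<le> L w * (exp (F w) / L w - 1)"
      using l by (intro mult_left_mono) (auto simp: ln_div)
    also have "\<dots> = exp (F w) - L w" using l by (simp add: right_diff_distrib)
    finally show ?thesis by (simp add: algebra_simps)
  qed simp
  have "(\<integral>w. L w * F w + L w \<partial>P) \<le> (\<integral>w. L w * ln (L w) + exp (F w) \<partial>P)"
    using int * by (intro integral_mono) auto
  then show ?thesis using int by simp
qed

context controlled_diffusion
begin

text \<open>The added 1 is written as \<open>exp (- x) * exp x\<close> with \<open>x\<close> the
  exponent. The entropy integrand then becomes \<open>x + exp (- x)\<close>, which is nonnegative
  and so can be transferred by a nonnegative integral.\<close>

lemma nn_integral_entropy_exponent:
  "(\<integral>\<^sup>+w. ennreal (dens n w * ln (dens n w) + 1) \<partial>P)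
     = ennreal (expectation (\<lambda>\<omega>. exponent n (euler n n \<omega>)) + 1)"
proof -
  have pos: "0 \<le> x + exp (- x)" for x :: real using exp_ge_add_one_self[of "- x"] by simp
  have "(\<integral>\<^sup>+\<omega>. ennreal (exp (- exponent n (euler n n \<omega>))) \<partial>M)
      = (\<integral>\<^sup>+w. ennreal (exp (- exponent n w)) * ennreal (dens n w) \<partial>P)"
    by (rule nn_integral_euler_exponents[of n n n "\<lambda>x y. ennreal (exp (- x))"]) auto
  also have "\<dots> = (\<integral>\<^sup>+w. 1 \<partial>P)"
    by (intro nn_integral_cong) (simp add: ennreal_mult[symmetric] exp_add[symmetric])
  also have "\<dots> = ennreal 1" using prob_space.emeasure_space_1[OF prob_space_P] by simp
  finally have e: "integrable M (\<lambda>\<omega>. exp (- exponent n (euler n n \<omega>)))" "expectation (\<lambda>\<omega>. exp (- exponent n (euler n n \<omega>))) = 1"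
    using integrable_nonneg_of_nn_integral[of "\<lambda>\<omega>. exp (- exponent n (euler n n \<omega>))" M 1] by auto
  have "(\<integral>\<^sup>+w. ennreal (dens n w * ln (dens n w) + 1) \<partial>P)
      = (\<integral>\<^sup>+w. ennreal (exponent n w + exp (- exponent n w)) * ennreal (dens n w) \<partial>P)"
  proof (rule nn_integral_cong)
    fix w
    have "(exponent n w + exp (- exponent n w)) * dens n w = dens n w * ln (dens n w) + 1"
      by (simp add: distrib_right exp_minus)
    then show "ennreal (dens n w * ln (dens n w) + 1)
        = ennreal (exponent n w + exp (- exponent n w)) * ennreal (dens n w)"
      by (simp only: ennreal_mult[OF pos exp_ge_zero, symmetric])
  qed
  also have "\<dots> = (\<integral>\<^sup>+\<omega>. ennreal (exponent n (euler n n \<omega>) + exp (- exponent n (euler n n \<omega>))) \<partial>M)"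
    by (rule nn_integral_euler_exponents[of n n n "\<lambda>x y. ennreal (x + exp (- x))", symmetric]) auto
  also have "\<dots> = ennreal (expectation (\<lambda>\<omega>. exponent n (euler n n \<omega>) + exp (- exponent n (euler n n \<omega>))))"
    using e integrable_exponent_euler[of n n n] pos by (intro nn_integral_eq_integral) auto
  finally show ?thesis using e integrable_exponent_euler[of n n n] by simp
qed

theorem KL_path_law: "KL Q P = ereal control_cost"
proof -
  interpret P: prob_space P by (rule prob_space_P)
  interpret Q: prob_space Q by (rule prob_space_Q)
  obtain L r where L: "L \<in> borel_measurable path_space" "\<And>w. 0 \<le> L w" and r: "strict_mono r" and int: "integrable P L"
    and AE: "AE w in P. (\<lambda>i. dens (r i) w) \<longlonglongrightarrow> L w"
    and L1: "(\<lambda>i. \<integral>w. norm (dens (r i) w - L w) \<partial>P) \<longlonglongrightarrow> 0"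
    using ex_L1_limit by blast
  note L(1)[measurable]
  have Q: "Q = density P (\<lambda>w. ennreal (L w))" by (rule Q_eq_density[OF L r int L1])
  have L_1: "(\<integral>w. L w \<partial>P) = 1"
  proof -
    have "ennreal (\<integral>w. L w \<partial>P) = (\<integral>\<^sup>+w. ennreal (L w) \<partial>P)"
      using int L(2) by (intro nn_integral_eq_integral[symmetric]) auto
    also have "\<dots> = emeasure Q (space P)"
      unfolding Q by (subst emeasure_density) (auto intro!: nn_integral_cong simp: indicator_def)
    also have "\<dots> = 1" using Q.emeasure_space_1 by simp
    finally show ?thesis using L(2) by (simp add: Bochner_Integration.integral_nonneg)
  qed
  have cost: "(\<lambda>i. expectation (\<lambda>\<omega>. exponent (r i) (euler (r i) (r i) \<omega>)) + 1) \<longlonglongrightarrow> control_cost + 1"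
    using LIMSEQ_subseq_LIMSEQ[OF expectation_girsanov_exponent_tendsto r]
    by (intro tendsto_add tendsto_const) (simp add: exponent_def o_def)
  have "(\<integral>\<^sup>+w. ennreal (L w * ln (L w) + 1) \<partial>P)
      = (\<integral>\<^sup>+w. liminf (\<lambda>i. ennreal (dens (r i) w * ln (dens (r i) w) + 1)) \<partial>P)"
  proof (rule nn_integral_cong_AE, use AE in eventually_elim)
    case (elim w)
    have "(\<lambda>i. ennreal (dens (r i) w * ln (dens (r i) w) + 1)) \<longlonglongrightarrow> ennreal (L w * ln (L w) + 1)"
      by (intro tendsto_ennrealI tendsto_add tendsto_const tendsto_x_ln_x[OF elim]) simp
    then show ?case by (rule lim_imp_Liminf[OF sequentially_bot, symmetric])
  qed
  also have "\<dots> \<le> liminf (\<lambda>i. \<integral>\<^sup>+w. ennreal (dens (r i) w * ln (dens (r i) w) + 1) \<partial>P)"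
    by (rule nn_integral_liminf) measurable
  also have "\<dots> = ennreal (control_cost + 1)"
    unfolding nn_integral_entropy_exponent
    by (rule lim_imp_Liminf[OF sequentially_bot tendsto_ennrealI[OF cost]])
  finally have le: "(\<integral>\<^sup>+w. ennreal (L w * ln (L w) + 1) \<partial>P) \<le> ennreal (control_cost + 1)" .
  have nn: "0 \<le> L w * ln (L w) + 1" for w by (rule x_ln_x_plus_one_nonneg[OF L(2)])
  \<comment> \<open>Finiteness of the Fatou bound gives integrability of the entropy, so that
    \<open>KL\<close> is in its finite case.\<close>
  have int1: "integrable P (\<lambda>w. L w * ln (L w) + 1)"
    by (rule integrableI_bounded) (use le nn in \<open>auto intro: le_less_trans\<close>)
  from Bochner_Integration.integrable_diff[OF this, of "\<lambda>_. 1"]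
  have int_ent: "integrable P (\<lambda>w. L w * ln (L w))" by simp
  have cost0: "0 \<le> control_cost"
    using \<gamma>_pos by (simp add: control_cost_def energy_nonneg Bochner_Integration.integral_nonneg)
  have "ennreal (\<integral>w. L w * ln (L w) + 1 \<partial>P) \<le> ennreal (control_cost + 1)"
    using le nn_integral_eq_integral[OF int1] nn by simp
  then have "(\<integral>w. L w * ln (L w) + 1 \<partial>P) \<le> control_cost + 1"
    using cost0 by (subst (asm) ennreal_le_iff) auto
  then have upper: "(\<integral>w. L w * ln (L w) \<partial>P) \<le> control_cost"
    using int_ent P.prob_space by simp
  \<comment> \<open>The test function in the Gibbs inequality is the exponent of one level
    \<open>n\<close>, whose exponential has mass 1 under \<open>P\<close> and whose mean under
    \<open>Q\<close> is within \<epsilon> below the cost.\<close>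
  have "control_cost \<le> (\<integral>w. L w * ln (L w) \<partial>P)"
  proof (rule field_le_epsilon)
    fix \<epsilon> :: real assume "\<epsilon> > 0"
    then obtain n where n: "control_cost - \<epsilon> \<le> expectation (\<lambda>\<omega>. exponent n (path_of \<Theta> \<omega>))"
      using expectation_girsanov_exponent_\<Theta>_ge unfolding exponent_def girsanov_exponent_path_of by blast
    have intQ: "integrable Q (exponent n)"
      unfolding Q_eq using girsanov_exponent_\<Theta>(1)[of n]
      by (subst integrable_distr_eq) (auto simp: exponent_def girsanov_exponent_path_of)
    then have intLF: "integrable P (\<lambda>w. L w * exponent n w)"
      unfolding Q using L(2) by (subst (asm) integrable_density) auto
    have "expectation (\<lambda>\<omega>. exponent n (path_of \<Theta> \<omega>)) = (\<integral>w. exponent n w \<partial>Q)"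
      unfolding Q_eq by (rule integral_distr[symmetric]) measurable
    also have "\<dots> = (\<integral>w. L w * exponent n w \<partial>P)"
      unfolding Q using L(2) by (subst integral_density) auto
    also have "\<dots> \<le> (\<integral>w. L w * ln (L w) \<partial>P)"
      using integral_times_exponent_le_entropy[OF L(2) int_ent intLF int integrable_exp_exponent]
      by (simp add: L_1 integral_exp_exponent)
    finally show "control_cost \<le> (\<integral>w. L w * ln (L w) \<partial>P) + \<epsilon>" using n by linarith
  qed
  with upper have "(\<integral>w. L w * ln (L w) \<partial>P) = control_cost" by simp
  with KL_density_eq[OF P.sigma_finite_measure_axioms _ L(2) int_ent] show ?thesis
    unfolding Q[symmetric] by simp
qed

lemma energy_path_of: "energy (path_of \<Theta> \<omega>) = energy (\<lambda>t. \<Theta> t \<omega>)"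
  unfolding energy_def set_lebesgue_integral_def
  by (intro Bochner_Integration.integral_cong refl) (auto simp: path_of_def indicator_def)

lemma measurable_energy_path: "energy \<in> borel_measurable path_space"
  by (rule measurable_energy) (auto intro: continuous_path measurable_path_eval)

lemma integrable_energy_Q: "integrable Q energy"
  unfolding Q_eq using integrable_energy measurable_energy_path
  by (subst integrable_distr_eq) (auto simp: energy_path_of)

lemma integral_energy_Q: "(\<integral>w. energy w \<partial>Q) / (2 * \<gamma>) = control_cost"
  unfolding Q_eq control_cost_def using measurable_energy_path
  by (subst integral_distr) (auto simp: energy_path_of)

end

section \<open>The objective as a negative ELBO\<close>

text \<open>Relations between the positive and negative parts of \<open>a - r\<close> and
  \<open>r\<close> in additive form, since subtraction in \<open>ennreal\<close> is truncated and
  these have to survive integration with infinite values.\<close>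

lemma ennreal_diff_parts:
  assumes "0 \<le> a"
  shows "ennreal (a - r) + ennreal r = ennreal a + ennreal (- r) + ennreal (r - a)"
    and "ennreal (a - r) \<le> ennreal a + ennreal (- r)" and "ennreal (r - a) \<le> ennreal r"
proof -
  consider "r < 0" | "0 \<le> r" "r \<le> a" | "a < r" by linarith
  then have *: "ennreal (a - r) + ennreal r = ennreal a + ennreal (- r) + ennreal (r - a)
    \<and> ennreal (a - r) \<le> ennreal a + ennreal (- r)"
  proof cases
    case 1
    then have "ennreal (a - r) = ennreal a + ennreal (- r)"
      using assms ennreal_plus[of a "- r"] by simp
    then show ?thesis using 1 assms by (simp add: ennreal_neg)
  next
    case 2
    then have "ennreal a = ennreal (a - r) + ennreal r"
      using ennreal_plus[of "a - r" r] by simp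
    then show ?thesis using 2 by (simp add: ennreal_neg)
  next
    case 3
    then have "ennreal r = ennreal a + ennreal (r - a)"
      using assms ennreal_plus[of a "r - a"] by simp
    then show ?thesis using 3 assms by (simp add: ennreal_neg)
  qed
  then show "ennreal (a - r) + ennreal r = ennreal a + ennreal (- r) + ennreal (r - a)"
    "ennreal (a - r) \<le> ennreal a + ennreal (- r)" by auto
  show "ennreal (r - a) \<le> ennreal r" using assms by (intro ennreal_leI) simp
qed

text \<open>\<open>g\<close> may have an infinite mean of either sign, so positive and negative
  parts are integrated separately. The integrable \<open>e\<close> shifts them by finite amounts,
  and \<open>has_eexpectation\<close> excludes the case where both are infinite.\<close>

lemma eexpectation_diff:
  fixes e :: "'b \<Rightarrow> real" and g :: "'b \<Rightarrow> ereal"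
  assumes e: "integrable N e" "\<And>w. 0 \<le> e w" and g[measurable]: "g \<in> borel_measurable N"
    and fin: "\<And>w. g w \<noteq> \<infinity>" and ex: "has_eexpectation N g"
  shows "eexpectation N (\<lambda>w. ereal (e w) - g w) = ereal (\<integral>w. e w \<partial>N) - eexpectation N g"
proof -
  define f where "f w = ereal (e w) - g w" for w
  have [measurable]: "e \<in> borel_measurable N" using e(1) by auto
  have [measurable]: "f \<in> borel_measurable N" unfolding f_def[abs_def] by measurable
  define fp fm gp gm where "fp = (\<integral>\<^sup>+w. e2ennreal (f w) \<partial>N)" and "fm = (\<integral>\<^sup>+w. e2ennreal (- f w) \<partial>N)"
    and "gp = (\<integral>\<^sup>+w. e2ennreal (g w) \<partial>N)" and "gm = (\<integral>\<^sup>+w. e2ennreal (- g w) \<partial>N)"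
  define E where "E = (\<integral>w. e w \<partial>N)"
  have E: "(\<integral>\<^sup>+w. ennreal (e w) \<partial>N) = ennreal E" "0 \<le> E"
    unfolding E_def using e by (auto intro!: nn_integral_eq_integral Bochner_Integration.integral_nonneg)
  have pw: "e2ennreal (f w) + e2ennreal (g w) = ennreal (e w) + e2ennreal (- g w) + e2ennreal (- f w)"
    "e2ennreal (f w) \<le> ennreal (e w) + e2ennreal (- g w)" "e2ennreal (- f w) \<le> e2ennreal (g w)" for w
    using e(2)[of w] fin[of w] ennreal_diff_parts[of "e w" "real_of_ereal (g w)"]
    unfolding f_def by (cases "g w"; simp add: e2ennreal_neg)+
  have "fp + gp = ennreal E + gm + fm"
    unfolding fp_def fm_def gp_def gm_def E(1)[symmetric]
    by (simp add: nn_integral_add[symmetric] pw(1))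
  moreover have "fp \<le> ennreal E + gm"
    unfolding fp_def gm_def E(1)[symmetric] by (subst nn_integral_add[symmetric]) (auto intro!: nn_integral_mono pw)
  moreover have "fm \<le> gp" unfolding fm_def gp_def by (intro nn_integral_mono pw)
  moreover have "gp < \<infinity> \<or> gm < \<infinity>" using ex unfolding has_eexpectation_def gp_def gm_def .
  ultimately have "enn2ereal fp - enn2ereal fm = ereal E - (enn2ereal gp - enn2ereal gm)"
    using E(2)
    by (cases fp; cases fm; cases gp; cases gm)
       (auto simp: ennreal_plus[symmetric] enn2ereal_ennreal top_unique simp del: ennreal_plus)
  then show ?thesis
    by (simp add: eexpectation_def fp_def fm_def gp_def gm_def E_def f_def)
qed

lemma measurable_eln [measurable]: "eln \<in> borel_measurable borel"
  unfolding eln_def[abs_def] by measurable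

lemma admissible_controls_regular:
  fixes u :: "real \<Rightarrow> 'a::euclidean_space \<Rightarrow> 'a"
  assumes "u \<in> admissible_controls"
  obtains C where "regular_drift u C"
proof -
  obtain u' :: "real \<times> 'a \<Rightarrow> (real \<times> 'a) \<Rightarrow>\<^sub>L 'a" and C
    where d: "\<And>z. z \<in> {0..1} \<times> UNIV \<Longrightarrow> (case_prod u has_derivative blinfun_apply (u' z)) (at z within {0..1} \<times> UNIV)"
      and c: "continuous_on ({0..1} \<times> UNIV) u'" and C: "\<forall>t\<in>{0..1}. \<forall>x. norm (u t x) \<le> C * (1 + norm x)"
    using assms unfolding admissible_controls_def by blast
  have "regular_drift u C"
  proof
    fix R :: real
    let ?S = "{0..1::real} \<times> cball (0::'a) R"
    have "compact (u' ` ?S)"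
      by (intro compact_continuous_image continuous_on_subset[OF c] compact_Times) auto
    then have "bounded (u' ` ?S)" by (rule compact_imp_bounded)
    then obtain K where K: "\<forall>z\<in>?S. norm (u' z) \<le> K" unfolding bounded_iff by blast
    show "\<exists>L\<ge>0. \<forall>s\<in>{0..1}. \<forall>t\<in>{0..1}. \<forall>x\<in>cball 0 R. \<forall>y\<in>cball 0 R.
        norm (u s x - u t y) \<le> L * (\<bar>s - t\<bar> + norm (x - y))"
    proof (intro exI[of _ "max K 0"] conjI ballI)
      fix s t :: real and x y :: 'a assume st: "s \<in> {0..1}" "t \<in> {0..1::real}" and xy: "x \<in> cball 0 R" "y \<in> cball 0 R"
      have "norm (case_prod u (s, x) - case_prod u (t, y)) \<le> K * norm ((s, x) - (t, y))"
      proof (rule differentiable_bound[where f' = "\<lambda>z. blinfun_apply (u' z)"])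
        show "convex ?S" by (intro convex_Times) auto
        show "(case_prod u has_derivative blinfun_apply (u' z)) (at z within ?S)" if "z \<in> ?S" for z
          using that by (intro has_derivative_subset[OF d]) auto
        show "onorm (blinfun_apply (u' z)) \<le> K" if "z \<in> ?S" for z
          using bspec[OF K that] unfolding norm_blinfun.rep_eq .
      qed (use st xy in auto)
      also have "\<dots> \<le> max K 0 * (\<bar>s - t\<bar> + norm (x - y))"
        using norm_Pair_le[of "s - t" "x - y"] by (intro mult_mono) auto
      finally show "norm (u s x - u t y) \<le> max K 0 * (\<bar>s - t\<bar> + norm (x - y))" by simp
    qed simp
  qed (use C in auto)
  then show thesis by (rule that)
qed

text \<open>The prior cancels against the Gaussian reference density, which leaves the control cost
  minus the log-likelihood; the claim is then that the cost equals the divergence from Wiener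
  measure. The mean log-likelihood may be infinite, and \<open>has_eexpectation\<close> ensures that
  it is defined.\<close>

theorem mainTheorem3:
  fixes \<gamma> :: real
    and M :: "'w measure"
    and B \<Theta> Z :: "real \<Rightarrow> 'w \<Rightarrow> real ^ 'd"
    and u :: "real \<Rightarrow> real ^ 'd \<Rightarrow> real ^ 'd"
    and prior :: "real ^ 'd \<Rightarrow> real"
    and \<nu> :: "'x measure"
    and p :: "'x \<Rightarrow> real ^ 'd \<Rightarrow> real"
    and N :: nat
    and x :: "nat \<Rightarrow> 'x"
  assumes "\<gamma> > 0"
    and "observation_model \<nu> p"
    and "\<forall>i\<in>{1..N}. x i \<in> space \<nu>"
    and "\<forall>\<theta>. prior \<theta> = gaussian_density \<gamma> \<theta>"
    and "standard_brownian_motion M B"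
    and "u \<in> admissible_controls"
    and "sde_solution M B \<gamma> u \<Theta>"
    and "sde_solution M B \<gamma> (\<lambda>_ _. 0) Z"
    and "has_eexpectation (path_law M \<Theta>) (\<lambda>w. eln (likelihood p N x (w 1)))"
  shows "control_objective \<gamma> prior (likelihood p N x) u (path_law M \<Theta>)
       = - elbo (likelihood p N x) (path_law M Z) (path_law M \<Theta>)"
proof -
  obtain C where "regular_drift u C"
    using admissible_controls_regular[OF assms(6)] by blast
  moreover have "prob_space M" using assms(5) by (simp add: standard_brownian_motion_def)
  ultimately interpret controlled_diffusion M B u C \<gamma> \<Theta> Z
    using assms by (simp add: controlled_diffusion_def controlled_diffusion_axioms_def
        brownian_motion_def brownian_motion_axioms_def)
  define g where "g w = eln (likelihood p N x (w 1))" for w :: "real \<Rightarrow> real ^ 'd"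
  have "case_prod p \<in> borel_measurable (\<nu> \<Otimes>\<^sub>M borel)"
    using assms(2) by (simp add: observation_model_def)
  then have "p (x i) \<in> borel_measurable borel" if "i \<in> {1..N}" for i
    using assms(3) that measurable_Pair2[of "case_prod p" \<nu> borel borel "x i"] by simp
  then have "likelihood p N x \<in> borel_measurable borel"
    unfolding likelihood_def[abs_def] by (intro borel_measurable_prod) auto
  then have g: "g \<in> borel_measurable path_space"
    unfolding g_def[abs_def]
    by (intro measurable_compose[OF _ measurable_eln] measurable_compose[OF measurable_path_eval]) auto
  have "likelihood p N x \<theta> * prior \<theta> / gaussian_density \<gamma> \<theta> = likelihood p N x \<theta>" for \<theta>
    using assms(4) gaussian_density_pos[OF assms(1), of \<theta>] by simp
  then have "control_objective \<gamma> prior (likelihood p N x) u (path_law M \<Theta>)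
      = eexpectation (path_law M \<Theta>) (\<lambda>w. ereal (1 / (2 * \<gamma>) * energy w) - g w)"
    by (simp add: control_objective_def energy_def g_def)
  also have "\<dots> = ereal (\<integral>w. 1 / (2 * \<gamma>) * energy w \<partial>path_law M \<Theta>) - eexpectation (path_law M \<Theta>) g"
  proof (rule eexpectation_diff)
    show "integrable (path_law M \<Theta>) (\<lambda>w. 1 / (2 * \<gamma>) * energy w)" using integrable_energy_Q by simp
    show "g w \<noteq> \<infinity>" for w by (simp add: g_def eln_def)
    show "has_eexpectation (path_law M \<Theta>) g" using assms(9) by (simp add: g_def[abs_def])
    show "g \<in> borel_measurable (path_law M \<Theta>)" using g by (simp cong: measurable_cong_sets)
  qed (use assms(1) energy_nonneg in simp)
  also have "(\<integral>w. 1 / (2 * \<gamma>) * energy w \<partial>path_law M \<Theta>) = control_cost"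
    unfolding integral_energy_Q[symmetric] by simp
  \<comment> \<open>The sign distributes over the difference because the divergence is a finite
    number.\<close>
  also have "ereal control_cost - eexpectation (path_law M \<Theta>) g
      = - (eexpectation (path_law M \<Theta>) g - KL (path_law M \<Theta>) (path_law M Z))"
    unfolding KL_path_law by (simp add: ereal_minus_diff_eq)
  finally show ?thesis by (simp add: elbo_def g_def[abs_def])
qed

end
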